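(* Let $N\ge 1$, let $\mathbb{M}$ be a second-countable locally compact Hausdorff space, let $\Phi$ be a stationary marked point process on $\mathbb{R}^N$ with marks in $\mathbb{M}$ whose ground process has all finite moments, and let $\kappa:\mathscr{F}(\mathbb{R}^N\times\mathbb{M})\to[0,\infty]$ be a filtration function (for marked point sets). Assume that $\Phi$ has intensity $\lambda\in(0,\infty]$ and that $\kappa$ is finite-valued, i.e. $\kappa(\sigma)<\infty$ for all $\sigma\in\mathscr{F}(\mathbb{R}^N\times\mathbb{M})$. For $q\ge0$ let $\nu_q'=\nu_q'(\kappa,\Phi)$ be the limiting verbose diagram measure on $\Delta'$. Then $$\nu_q'(\Delta')=\begin{cases}\lambda,&\text{if } q=0,\\ \infty,&\text{if } q\ge1.\end{cases}$$
   Context: **Limiting measure.** $\nu_q'=\nu_q'(\kappa,\Phi)$ is the unique Radon measure on $\Delta'$ such that for every convex averaging sequence $\{\Lambda_n\}_n$ in $\mathbb{R}^N$, $\frac{1}{\mathrm{vol}(\Lambda_n)}\mathbb{E}[\xi^{\kappa}_{\mathrm{Ver},q,\Lambda_n}]\xrightarrow{v}\nu_q'$ as $n\to\infty$ (its existence and uniqueness is a theorem valid for every stationary $\Phi$ and filtration function $\kappa$ as in the claim). The notions involved are as follows. **Measures.** For a second-countable locally compact Hausdorff space $S$, $\mathscr{R}(S)$ is the set of Radon measures on $S$ (Borel measures finite on compact sets); $\mu_n\xrightarrow{v}\mu$ (vague convergence) iff $\int f\,d\mu_n\to\int f\,d\mu$ for every continuous compactly supported $f:S\to\mathbb{R}$.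 $\mathscr{N}(S)\subset\mathscr{R}(S)$ is the set of integer-valued measures (sums of Dirac measures), identified with locally finite multisets. A point process on $S$ is an $\mathscr{N}(S)$-valued random variable (Borel $\sigma$-algebra of the vague topology). It is simple if a.s. every point has mass at most $1$. $\mathbb{E}[\xi](A):=\mathbb{E}[\xi(A)]$. $\mathrm{vol}$ is Lebesgue measure. **Marked point processes.** A marked point process on $\mathbb{R}^N$ with marks in $\mathbb{M}$ is a point process $\Phi$ on $\mathbb{R}^N\times\mathbb{M}$ whose ground process $\Phi_g(A):=\Phi(A\times\mathbb{M})$ is simple. The ground process has all finite moments if $\mathbb{E}[\Phi_g(A)^k]<\infty$ for all bounded Borel $A\subset\mathbb{R}^N$ and integers $k\ge1$. $\Phi$ is stationary if its distribution is invariant under the translations $\mu\mapsto\mu^{(v)}$, $\mu^{(v)}(A):=\mu(A+v)$, $A+v:=\{(x+v,m):(x,m)\in A\}$, $v\in\mathbb{R}^N$. Its intensity is $\mathbb{E}[\Phi([0,1)^N\times\mathbb{M})]\in[0,\infty]$. For bounded Borel $\Lambda\subset\mathbb{R}^N$, $\Phi_\Lambda(\cdot):=\Phi(\cdot\cap(\Lambda\times\mathbb{M}))$; almost surely it is identified with a finite simple marked point set, i.e. a finite subset $X$ of $\mathbb{R}^N\times\mathbb{M}$ having at most one point over each $x\in\mathbb{R}^N$. **Convex averaging sequence.** A sequence $\{\Lambda_n\}_n$ of bounded convex Borel sets in $\mathbb{R}^N$ with $\Lambda_n\subset\Lambda_m$ for $n\le m$ and $\sup_n r(\Lambda_n)=\infty$,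 where $r(\Lambda)$ is the supremum of the radii of open balls contained in $\Lambda$. **Filtration functions.** $\mathscr{F}(S)$ is the set of nonempty finite subsets of $S$. A function $f$ on $\mathscr{F}(\mathbb{R}^N\times\mathbb{M})$ is measurable if for each $k\ge1$ there is a permutation-invariant measurable $\tilde f_k$ on $(\mathbb{R}^N\times\mathbb{M})^k$ with $f(\{x_1,\dots,x_k\})=\tilde f_k(x_1,\dots,x_k)$. A filtration function for marked point sets is a measurable $\kappa:\mathscr{F}(\mathbb{R}^N\times\mathbb{M})\to[0,\infty]$ such that: (1) $\kappa(\sigma)\le\kappa(\tau)$ if $\sigma\subset\tau$; (2) $\kappa(\sigma)=\kappa(\sigma+x)$ for all $x\in\mathbb{R}^N$, where $\sigma+x=\{(y+x,m):(y,m)\in\sigma\}$; (3) there is an increasing $\rho:[0,\infty]\to[0,\infty]$ with $\rho(t)<\infty$ for finite $t$ and $\|x-y\|\le\rho(\kappa(\{(x,m),(y,n)\}))$ for all $(x,m),(y,n)$. The $\kappa$-filtration on a finite simple marked point set $X$ is $\mathbb{K}^\kappa(X)=\{K^\kappa(X,t)\}_{t\ge0}$, $K^\kappa(X,t)=\{\emptyset\ne\sigma\subset X:\kappa(\sigma)\le t\}$; it is regarded as a filtration of $\bigcup_{t\ge0}K^\kappa(X,t)$. **Verbose diagrams.** Fix a coefficient field $\mathbb{F}$. Let $\mathbb{K}=\{K_t\}_{t\ge0}$ be an increasing right-continuous family of subcomplexes of a finite simplicial complex $K=\bigcup_tK_t$. Let $(C_*(K),\partial)$ be its (unreduced) simplicial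 chain complex over $\mathbb{F}$, and for a chain $x=\sum_i\lambda_i\sigma_i$ (distinct simplices) put $\ell_{\mathbb{K}}(x)=\max\{t_{\mathbb{K}}(\sigma_i):\lambda_i\ne0\}$, $\ell_{\mathbb{K}}(0)=-\infty$, where $t_{\mathbb{K}}(\sigma)=\inf\{t\ge0:\sigma\in K_t\}$. A finite set $\{x_1,\dots,x_k\}$ of chains is orthogonal if $\ell_{\mathbb{K}}(\sum\lambda_ix_i)=\max\{\ell_{\mathbb{K}}(x_i):\lambda_i\ne0\}$ for all $\lambda_i\in\mathbb{F}$ (with $\max\varnothing=-\infty$). View $\partial_{q+1}$ as a map $C_{q+1}(K)\to\mathrm{Ker}\,\partial_q$, of rank $r$. A singular value decomposition of $\partial_{q+1}$ is a pair $((y_1,\dots,y_n),(x_1,\dots,x_m))$ of ordered orthogonal bases of $C_{q+1}(K)$ and $\mathrm{Ker}\,\partial_q$ such that $(y_{r+1},\dots,y_n)$ is an orthogonal basis of $\mathrm{Ker}\,\partial_{q+1}$, $(x_1,\dots,x_r)$ is an orthogonal basis of $\mathrm{Im}\,\partial_{q+1}$, and $\partial_{q+1}y_i=x_i$ for $i\le r$; one always exists. The degree-$q$ verbose diagram is the multiset consisting of $(\ell_{\mathbb{K}}(x_i),\ell_{\mathbb{K}}(y_i))$ for $i\le r$ and $(\ell_{\mathbb{K}}(x_i),\infty)$ for $r<i\le m$; it does not depend on the decomposition chosen. It is a multiset in $\Delta':=\{(x,y)\in[0,\infty]^2:x\le y\}\setminus\{(\infty,\infty)\}$, where $[0,\infty]$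 has the order topology and $\Delta'$ the subspace topology. $\xi^{\kappa}_{\mathrm{Ver},q,\Lambda}$ denotes the sum of Dirac measures (with multiplicity) at the points of the degree-$q$ verbose diagram of $\mathbb{K}^\kappa(\Phi_\Lambda)$; it is (almost surely defined as) a point process on $\Delta'$. *)

theory Defs
  imports "HOL-Probability.Probability" "HOL-Library.Poly_Mapping"
begin

section \<open>Radon measures, the vague topology and point processes\<close>

text \<open>
  A space is given as a subset \<open>S\<close> of a topological type, with the subspace topology; its Borel
  sets are those of \<open>restrict_space borel S\<close>.
\<close>

definition radon_measures :: "'a::topological_space set \<Rightarrow> 'a measure set" where
  "radon_measures S = {\<mu>. sets \<mu> = sets (restrict_space borel S) \<and>
     (\<forall>C. compact C \<and> C \<subseteq> S \<longrightarrow> emeasure \<mu> C < \<infinity>)}"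

definition integer_measures :: "'a::topological_space set \<Rightarrow> 'a measure set" where
  "integer_measures S = {\<mu> \<in> radon_measures S.
     \<forall>B \<in> sets \<mu>. emeasure \<mu> B = \<infinity> \<or> (\<exists>k::nat. emeasure \<mu> B = of_nat k)}"

definition cont_comp_supp :: "'a::topological_space set \<Rightarrow> ('a \<Rightarrow> real) set" where
  "cont_comp_supp S = {f. continuous_on S f \<and> compact (S \<inter> closure {x \<in> S. f x \<noteq> 0})}"

definition vague_conv ::
  "'a::topological_space set \<Rightarrow> (nat \<Rightarrow> 'a measure) \<Rightarrow> 'a measure \<Rightarrow> bool" where
  "vague_conv S \<mu>s \<mu> \<longleftrightarrow> (\<forall>f \<in> cont_comp_supp S.
     (\<lambda>n. integral\<^sup>L (\<mu>s n) f) \<longlonglongrightarrow> integral\<^sup>L \<mu> f)"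

definition vague_topology :: "'a::topological_space set \<Rightarrow> 'a measure topology" where
  "vague_topology S = topology_generated_by
     {{\<mu> \<in> radon_measures S. integral\<^sup>L \<mu> f \<in> U} | f U. f \<in> cont_comp_supp S \<and> open U}"

definition integer_measure_space :: "'a::topological_space set \<Rightarrow> 'a measure measure" where
  "integer_measure_space S = sigma (integer_measures S)
     {U. openin (subtopology (vague_topology S) (integer_measures S)) U}"

definition point_process ::
  "'w measure \<Rightarrow> 'a::topological_space set \<Rightarrow> ('w \<Rightarrow> 'a measure) \<Rightarrow> bool" where
  "point_process P S \<xi> \<longleftrightarrow> \<xi> \<in> measurable P (integer_measure_space S)"

definition simple_process :: "'w measure \<Rightarrow> ('w \<Rightarrow> 'a measure) \<Rightarrow> bool" where
  "simple_process P \<xi> \<longleftrightarrow> (AE \<omega> in P. \<forall>x. emeasure (\<xi> \<omega>) {x} \<le> 1)"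

definition expected_measure ::
  "'w measure \<Rightarrow> 'a::topological_space set \<Rightarrow> ('w \<Rightarrow> 'a measure) \<Rightarrow> 'a measure" where
  "expected_measure P S \<xi> =
     measure_of S (sets (restrict_space borel S)) (\<lambda>A. \<integral>\<^sup>+\<omega>. emeasure (\<xi> \<omega>) A \<partial>P)"

definition dirac_sum :: "'a::topological_space set \<Rightarrow> 'a multiset \<Rightarrow> 'a measure" where
  "dirac_sum S D =
     measure_of S (sets (restrict_space borel S)) (\<lambda>A. \<Sum>p\<in>#D. indicator A p)"


section \<open>Marked point processes\<close>

definition ground :: "((real^'n) \<times> 'm) measure \<Rightarrow> (real^'n) measure" where
  "ground \<mu> = distr \<mu> borel fst"

text \<open>
  The ground measure of a Radon measure need not be locally finite when the mark space is not
  compact. That the ground process is a point process is required almost surely.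
\<close>

definition marked_point_process ::
  "'w measure \<Rightarrow> ('w \<Rightarrow> ((real^'n) \<times> 'm::topological_space) measure) \<Rightarrow> bool" where
  "marked_point_process P \<Phi> \<longleftrightarrow> point_process P UNIV \<Phi> \<and>
     (AE \<omega> in P. ground (\<Phi> \<omega>) \<in> integer_measures UNIV) \<and>
     simple_process P (\<lambda>\<omega>. ground (\<Phi> \<omega>))"

definition all_finite_moments ::
  "'w measure \<Rightarrow> ('w \<Rightarrow> (real^'n) measure) \<Rightarrow> bool" where
  "all_finite_moments P \<xi> \<longleftrightarrow> (\<forall>A \<in> sets borel. \<forall>k\<ge>1::nat. bounded A \<longrightarrow>
     (\<integral>\<^sup>+\<omega>. emeasure (\<xi> \<omega>) A ^ k \<partial>P) < \<infinity>)"

text \<open>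
  The measure \<open>A \<mapsto> \<mu>(A + v)\<close>: the preimage of \<open>A\<close> under \<open>(x, m) \<mapsto> (x - v, m)\<close> is \<open>A + v\<close>.
\<close>

definition translate_measure ::
  "real^'n \<Rightarrow> ((real^'n) \<times> 'm::topological_space) measure \<Rightarrow> ((real^'n) \<times> 'm) measure" where
  "translate_measure v \<mu> = distr \<mu> borel (\<lambda>(x, m). (x - v, m))"

definition stationary ::
  "'w measure \<Rightarrow> ('w \<Rightarrow> ((real^'n) \<times> 'm::topological_space) measure) \<Rightarrow> bool" where
  "stationary P \<Phi> \<longleftrightarrow> (\<forall>v.
     distr P (integer_measure_space UNIV) (\<lambda>\<omega>. translate_measure v (\<Phi> \<omega>)) =
     distr P (integer_measure_space UNIV) \<Phi>)"

definition intensity :: "'w measure \<Rightarrow> ('w \<Rightarrow> ((real^'n) \<times> 'm) measure) \<Rightarrow> ennreal" where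
  "intensity P \<Phi> = (\<integral>\<^sup>+\<omega>. emeasure (\<Phi> \<omega>) ({x. \<forall>i. 0 \<le> x $ i \<and> x $ i < 1} \<times> UNIV) \<partial>P)"

text \<open>
  The marked point set identified with the restriction of an integer-valued measure to
  \<open>\<Lambda> \<times> UNIV\<close>. For bounded \<open>\<Lambda>\<close> and the processes considered it is almost surely finite with at
  most one point over each location; on the exceptional null set its value is immaterial.
\<close>

definition points_in :: "((real^'n) \<times> 'm) measure \<Rightarrow> (real^'n) set \<Rightarrow> ((real^'n) \<times> 'm) set" where
  "points_in \<mu> \<Lambda> = {z \<in> \<Lambda> \<times> UNIV. emeasure \<mu> {z} \<noteq> 0}"

definition inradius :: "(real^'n) set \<Rightarrow> ennreal" where
  "inradius \<Lambda> = Sup {ennreal r | x r. 0 < r \<and> ball x r \<subseteq> \<Lambda>}"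

definition convex_averaging :: "(nat \<Rightarrow> (real^'n) set) \<Rightarrow> bool" where
  "convex_averaging \<Lambda> \<longleftrightarrow>
     (\<forall>n. bounded (\<Lambda> n) \<and> convex (\<Lambda> n) \<and> \<Lambda> n \<in> sets borel) \<and>
     (\<forall>n m. n \<le> m \<longrightarrow> \<Lambda> n \<subseteq> \<Lambda> m) \<and>
     (SUP n. inradius (\<Lambda> n)) = \<infinity>"


section \<open>Filtration functions\<close>

text \<open>
  Functions on nonempty finite sets are total functions on sets, whose values at the empty set and
  at infinite sets are irrelevant.
\<close>

definition measurable_on_finite_sets :: "('a::topological_space set \<Rightarrow> ennreal) \<Rightarrow> bool" where
  "measurable_on_finite_sets f \<longleftrightarrow> (\<forall>k\<ge>1::nat.
     \<exists>g \<in> borel_measurable (\<Pi>\<^sub>M i\<in>{..<k}. (borel :: 'a measure)).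
       (\<forall>x \<in> {..<k} \<rightarrow>\<^sub>E UNIV. \<forall>p. p permutes {..<k} \<longrightarrow> g (x \<circ> p) = g x) \<and>
       (\<forall>x \<in> {..<k} \<rightarrow>\<^sub>E UNIV. inj_on x {..<k} \<longrightarrow> f (x ` {..<k}) = g x))"

definition filtration_function ::
  "(((real^'n) \<times> 'm::topological_space) set \<Rightarrow> ennreal) \<Rightarrow> bool" where
  "filtration_function \<kappa> \<longleftrightarrow>
     measurable_on_finite_sets \<kappa> \<and>
     (\<forall>\<sigma> \<tau>. \<sigma> \<noteq> {} \<and> finite \<tau> \<and> \<sigma> \<subseteq> \<tau> \<longrightarrow> \<kappa> \<sigma> \<le> \<kappa> \<tau>) \<and>
     (\<forall>\<sigma> x. \<sigma> \<noteq> {} \<and> finite \<sigma> \<longrightarrow> \<kappa> ((\<lambda>(y, m). (y + x, m)) ` \<sigma>) = \<kappa> \<sigma>) \<and>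
     (\<exists>\<rho> :: ennreal \<Rightarrow> ennreal. mono \<rho> \<and> (\<forall>t<\<infinity>. \<rho> t < \<infinity>) \<and>
        (\<forall>x m y n. ennreal (norm (x - y)) \<le> \<rho> (\<kappa> {(x, m), (y, n)})))"

definition kappa_filtration :: "('v set \<Rightarrow> ennreal) \<Rightarrow> 'v set \<Rightarrow> real \<Rightarrow> 'v set set" where
  "kappa_filtration \<kappa> X t = {\<sigma>. \<sigma> \<noteq> {} \<and> \<sigma> \<subseteq> X \<and> \<kappa> \<sigma> \<le> ennreal t}"


section \<open>Simplicial chains and verbose diagrams\<close>

text \<open>
  A filtration is a function \<open>K :: real \<Rightarrow> 'v set set\<close> used only at nonnegative arguments; a complex
  is a set of nonempty finite sets. Chains are formal linear combinations of simplices, each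
  simplex being oriented by an injective numbering \<open>num\<close> of the vertices.
\<close>

definition total_complex :: "(real \<Rightarrow> 'v set set) \<Rightarrow> 'v set set" where
  "total_complex K = (\<Union>t\<in>{0..}. K t)"

definition chain_scale :: "'f::field \<Rightarrow> ('v set \<Rightarrow>\<^sub>0 'f) \<Rightarrow> ('v set \<Rightarrow>\<^sub>0 'f)" where
  "chain_scale a x = Poly_Mapping.map ((*) a) x"

lemma lookup_chain_scale:
  "Poly_Mapping.lookup (chain_scale a x) \<sigma> = a * Poly_Mapping.lookup x \<sigma>"
  by (simp add: chain_scale_def Poly_Mapping.map.rep_eq when_def)

global_interpretation chains: vector_space chain_scale
  by unfold_locales
    (auto intro!: poly_mapping_eqI simp: lookup_chain_scale lookup_add algebra_simps)

definition chain_group :: "nat \<Rightarrow> 'v set set \<Rightarrow> ('v set \<Rightarrow>\<^sub>0 'f::field) set" where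
  "chain_group q K = {x. Poly_Mapping.keys x \<subseteq> {\<sigma> \<in> K. card \<sigma> = q + 1}}"

text \<open>The complex is unreduced: the condition \<open>\<sigma> \<noteq> {v}\<close> makes the boundary of a vertex zero.\<close>

definition boundary :: "('v \<Rightarrow> nat) \<Rightarrow> ('v set \<Rightarrow>\<^sub>0 'f::field) \<Rightarrow> ('v set \<Rightarrow>\<^sub>0 'f)" where
  "boundary num x = (\<Sum>\<sigma>\<in>Poly_Mapping.keys x. \<Sum>v\<in>{v \<in> \<sigma>. \<sigma> \<noteq> {v}}.
     Poly_Mapping.single (\<sigma> - {v})
       ((-1) ^ card {u \<in> \<sigma>. num u < num v} * Poly_Mapping.lookup x \<sigma>))"

definition cycles :: "('v \<Rightarrow> nat) \<Rightarrow> nat \<Rightarrow> 'v set set \<Rightarrow> ('v set \<Rightarrow>\<^sub>0 'f::field) set" where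
  "cycles num q K = {x \<in> chain_group q K. boundary num x = 0}"

definition entry_time :: "(real \<Rightarrow> 'v set set) \<Rightarrow> 'v set \<Rightarrow> ennreal" where
  "entry_time K \<sigma> = Inf {ennreal t | t. 0 \<le> t \<and> \<sigma> \<in> K t}"

definition level :: "(real \<Rightarrow> 'v set set) \<Rightarrow> ('v set \<Rightarrow>\<^sub>0 'f::field) \<Rightarrow> ereal" where
  "level K x = Max (insert (-\<infinity>) ((\<lambda>\<sigma>. enn2ereal (entry_time K \<sigma>)) ` Poly_Mapping.keys x))"

definition orthogonal_chains :: "(real \<Rightarrow> 'v set set) \<Rightarrow> ('v set \<Rightarrow>\<^sub>0 'f::field) set \<Rightarrow> bool" where
  "orthogonal_chains K B \<longleftrightarrow> finite B \<and> (\<forall>c :: ('v set \<Rightarrow>\<^sub>0 'f) \<Rightarrow> 'f.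
     level K (\<Sum>x\<in>B. chain_scale (c x) x) =
     Max (insert (-\<infinity>) (level K ` {x \<in> B. c x \<noteq> 0})))"

definition orthogonal_basis ::
  "(real \<Rightarrow> 'v set set) \<Rightarrow> ('v set \<Rightarrow>\<^sub>0 'f::field) set \<Rightarrow> ('v set \<Rightarrow>\<^sub>0 'f) list \<Rightarrow> bool" where
  "orthogonal_basis K V bs \<longleftrightarrow> distinct bs \<and> \<not> chains.dependent (set bs) \<and>
     chains.span (set bs) = V \<and> orthogonal_chains K (set bs)"

definition boundary_rank :: "'f::field itself \<Rightarrow> ('v \<Rightarrow> nat) \<Rightarrow> nat \<Rightarrow> 'v set set \<Rightarrow> nat" where
  "boundary_rank _ num q K = chains.dim (boundary num ` (chain_group q K :: ('v set \<Rightarrow>\<^sub>0 'f) set))"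

definition is_svd ::
  "(real \<Rightarrow> 'v set set) \<Rightarrow> ('v \<Rightarrow> nat) \<Rightarrow> nat \<Rightarrow>
   ('v set \<Rightarrow>\<^sub>0 'f::field) list \<Rightarrow> ('v set \<Rightarrow>\<^sub>0 'f) list \<Rightarrow> bool" where
  "is_svd K num q ys xs \<longleftrightarrow>
     (let L = total_complex K; r = boundary_rank TYPE('f) num (q + 1) L in
       orthogonal_basis K (chain_group (q + 1) L) ys \<and>
       orthogonal_basis K (cycles num q L) xs \<and>
       orthogonal_basis K (cycles num (q + 1) L) (drop r ys) \<and>
       orthogonal_basis K (boundary num ` chain_group (q + 1) L) (take r xs) \<and>
       (\<forall>i<r. boundary num (ys ! i) = xs ! i))"

text \<open>
  The levels occurring below are those of nonzero chains, so \<open>e2ennreal\<close> does not truncate.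
\<close>

definition svd_diagram ::
  "(real \<Rightarrow> 'v set set) \<Rightarrow> ('v \<Rightarrow> nat) \<Rightarrow> nat \<Rightarrow>
   ('v set \<Rightarrow>\<^sub>0 'f::field) list \<Rightarrow> ('v set \<Rightarrow>\<^sub>0 'f) list \<Rightarrow> (ennreal \<times> ennreal) multiset" where
  "svd_diagram K num q ys xs =
     (let r = boundary_rank TYPE('f) num (q + 1) (total_complex K) in
       mset (map (\<lambda>i. (e2ennreal (level K (xs ! i)),
                       if i < r then e2ennreal (level K (ys ! i)) else \<infinity>))
                 [0..<length xs]))"

text \<open>
  For a filtration of a finite complex the diagram is independent of the numbering and of the
  decomposition chosen.
\<close>

definition verbose_diagram ::
  "'f::field itself \<Rightarrow> nat \<Rightarrow> (real \<Rightarrow> 'v set set) \<Rightarrow> (ennreal \<times> ennreal) multiset" where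
  "verbose_diagram _ q K = (SOME D. \<exists>num (ys :: ('v set \<Rightarrow>\<^sub>0 'f) list) xs.
     inj_on num (\<Union>(total_complex K)) \<and> is_svd K num q ys xs \<and> D = svd_diagram K num q ys xs)"


section \<open>The limiting measure\<close>

definition Delta' :: "(ennreal \<times> ennreal) set" where
  "Delta' = {(x, y). x \<le> y} - {(\<infinity>, \<infinity>)}"

definition verbose_process ::
  "'f::field itself \<Rightarrow> (((real^'n) \<times> 'm) set \<Rightarrow> ennreal) \<Rightarrow> nat \<Rightarrow>
   ('w \<Rightarrow> ((real^'n) \<times> 'm) measure) \<Rightarrow> (real^'n) set \<Rightarrow> 'w \<Rightarrow> (ennreal \<times> ennreal) measure" where
  "verbose_process F \<kappa> q \<Phi> \<Lambda> \<omega> =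
     dirac_sum Delta' (verbose_diagram F q (kappa_filtration \<kappa> (points_in (\<Phi> \<omega>) \<Lambda>)))"

definition limiting_verbose_measure ::
  "'f::field itself \<Rightarrow> 'w measure \<Rightarrow> ('w \<Rightarrow> ((real^'n) \<times> 'm) measure) \<Rightarrow>
   (((real^'n) \<times> 'm) set \<Rightarrow> ennreal) \<Rightarrow> nat \<Rightarrow> (ennreal \<times> ennreal) measure \<Rightarrow> bool" where
  "limiting_verbose_measure F P \<Phi> \<kappa> q \<nu> \<longleftrightarrow> \<nu> \<in> radon_measures Delta' \<and>
     (\<forall>\<Lambda>. convex_averaging \<Lambda> \<longrightarrow>
        vague_conv Delta'
          (\<lambda>n. scale_measure (1 / emeasure lborel (\<Lambda> n))
                 (expected_measure P Delta' (verbose_process F \<kappa> q \<Phi> (\<Lambda> n))))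
          \<nu>)"

end

theory Submission
  imports Defs
begin

text \<open>
  The mass of the limit is already visible in the births. A point of \<open>\<Delta>'\<close> has finite birth, the
  sets \<open>{birth \<le> R}\<close> are compact in \<open>\<Delta>'\<close>, and so \<open>\<nu>(\<Delta>')\<close> is the supremum over \<open>R\<close> of the limits
  of the expected number per volume of births that are at most \<open>R\<close>, up to a continuous cutoff.
  Along cubes tiled by translates of a cube \<open>Q\<close> of side \<open>l\<close>, the boundaries of the cones over a chosen
  vertex in each tile are linearly independent cycles. By stationarity this yields
  \<open>\<nu>(\<Delta>') \<ge> E[c\<^sub>q(\<Phi>(Q))] / l\<^sup>N\<close> with \<open>c\<^sub>0(k) = k\<close> and \<open>c\<^sub>q(k) = (k - 1) choose (q + 1)\<close>; as \<open>\<kappa>\<close> is finite,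
  restricting to the tiles whose points all appear by time \<open>R\<close> loses nothing in the limit. For
  \<open>q = 0\<close> the total number of points gives the matching upper bound \<open>\<lambda>\<close>; for \<open>q \<ge> 1\<close> the function
  \<open>c\<^sub>q\<close> grows faster than linearly and \<open>l \<rightarrow> \<infinity>\<close> gives \<open>\<infinity>\<close>.

  The expected diagram is a measure only if the number of diagram points in a Borel set is a random
  variable. For rectangles this number is the dimension of a space of chains, which depends only on
  the finitely many truth values \<open>\<kappa>(\<sigma>) \<in> I\<close>, and the atoms can be enumerated measurably.
\<close>

section \<open>Chains and the boundary map\<close>

text \<open>A verbose diagram has one point for each vector of an orthogonal basis of the cycle
  space, however short its life, so a lower bound on births needs no control of deaths. As \<kappa>
  is finite, the total complex on k points is the full simplex, and \<open>c\<^sub>q(k)\<close> is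
  exactly the dimension of its q-cycles. Cycles of disjoint tiles are supported on different
  simplices, hence their numbers add up. Two obstacles shape the rest. The diagram is picked by
  \<open>SOME\<close> among all numberings and decompositions, so nothing can be said about it
  before a decomposition is known to exist and its counts are expressed by quantities that depend on
  neither choice. And vague convergence does not control mass that escapes towards infinite births,
  so the limit is taken for a fixed cutoff and a fixed tile size; only afterwards are these sent to
  \<infinity>. The finite moments keep the integrals finite on the way: the Bochner integral of a
  function that is not integrable would be 0.\<close>

abbreviation "keys \<equiv> Poly_Mapping.keys"
abbreviation "lookup \<equiv> Poly_Mapping.lookup"
abbreviation "psingle \<equiv> Poly_Mapping.single"

lemma lookup_chain_sum:
  "lookup (\<Sum>x\<in>B. chain_scale (c x) (g x)) \<sigma> = (\<Sum>x\<in>B. c x * lookup (g x) \<sigma>)"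
  by (simp add: lookup_sum lookup_chain_scale)

lemma chain_scale_single: "chain_scale a (psingle s b) = psingle s (a * b)"
  by (rule poly_mapping_eqI) (simp add: lookup_chain_scale lookup_single when_def)

lemma keys_chain_scale: "keys (chain_scale a x) \<subseteq> keys x"
  by (auto simp: in_keys_iff lookup_chain_scale)

text \<open>The sum defining \<open>boundary\<close> runs over the keys of the chain, which vary
  under addition. Writing boundary and relabelling as linear extensions settles linearity,
  composition and supports for both at once.\<close>

definition lin_ext :: "('v set \<Rightarrow> ('v set \<Rightarrow>\<^sub>0 'f::field)) \<Rightarrow> ('v set \<Rightarrow>\<^sub>0 'f) \<Rightarrow> ('v set \<Rightarrow>\<^sub>0 'f)" where
  "lin_ext g x = (\<Sum>s\<in>keys x. chain_scale (lookup x s) (g s))"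

lemma lin_ext_superset:
  assumes "finite A" "keys x \<subseteq> A"
  shows "lin_ext g x = (\<Sum>s\<in>A. chain_scale (lookup x s) (g s))"
  unfolding lin_ext_def by (rule sum.mono_neutral_left) (use assms in \<open>auto simp: in_keys_iff\<close>)

lemma linear_lin_ext:
  fixes g :: "'v set \<Rightarrow> ('v set \<Rightarrow>\<^sub>0 'f::field)"
  shows "Vector_Spaces.linear chain_scale chain_scale (lin_ext g)"
proof (unfold_locales)
  fix x y :: "'v set \<Rightarrow>\<^sub>0 'f"
  let ?A = "keys x \<union> keys y"
  have "keys (x + y) \<subseteq> ?A" by (rule keys_add)
  then have "lin_ext g (x + y) = (\<Sum>s\<in>?A. chain_scale (lookup (x + y) s) (g s))"
    by (intro lin_ext_superset) auto
  also have "\<dots> = (\<Sum>s\<in>?A. chain_scale (lookup x s) (g s)) + (\<Sum>s\<in>?A. chain_scale (lookup y s) (g s))"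
    by (simp add: lookup_add chains.scale_left_distrib sum.distrib)
  also have "\<dots> = lin_ext g x + lin_ext g y"
    by (subst (1 2) lin_ext_superset[where A = ?A]) auto
  finally show "lin_ext g (x + y) = lin_ext g x + lin_ext g y" .
next
  fix a and x :: "'v set \<Rightarrow>\<^sub>0 'f"
  have "lin_ext g (chain_scale a x) = (\<Sum>s\<in>keys x. chain_scale (lookup (chain_scale a x) s) (g s))"
    by (rule lin_ext_superset) (auto simp: keys_chain_scale[THEN subsetD])
  also have "\<dots> = chain_scale a (lin_ext g x)"
    by (simp add: lin_ext_def lookup_chain_scale chains.scale_sum_right)
  finally show "lin_ext g (chain_scale a x) = chain_scale a (lin_ext g x)" .
qed

lemma lin_ext_single: "lin_ext g (psingle s c) = chain_scale c (g s)"
  by (subst lin_ext_superset[where A = "{s}"]) auto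

lemma lin_ext_sum: "lin_ext g (\<Sum>i\<in>I. chain_scale (c i) (x i)) = (\<Sum>i\<in>I. chain_scale (c i) (lin_ext g (x i)))"
proof -
  interpret L: Vector_Spaces.linear chain_scale chain_scale "lin_ext g" by (rule linear_lin_ext)
  show ?thesis by (simp add: L.sum L.scale)
qed

lemma lin_ext_lin_ext: "lin_ext g (lin_ext k x) = lin_ext (\<lambda>s. lin_ext g (k s)) x"
  by (simp add: lin_ext_def[of k] lin_ext_sum) (simp add: lin_ext_def)

lemma lin_ext_cong: "(\<And>s. s \<in> keys x \<Longrightarrow> g s = k s) \<Longrightarrow> lin_ext g x = lin_ext k x"
  by (simp add: lin_ext_def)

lemma keys_lin_ext: "keys (lin_ext g x) \<subseteq> (\<Union>s\<in>keys x. keys (g s))"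
  unfolding lin_ext_def
  by (rule subset_trans[OF keys_sum]) (use keys_chain_scale in fast)

lemma lin_ext_id: "lin_ext (\<lambda>s. psingle s 1) x = x"
  by (rule poly_mapping_eqI) 
    (auto simp: lin_ext_def lookup_sum lookup_chain_scale lookup_single when_def if_distrib in_keys_iff cong: if_cong)

definition simplex_boundary :: "('v \<Rightarrow> nat) \<Rightarrow> 'v set \<Rightarrow> ('v set \<Rightarrow>\<^sub>0 'f::field)" where
  "simplex_boundary num s = (\<Sum>v\<in>{v \<in> s. s \<noteq> {v}}. psingle (s - {v}) ((-1) ^ card {u \<in> s. num u < num v}))"

lemma boundary_eq_lin_ext: "boundary num = lin_ext (simplex_boundary num)"
  by (rule ext) (simp add: boundary_def lin_ext_def simplex_boundary_def chains.scale_sum_right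
      chain_scale_single mult.commute)

lemma linear_boundary: "Vector_Spaces.linear chain_scale chain_scale (boundary num)"
  by (simp add: boundary_eq_lin_ext linear_lin_ext)

lemma keys_simplex_boundary:
  "keys (simplex_boundary num s) \<subseteq> {s - {v} | v. v \<in> s \<and> s \<noteq> {v}}"
  unfolding simplex_boundary_def
  by (rule subset_trans[OF keys_sum]) (auto split: if_splits)

lemma keys_boundary:
  "keys (boundary num x) \<subseteq> (\<Union>s\<in>keys x. {s - {v} | v. v \<in> s \<and> s \<noteq> {v}})"
  unfolding boundary_eq_lin_ext
  by (rule subset_trans[OF keys_lin_ext]) (intro UN_mono keys_simplex_boundary subset_refl)

text \<open>Deleting two vertices in either order gives the same face with opposite signs, so the
  terms cancel in pairs \<open>(v, w)\<close>, \<open>(w, v)\<close>.\<close>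

lemma boundary_simplex_boundary:
  fixes s :: "'v set"
  assumes "finite s" "inj_on num s"
  shows "boundary num (simplex_boundary num s :: 'v set \<Rightarrow>\<^sub>0 'f::field) = 0"
proof -
  define e :: "'v set \<Rightarrow> 'v \<Rightarrow> 'f" where "e t v = (-1) ^ card {u \<in> t. num u < num v}" for t v
  define F where "F v w = psingle (s - {v} - {w}) (e s v * e (s - {v}) w)" for v w
  \<comment> \<open>The conditions \<open>s \<noteq> {v}\<close> and
    \<open>s - {v} \<noteq> {w}\<close> come from the unreduced boundary; together they are
    symmetric in \<open>v\<close> and \<open>w\<close>.\<close>
  define P where "P = {(v, w). v \<in> s \<and> s \<noteq> {v} \<and> w \<in> s - {v} \<and> s - {v} \<noteq> {w}}"
  have finP: "finite P"
    by (rule finite_subset[of _ "s \<times> s"]) (auto simp: P_def assms)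
  have swapP: "(w, v) \<in> P" if "(v, w) \<in> P" for v w
    using that unfolding P_def by auto
  have "boundary num (simplex_boundary num s :: 'v set \<Rightarrow>\<^sub>0 'f)
      = (\<Sum>v\<in>{v \<in> s. s \<noteq> {v}}. \<Sum>w\<in>{w \<in> s - {v}. s - {v} \<noteq> {w}}. F v w)"
  proof -
    interpret L: Vector_Spaces.linear chain_scale chain_scale "lin_ext (simplex_boundary num)"
      by (rule linear_lin_ext)
    show ?thesis
      unfolding boundary_eq_lin_ext simplex_boundary_def[of num s] L.sum lin_ext_single
      unfolding simplex_boundary_def chains.scale_sum_right chain_scale_single F_def e_def
      by simp
  qed
  also have "\<dots> = (\<Sum>(v, w)\<in>P. F v w)"
    unfolding P_def
    by (subst sum.Sigma) (auto simp: assms intro!: sum.cong)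
  also have "\<dots> = (\<Sum>(v, w)\<in>{(v, w) \<in> P. num v < num w}. F v w) + (\<Sum>(v, w)\<in>{(v, w) \<in> P. num w < num v}. F v w)"
  proof (subst sum.union_disjoint[symmetric])
    have "num v \<noteq> num w" if "(v, w) \<in> P" for v w
      using that assms(2) unfolding P_def inj_on_def by auto
    then have "P = {(v, w) \<in> P. num v < num w} \<union> {(v, w) \<in> P. num w < num v}"
      by (auto simp: neq_iff)
    then show "(\<Sum>(v, w)\<in>P. F v w) = (\<Sum>(v, w)\<in>{(v, w) \<in> P. num v < num w} \<union> {(v, w) \<in> P. num w < num v}. F v w)"
      by simp
  qed (auto intro: finite_subset[OF _ finP])
  also have "(\<Sum>(v, w)\<in>{(v, w) \<in> P. num w < num v}. F v w) = (\<Sum>(v, w)\<in>{(v, w) \<in> P. num v < num w}. F w v)"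
    by (rule sum.reindex_bij_witness[of _ prod.swap prod.swap]) (auto dest: swapP)
  also have "(\<Sum>(v, w)\<in>{(v, w) \<in> P. num v < num w}. F v w) + (\<Sum>(v, w)\<in>{(v, w) \<in> P. num v < num w}. F w v)
     = (\<Sum>(v, w)\<in>{(v, w) \<in> P. num v < num w}. F v w + F w v)"
    by (simp add: sum.distrib[symmetric] case_prod_unfold)
  also have "\<dots> = 0"
  proof (rule sum.neutral, safe)
    fix v w assume vw: "(v, w) \<in> P" "num v < num w"
    then have in_s: "v \<in> s" "w \<in> s" "v \<noteq> w" by (auto simp: P_def)
    \<comment> \<open>Deleting the smaller vertex \<open>v\<close> lowers the position of
      \<open>w\<close> by one; deleting \<open>w\<close> does not move \<open>v\<close>.\<close>
    have "{u \<in> s. num u < num w} = insert v {u \<in> s - {v}. num u < num w}"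
      using vw in_s by auto
    then have "card {u \<in> s. num u < num w} = Suc (card {u \<in> s - {v}. num u < num w})"
      using assms(1) by simp
    then have 1: "e s w = - e (s - {v}) w" by (simp add: e_def)
    have "{u \<in> s - {w}. num u < num v} = {u \<in> s. num u < num v}" using vw by auto
    then have 2: "e (s - {w}) v = e s v" by (simp add: e_def)
    have "s - {w} - {v} = s - {v} - {w}" by auto
    then show "F v w + F w v = 0"
      by (simp add: F_def 1 2 single_add[symmetric] mult.commute)
  qed
  finally show ?thesis .
qed

lemma boundary_boundary:
  assumes "\<And>s. s \<in> keys x \<Longrightarrow> finite s \<and> inj_on num s"
  shows "boundary num (boundary num x) = (0 :: 'v set \<Rightarrow>\<^sub>0 'f::field)"
proof -
  have "boundary num (boundary num x) = lin_ext (\<lambda>s. boundary num (simplex_boundary num s)) x"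
    by (simp add: boundary_eq_lin_ext lin_ext_lin_ext)
  also have "\<dots> = lin_ext (\<lambda>s. 0) x"
    using assms by (intro lin_ext_cong boundary_simplex_boundary) auto
  finally show ?thesis by (simp add: lin_ext_def)
qed

section \<open>Existence of singular value decompositions\<close>

lemma keys_diff_scale:
  "keys (x - chain_scale c b) \<subseteq> keys x \<union> keys b"
  by (auto simp: in_keys_iff lookup_minus lookup_chain_scale)

lemma subspace_chain_group: "chains.subspace (chain_group q K :: ('v set \<Rightarrow>\<^sub>0 'f::field) set)"
  unfolding chains.subspace_def chain_group_def
  by (auto dest!: keys_add[THEN subsetD] keys_chain_scale[THEN subsetD])

lemma subspace_boundary_kernel:
  assumes "chains.subspace V"
  shows "chains.subspace {x \<in> V. boundary num x = (0 :: 'v set \<Rightarrow>\<^sub>0 'f::field)}"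
proof -
  interpret D: Vector_Spaces.linear chain_scale chain_scale "boundary num :: ('v set \<Rightarrow>\<^sub>0 'f) \<Rightarrow> _"
    by (rule linear_boundary)
  show ?thesis
    using assms by (auto simp: chains.subspace_def D.add D.scale)
qed

lemma subspace_cycles: "chains.subspace (cycles num q K :: ('v set \<Rightarrow>\<^sub>0 'f::field) set)"
  unfolding cycles_def by (intro subspace_boundary_kernel subspace_chain_group)

lemma level_0 [simp]: "level K 0 = -\<infinity>"
  by (simp add: level_def)

lemma level_le_iff: "level K x \<le> enn2ereal t \<longleftrightarrow> (\<forall>s\<in>keys x. entry_time K s \<le> t)"
  by (auto simp: level_def less_eq_ennreal.rep_eq)

lemma in_keys_boundaryE:
  assumes "t \<in> keys (boundary num x)"
  obtains s v where "s \<in> keys x" "v \<in> s" "s \<noteq> {v}" "t = s - {v}"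
  using subsetD[OF keys_boundary assms] by auto

text \<open>An injective rank compatible with the entry times breaks ties, so every nonzero chain
  has a single leading simplex. Orthogonality with respect to levels then follows from Gaussian
  elimination with respect to ranks.\<close>

locale ranked_complex =
  fixes K :: "real \<Rightarrow> 'v set set" and L :: "'v set set" and rk :: "'v set \<Rightarrow> nat"
  assumes finite_L: "finite L"
    and inj_rk: "inj_on rk L"
    and rk_mono: "\<And>s t. s \<in> L \<Longrightarrow> t \<in> L \<Longrightarrow> rk s \<le> rk t \<Longrightarrow> entry_time K s \<le> entry_time K t"
begin

text \<open>The \<open>Suc\<close> leaves the value 0 to the zero chain alone, so elimination is
  finished exactly when the height reaches 0.\<close>

definition height :: "('v set \<Rightarrow>\<^sub>0 'f::zero) \<Rightarrow> nat" where
  "height x = Max (insert 0 (Suc ` rk ` keys x))"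

lemma height_le_iff: "height x \<le> n \<longleftrightarrow> (\<forall>s\<in>keys x. rk s < n)"
  unfolding height_def by (subst Max_le_iff) auto

lemma height_less_iff: "0 < n \<Longrightarrow> height x < n \<longleftrightarrow> (\<forall>s\<in>keys x. Suc (rk s) < n)"
  unfolding height_def by (subst Max_less_iff) auto

lemma height_0_iff [simp]: "height x = 0 \<longleftrightarrow> x = 0"
  using height_le_iff[of x 0] by auto

lemma height_zero [simp]: "height 0 = 0"
  by simp

lemma rk_less_height: "s \<in> keys x \<Longrightarrow> rk s < height x"
  using height_le_iff[of x "height x"] by simp

lemma leading_simplex:
  assumes "x \<noteq> 0"
  obtains s where "s \<in> keys x" "height x = Suc (rk s)"
proof -
  have "height x \<in> insert 0 (Suc ` rk ` keys x)"
    unfolding height_def by (rule Max_in) auto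
  with assms height_0_iff[of x] have "height x \<in> Suc ` rk ` keys x"
    by auto
  then show ?thesis using that by auto
qed

lemma level_mono_height:
  assumes "keys x \<subseteq> L" "keys y \<subseteq> L" "height x \<le> height y"
  shows "level K x \<le> level K y"
proof (cases "x = 0")
  case False
  with assms have "y \<noteq> 0" using height_0_iff[of x] height_0_iff[of y] by auto
  then obtain t where t: "t \<in> keys y" "height y = Suc (rk t)" by (rule leading_simplex)
  have "level K x \<le> enn2ereal (entry_time K t)"
    unfolding level_le_iff
  proof
    fix s assume "s \<in> keys x"
    then have "rk s \<le> rk t" using rk_less_height[of s x] assms t by simp
    then show "entry_time K s \<le> entry_time K t"
      using \<open>s \<in> keys x\<close> t assms by (intro rk_mono) auto
  qed
  also have "\<dots> \<le> level K y" using t unfolding level_def by (intro Max_ge) auto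
  finally show ?thesis .
qed simp

text \<open>The other terms with nonzero coefficient have strictly smaller height, so the leading
  simplex of the highest term occurs in none of them and survives.\<close>

lemma height_sum:
  fixes B :: "('v set \<Rightarrow>\<^sub>0 'f::field) set"
  assumes B: "finite B" "\<And>x. x \<in> B \<Longrightarrow> keys x \<subseteq> L" "0 \<notin> B" "inj_on height B"
    and x0: "x0 \<in> B" "c x0 \<noteq> 0" "\<And>x. x \<in> B \<Longrightarrow> c x \<noteq> 0 \<Longrightarrow> height x \<le> height x0"
  shows "height (\<Sum>x\<in>B. chain_scale (c x) x) = height x0"
proof (rule antisym)
  let ?z = "\<Sum>x\<in>B. chain_scale (c x) x"
  have "x0 \<noteq> 0" using x0 B by auto
  then obtain s where s: "s \<in> keys x0" "height x0 = Suc (rk s)" by (rule leading_simplex)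
  have "lookup ?z s = (\<Sum>x\<in>B. if x = x0 then c x0 * lookup x0 s else 0)"
    unfolding lookup_chain_sum
  proof (intro sum.cong refl)
    fix x assume x: "x \<in> B"
    have "lookup x s = 0" if "x \<noteq> x0" "c x \<noteq> 0"
    proof (rule ccontr)
      assume "lookup x s \<noteq> 0"
      then have "rk s < height x" by (intro rk_less_height) (simp add: in_keys_iff)
      moreover have "height x \<noteq> height x0" using that x x0 B(4) by (auto dest: inj_onD)
      ultimately show False using x0(3)[OF x that(2)] s by simp
    qed
    then show "c x * lookup x s = (if x = x0 then c x0 * lookup x0 s else 0)" by auto
  qed
  also have "\<dots> = c x0 * lookup x0 s" using B x0 by simp
  finally have "s \<in> keys ?z" using s x0 by (simp add: in_keys_iff)
  then show "height x0 \<le> height ?z" using s rk_less_height[of s ?z] by simp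
  show "height ?z \<le> height x0"
    unfolding height_le_iff
  proof
    fix t assume "t \<in> keys ?z"
    then have "(\<Sum>x\<in>B. c x * lookup x t) \<noteq> 0" by (simp add: in_keys_iff lookup_chain_sum)
    then obtain x where "x \<in> B" "c x * lookup x t \<noteq> 0" by (rule sum.not_neutral_contains_not_neutral)
    then show "rk t < height x0"
      using x0(3)[of x] rk_less_height[of t x] by (auto simp: in_keys_iff)
  qed
qed

text \<open>A combination has the height of its highest term. This is positive, which gives
  independence, and the height determines the level, which gives orthogonality.\<close>

lemma
  fixes B :: "('v set \<Rightarrow>\<^sub>0 'f::field) set"
  assumes B: "finite B" "\<And>x. x \<in> B \<Longrightarrow> keys x \<subseteq> L" "0 \<notin> B" "inj_on height B"
  shows independent_distinct_heights: "\<not> chains.dependent B"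
    and orthogonal_distinct_heights: "orthogonal_chains K B"
proof -
  have max: "\<exists>x0\<in>B. c x0 \<noteq> 0 \<and> (\<forall>x\<in>B. c x \<noteq> 0 \<longrightarrow> height x \<le> height x0)"
    if "{x \<in> B. c x \<noteq> 0} \<noteq> {}" for c :: "('v set \<Rightarrow>\<^sub>0 'f) \<Rightarrow> 'f"
  proof -
    let ?S = "height ` {x \<in> B. c x \<noteq> 0}"
    have "Max ?S \<in> ?S" using that B by (intro Max_in) auto
    then obtain x0 where "x0 \<in> B" "c x0 \<noteq> 0" "height x0 = Max ?S" by auto
    then show ?thesis using B by (intro bexI[of _ x0]) auto
  qed
  show "\<not> chains.dependent B"
  proof
    assume "chains.dependent B"
    then obtain c where c: "{x \<in> B. c x \<noteq> 0} \<noteq> {}" "(\<Sum>x\<in>B. chain_scale (c x) x) = 0"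
      using chains.dependent_finite[OF B(1)] by auto
    from max[OF c(1)] obtain x0 where x0: "x0 \<in> B" "c x0 \<noteq> 0" "\<forall>x\<in>B. c x \<noteq> 0 \<longrightarrow> height x \<le> height x0"
      by auto
    with height_sum[OF B, of x0 c] c(2) have "height x0 = 0" by simp
    with x0(1) B(3) show False by simp
  qed
  show "orthogonal_chains K B"
    unfolding orthogonal_chains_def
  proof (intro conjI allI)
    fix c :: "('v set \<Rightarrow>\<^sub>0 'f) \<Rightarrow> 'f"
    let ?z = "\<Sum>x\<in>B. chain_scale (c x) x"
    show "level K ?z = Max (insert (-\<infinity>) (level K ` {x \<in> B. c x \<noteq> 0}))"
    proof (cases "{x \<in> B. c x \<noteq> 0} = {}")
      case True
      then have "?z = 0" by (intro sum.neutral) auto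
      then show ?thesis unfolding True by simp
    next
      case False
      from max[OF this] obtain x0 where x0: "x0 \<in> B" "c x0 \<noteq> 0" "\<And>x. x\<in>B \<Longrightarrow> c x \<noteq> 0 \<Longrightarrow> height x \<le> height x0"
        by auto
      have h: "height ?z = height x0" using height_sum[OF B] x0 by blast
      have "keys ?z \<subseteq> L"
        by (rule subset_trans[OF keys_sum]) (use keys_chain_scale[THEN subsetD] B(2) in blast)
      then have "level K ?z = level K x0"
        using h B(2)[OF x0(1)] by (intro antisym level_mono_height) auto
      also have "\<dots> = Max (insert (-\<infinity>) (level K ` {x \<in> B. c x \<noteq> 0}))"
        using x0 B by (intro Max_eqI[symmetric]) (auto intro!: level_mono_height)
      finally show ?thesis .
    qed
  qed (use B in auto)
qed

text \<open>One elimination step: equal heights mean the same leading simplex, by injectivity of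
  \<open>rk\<close>.\<close>

lemma cancel_leading_simplex:
  fixes x b :: "'v set \<Rightarrow>\<^sub>0 'f::field"
  assumes "x \<noteq> 0" "keys x \<subseteq> L" "keys b \<subseteq> L" "height b = height x"
  obtains c where "height (x - chain_scale c b) < height x"
proof -
  obtain s where s: "s \<in> keys x" "height x = Suc (rk s)" using leading_simplex[OF assms(1)] .
  have "b \<noteq> 0" using assms height_0_iff[of x] height_0_iff[of b] by auto
  then obtain t where t: "t \<in> keys b" "height b = Suc (rk t)" by (rule leading_simplex)
  have [simp]: "t = s" using s t assms inj_rk by (auto dest: inj_onD)
  define y where "y = x - chain_scale (lookup x s / lookup b s) b"
  have "lookup y s = 0" using t by (simp add: y_def lookup_minus lookup_chain_scale in_keys_iff)
  moreover have "0 < height x" using assms(1) by (simp add: zero_less_iff_neq_zero)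
  moreover have "keys y \<subseteq> keys x \<union> keys b" unfolding y_def by (rule keys_diff_scale)
  ultimately have "height y < height x"
      unfolding height_less_iff[OF \<open>0 < height x\<close>]
  proof (intro ballI)
    fix u assume u: "u \<in> keys y"
    with \<open>lookup y s = 0\<close> have "u \<noteq> s" by (auto simp: in_keys_iff)
    moreover have "u \<in> L" "rk u < height x"
      using u \<open>keys y \<subseteq> _\<close> assms rk_less_height[of u x] rk_less_height[of u b] by auto
    ultimately show "Suc (rk u) < height x" using s assms inj_rk
      by (metis (no_types, lifting) inj_onD less_antisym Suc_less_eq subsetD)
  qed
  then show ?thesis using that unfolding y_def by blast
qed

lemma height_diff_lower:
  fixes x b :: "'v set \<Rightarrow>\<^sub>0 'f::field"
  assumes "height b < height x"
  shows "height (x - chain_scale c b) = height x"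
proof -
  have "x \<noteq> 0" using assms height_0_iff[of x] by auto
  then obtain s where s: "s \<in> keys x" "height x = Suc (rk s)" by (rule leading_simplex)
  have "s \<notin> keys b" using rk_less_height[of s b] assms s by auto
  then have "s \<in> keys (x - chain_scale c b)" using s
    by (simp add: in_keys_iff lookup_minus lookup_chain_scale)
  then have "height x \<le> height (x - chain_scale c b)" using s rk_less_height by fastforce
  moreover have "height (x - chain_scale c b) \<le> height x"
    unfolding height_le_iff
    using keys_diff_scale[of x c b] rk_less_height[of _ x] rk_less_height[of _ b] assms by fastforce
  ultimately show ?thesis by simp
qed

text \<open>Gaussian elimination: an element of \<open>B\<close> of the same height as
  \<open>x\<close> cancels the leading simplex of \<open>x\<close>, and the remainder has smaller
  height.\<close>

lemma span_distinct_heights: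
  fixes V :: "('v set \<Rightarrow>\<^sub>0 'f::field) set"
  assumes V: "chains.subspace V" "\<And>x. x \<in> V \<Longrightarrow> keys x \<subseteq> L"
    and B: "B \<subseteq> V" "height ` (V - {0}) \<subseteq> height ` B"
  shows "chains.span B = V"
proof
  show "chains.span B \<subseteq> V" using V B by (intro chains.span_minimal)
  show "V \<subseteq> chains.span B"
  proof
    fix x assume "x \<in> V"
    then show "x \<in> chains.span B"
    proof (induction "height x" arbitrary: x rule: less_induct)
      case less
      show ?case
      proof (cases "x = 0")
        case False
        with less.prems B(2) obtain b where b: "b \<in> B" "height b = height x" by force
        then have "b \<in> V" using B by auto
        then obtain c where c: "height (x - chain_scale c b) < height x"
          using cancel_leading_simplex[OF False V(2)[OF less.prems] V(2)] b(2) by metis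
        have "x - chain_scale c b \<in> V"
          using V(1) less.prems \<open>b \<in> V\<close> by (intro chains.subspace_diff chains.subspace_scale)
        from less.hyps[OF c this] have "x - chain_scale c b + chain_scale c b \<in> chains.span B"
          using chains.span_base[OF b(1)] by (rule chains.span_add[OF _ chains.span_scale])
        then show ?thesis by simp
      qed (simp add: chains.span_zero)
    qed
  qed
qed

lemma finite_heights:
  assumes "\<And>x. x \<in> V \<Longrightarrow> keys x \<subseteq> L"
  shows "finite (height ` V)"
proof (rule finite_subset)
  show "height ` V \<subseteq> insert 0 (Suc ` rk ` L)"
  proof
    fix n assume "n \<in> height ` V"
    then obtain x where x: "x \<in> V" "n = height x" by auto
    show "n \<in> insert 0 (Suc ` rk ` L)"
    proof (cases "x = 0")
      case False
      then obtain s where "s \<in> keys x" "height x = Suc (rk s)" by (rule leading_simplex)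
      then show ?thesis using x assms by auto
    qed (simp add: x)
  qed
qed (use finite_L in auto)

text \<open>One vector of \<open>V\<close> is added for every height attained in \<open>V\<close>
  but not in \<open>B0\<close>. Since \<open>B0\<close> stays intact, a basis of the boundaries can
  be completed to one of the cycles.\<close>

lemma extend_distinct_heights:
  fixes V :: "('v set \<Rightarrow>\<^sub>0 'f::field) set"
  assumes V: "chains.subspace V" "\<And>x. x \<in> V \<Longrightarrow> keys x \<subseteq> L"
    and B0: "B0 \<subseteq> V" "0 \<notin> B0" "inj_on height B0"
  obtains B where "B0 \<subseteq> B" "B \<subseteq> V" "0 \<notin> B" "inj_on height B" "chains.span B = V" "finite B"
proof -
  let ?H = "height ` (V - {0}) - height ` B0"
  define g where "g n = (SOME x. x \<in> V - {0} \<and> height x = n)" for n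
  have g: "g n \<in> V - {0} \<and> height (g n) = n" if "n \<in> ?H" for n
    unfolding g_def by (rule someI_ex) (use that in auto)
  let ?B = "B0 \<union> g ` ?H"
  have hg [simp]: "height ` g ` ?H = ?H"
  proof -
    have "(\<lambda>n. height (g n)) ` ?H = (\<lambda>n. n) ` ?H" by (rule image_cong[OF refl]) (use g in blast)
    then show ?thesis by (simp add: image_image)
  qed
  have "inj_on height (g ` ?H)"
    by (rule inj_onI) (metis (no_types, lifting) g imageE)
  then have "inj_on height ?B"
    unfolding inj_on_Un using B0 hg by blast
  have "g ` ?H \<subseteq> V - {0}" by (rule image_subsetI) (use g in blast)
  then have "?B \<subseteq> V" "0 \<notin> ?B" using B0 by auto
  moreover have "chains.span ?B = V"
  proof (rule span_distinct_heights[OF V])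
    show "height ` (V - {0}) \<subseteq> height ` ?B"
      unfolding image_Un hg by auto
  qed (use \<open>?B \<subseteq> V\<close> in auto)
  moreover have "finite ?B"
    using finite_heights[OF V(2)] \<open>inj_on height ?B\<close> \<open>?B \<subseteq> V\<close>
    by (meson finite_imageD finite_subset image_mono)
  ultimately show ?thesis
    using \<open>inj_on height ?B\<close> \<open>?B \<subseteq> V\<close> \<open>0 \<notin> ?B\<close> by (intro that[of ?B]) auto
qed

lemma orthogonal_basis_distinct_heights:
  assumes "distinct bs" "chains.span (set bs) = V" "\<And>x. x \<in> set bs \<Longrightarrow> keys x \<subseteq> L"
    "0 \<notin> set bs" "inj_on height (set bs)"
  shows "orthogonal_basis K V bs"
  unfolding orthogonal_basis_def
  using assms independent_distinct_heights[of "set bs"] orthogonal_distinct_heights[of "set bs"] by auto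

text \<open>
  For each leading simplex of \<open>C\<^sub>q\<^sub>+\<^sub>1\<close> choose a chain whose boundary has the lowest possible leading
  simplex. Two such chains with boundaries sharing their leading simplex would contradict
  minimality, so the nonzero boundaries have distinct leading simplices.
\<close>

lemma ex_svd:
  assumes L: "total_complex K = L"
    and faces: "\<And>s v. s \<in> L \<Longrightarrow> v \<in> s \<Longrightarrow> s \<noteq> {v} \<Longrightarrow> s - {v} \<in> L"
    and fin: "\<And>s. s \<in> L \<Longrightarrow> finite s"
    and num: "inj_on num (\<Union>L)"
  shows "\<exists>(ys :: ('v set \<Rightarrow>\<^sub>0 'f::field) list) xs. is_svd K num q ys xs"
proof -
  let ?C = "chain_group (q + 1) L :: ('v set \<Rightarrow>\<^sub>0 'f) set"
  let ?Z = "cycles num q L :: ('v set \<Rightarrow>\<^sub>0 'f) set"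
  let ?d = "boundary num :: ('v set \<Rightarrow>\<^sub>0 'f) \<Rightarrow> ('v set \<Rightarrow>\<^sub>0 'f)"
  interpret D: Vector_Spaces.linear chain_scale chain_scale ?d by (rule linear_boundary)
  have CL: "keys x \<subseteq> L" if "x \<in> chain_group j L" for x :: "'v set \<Rightarrow>\<^sub>0 'f" and j
    using that by (auto simp: chain_group_def)
  have ZL: "keys x \<subseteq> L" if "x \<in> ?Z" for x
    using that CL by (auto simp: cycles_def)
  have dZ: "?d x \<in> ?Z" if x: "x \<in> ?C" for x
  proof -
    have "?d (?d x) = 0"
    proof (rule boundary_boundary)
      fix s assume "s \<in> keys x"
      then have "s \<in> L" using CL[OF x] by auto
      then show "finite s \<and> inj_on num s" using fin num by (meson Union_upper inj_on_subset)
    qed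
    moreover have "?d x \<in> chain_group q L"
      unfolding chain_group_def
    proof safe
      fix t assume "t \<in> keys (?d x)"
      then obtain s v where s: "s \<in> keys x" "v \<in> s" "s \<noteq> {v}" "t = s - {v}"
        by (rule in_keys_boundaryE)
      then have "s \<in> L" "card s = q + 2" using x by (auto simp: chain_group_def)
      then show "t \<in> L" "card t = q + 1" using s faces[of s v] fin[of s] by auto
    qed
    ultimately show ?thesis by (simp add: cycles_def)
  qed
  define H where "H = height ` (?C - {0})"
  define y where "y n = arg_min (\<lambda>x. height (?d x)) (\<lambda>x. x \<in> ?C - {0} \<and> height x = n)" for n
  have y: "y n \<in> ?C - {0} \<and> height (y n) = n"
    and y_min: "x \<in> ?C - {0} \<Longrightarrow> height x = n \<Longrightarrow> height (?d (y n)) \<le> height (?d x)" if n: "n \<in> H" for n x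
  proof -
    obtain k where "k \<in> ?C - {0} \<and> height k = n" using n by (auto simp: H_def)
    note m = arg_min_nat_lemma[of "\<lambda>x. x \<in> ?C - {0} \<and> height x = n", OF this, of "\<lambda>x. height (?d x)"]
    show "y n \<in> ?C - {0} \<and> height (y n) = n" using m unfolding y_def by blast
    show "height (?d (y n)) \<le> height (?d x)" if "x \<in> ?C - {0}" "height x = n"
      using m that unfolding y_def by blast
  qed
  define Y where "Y = y ` H"
  have YC: "Y \<subseteq> ?C" and Y0: "0 \<notin> Y" and injY: "inj_on height Y"
    using y by (auto simp: Y_def inj_on_def)
  have "height ` Y = (\<lambda>n. n) ` H"
    unfolding Y_def image_image by (rule image_cong[OF refl]) (use y in blast)
  then have hY: "height ` Y = H" by simp
  have spanY: "chains.span Y = ?C"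
    by (rule span_distinct_heights[OF subspace_chain_group CL YC]) (simp_all add: hY H_def)
  have finY: "finite Y"
    unfolding Y_def H_def using CL by (intro finite_imageI finite_heights) auto
  define Y1 where "Y1 = {x \<in> Y. ?d x \<noteq> 0}"
  define Y2 where "Y2 = {x \<in> Y. ?d x = 0}"
  have dyL: "keys (?d (y n)) \<subseteq> L" if "n \<in> H" for n
    using dZ y[OF that] ZL by auto
  have less: False if h: "n1 \<in> H" "n2 \<in> H" "n1 < n2" "?d (y n2) \<noteq> 0"
    "height (?d (y n1)) = height (?d (y n2))" for n1 n2
  proof -
    obtain c where c: "height (?d (y n2) - chain_scale c (?d (y n1))) < height (?d (y n2))"
      by (rule cancel_leading_simplex[OF h(4) dyL[OF h(2)] dyL[OF h(1)] h(5)])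
    \<comment> \<open>As \<open>n1 < n2\<close>, subtracting a multiple of \<open>y n1\<close> keeps
      the height \<open>n2\<close>; so \<open>x\<close> competes with \<open>y n2\<close>, and its
      boundary is lower.\<close>
    define x where "x = y n2 - chain_scale c (y n1)"
    have h: "height x = n2" unfolding x_def using y that by (subst height_diff_lower) auto
    moreover have "x \<in> ?C"
      unfolding x_def using y that
      by (intro chains.subspace_diff chains.subspace_scale subspace_chain_group) auto
    moreover have "x \<noteq> 0" using h \<open>n1 < n2\<close> height_0_iff[of x] by auto
    ultimately have "height (?d (y n2)) \<le> height (?d x)"
      using y_min[OF \<open>n2 \<in> H\<close>, of x] by auto
    then show False using c by (simp add: x_def D.diff D.scale)
  qed
  have inj_hd: "inj_on (\<lambda>x. height (?d x)) Y1"
  proof (rule inj_onI)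
    fix a b assume ab: "a \<in> Y1" "b \<in> Y1" "height (?d a) = height (?d b)"
    then obtain n1 n2 where "a = y n1" "b = y n2" "n1 \<in> H" "n2 \<in> H" "?d (y n1) \<noteq> 0" "?d (y n2) \<noteq> 0"
      by (auto simp: Y1_def Y_def)
    with less[of n1 n2] less[of n2 n1] ab(3) show "a = b"
      by (cases n1 n2 rule: linorder_cases) auto
  qed
  then have inj_d: "inj_on ?d Y1" by (auto simp: inj_on_def)
  define X1 where "X1 = ?d ` Y1"
  have X1: "X1 \<subseteq> ?Z" "0 \<notin> X1" "inj_on height X1" "finite X1"
    using dZ YC inj_hd finY by (auto simp: X1_def Y1_def inj_on_def)
  have X1L: "keys x \<subseteq> L" if "x \<in> X1" for x
    using that X1(1) ZL by auto
  have spanX1: "chains.span X1 = ?d ` ?C"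
  proof -
    have "?d ` ?C = chains.span (?d ` Y)" by (simp only: D.span_image spanY)
    also have "\<dots> = chains.span X1"
    proof (rule antisym)
      have "?d ` Y \<subseteq> insert 0 X1" by (auto simp: X1_def Y1_def)
      then show "chains.span (?d ` Y) \<subseteq> chains.span X1"
        by (metis chains.span_insert_0 chains.span_mono)
      show "chains.span X1 \<subseteq> chains.span (?d ` Y)"
        by (rule chains.span_mono) (auto simp: X1_def Y1_def)
    qed
    finally show ?thesis by simp
  qed
  have indX1: "\<not> chains.dependent X1"
    by (rule independent_distinct_heights) (use X1 X1L in auto)
  have rank: "boundary_rank TYPE('f) num (q + 1) L = card Y1"
  proof -
    have "chains.dim (?d ` ?C) = card X1"
      by (rule chains.dim_eq_card[OF _ indX1]) (metis chains.span_span spanX1)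
    also have "\<dots> = card Y1" unfolding X1_def by (rule card_image[OF inj_d])
    finally show ?thesis by (simp add: boundary_rank_def)
  qed
  \<comment> \<open>The boundaries of \<open>Y1\<close> are independent, so a cycle expanded in
    \<open>Y\<close> has no component in \<open>Y1\<close>.\<close>
  have spanY2: "chains.span Y2 = cycles num (q + 1) L"
  proof
    show "chains.span Y2 \<subseteq> cycles num (q + 1) L"
      using YC by (intro chains.span_minimal subspace_cycles) (auto simp: Y2_def cycles_def)
    show "cycles num (q + 1) L \<subseteq> chains.span Y2"
    proof
      fix x assume x: "x \<in> (cycles num (q + 1) L :: ('v set \<Rightarrow>\<^sub>0 'f) set)"
      then have "x \<in> chains.span Y" by (simp add: spanY cycles_def)
      then obtain c where c: "x = (\<Sum>v\<in>Y. chain_scale (c v) v)"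
        unfolding chains.span_finite[OF finY] by auto
      have split: "Y = Y1 \<union> Y2" "Y1 \<inter> Y2 = {}" by (auto simp: Y1_def Y2_def)
      have "0 = ?d x" using x by (simp add: cycles_def)
      also have "\<dots> = (\<Sum>v\<in>Y. chain_scale (c v) (?d v))" by (simp add: c D.sum D.scale)
      also have "\<dots> = (\<Sum>v\<in>Y1. chain_scale (c v) (?d v))"
        by (rule sum.mono_neutral_right) (use finY in \<open>auto simp: Y1_def\<close>)
      also have "\<dots> = (\<Sum>w\<in>X1. chain_scale (c (the_inv_into Y1 ?d w)) w)"
        unfolding X1_def by (simp add: sum.reindex[OF inj_d] the_inv_into_f_f[OF inj_d])
      finally have "c (the_inv_into Y1 ?d w) = 0" if "w \<in> X1" for w
        using chains.independentD[OF indX1 X1(4) subset_refl _ that] by simp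
      then have "c v = 0" if "v \<in> Y1" for v
        using that the_inv_into_f_f[OF inj_d that] by (force simp: X1_def)
      then have "x = (\<Sum>v\<in>Y2. chain_scale (c v) v)"
        unfolding c by (intro sum.mono_neutral_right) (use finY split in auto)
      then show "x \<in> chains.span Y2"
        by (simp add: chains.span_sum chains.span_scale chains.span_base)
    qed
  qed
  \<comment> \<open>The nonzero boundaries have distinct heights and are therefore an admissible
    start for a basis of the cycles.\<close>
  obtain X where X: "X1 \<subseteq> X" "X \<subseteq> ?Z" "0 \<notin> X" "inj_on height X" "chains.span X = ?Z" "finite X"
    using extend_distinct_heights[OF subspace_cycles ZL X1(1-3)] by blast
  obtain l1 where l1: "set l1 = Y1" "distinct l1"
    using finite_distinct_list[of Y1] finY by (auto simp: Y1_def)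
  obtain l2 where l2: "set l2 = Y2" "distinct l2"
    using finite_distinct_list[of Y2] finY by (auto simp: Y2_def)
  obtain l3 where l3: "set l3 = X - X1" "distinct l3"
    using finite_distinct_list[of "X - X1"] X by auto
  have len: "length l1 = card Y1" using l1 distinct_card by fastforce
  have dist1: "distinct (map ?d l1)" using l1 inj_d by (simp add: distinct_map)
  have YL: "keys x \<subseteq> L" if "x \<in> Y" for x using that YC CL by auto
  have XL: "keys x \<subseteq> L" if "x \<in> X" for x using ZL[of x] that X(2) by auto
  have Y12: "Y1 \<union> Y2 = Y" "Y1 \<inter> Y2 = {}" "Y2 \<subseteq> Y" by (auto simp: Y1_def Y2_def)
  have "is_svd K num q (l1 @ l2) (map ?d l1 @ l3)"
    unfolding is_svd_def L Let_def rank len[symmetric]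
  proof (intro conjI allI impI)
    show "orthogonal_basis K ?C (l1 @ l2)"
      using Y12 YL Y0 injY l1 l2 spanY by (intro orthogonal_basis_distinct_heights) auto
    have "set (map ?d l1 @ l3) = X" using l1 l3 X(1) by (auto simp: X1_def)
    then show "orthogonal_basis K ?Z (map ?d l1 @ l3)"
      using X XL l1 l3 dist1 by (intro orthogonal_basis_distinct_heights) (auto simp: X1_def)
    show "orthogonal_basis K (cycles num (q + 1) L) (drop (length l1) (l1 @ l2))"
      using Y12 YL Y0 l2 spanY2 inj_on_subset[OF injY Y12(3)]
      by (intro orthogonal_basis_distinct_heights) auto
    show "orthogonal_basis K (?d ` ?C) (take (length l1) (map ?d l1 @ l3))"
      using X1 X1L l1 dist1 spanX1
      by (intro orthogonal_basis_distinct_heights) (auto simp: X1_def)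
    show "?d ((l1 @ l2) ! i) = (map ?d l1 @ l3) ! i" if "i < length l1" for i
      using that by (simp add: nth_append)
  qed
  then show ?thesis by blast
qed

end

text \<open>The rank is the position in a list of the simplices sorted by entry time.\<close>

lemma ex_ranked_complex:
  assumes "finite L"
  obtains rk where "ranked_complex K L rk"
proof -
  obtain l where l: "set l = L" "distinct l" using finite_distinct_list[OF assms] by auto
  define ls where "ls = sort_key (entry_time K) l"
  have ls: "set ls = L" "distinct ls" "sorted (map (entry_time K) ls)" using l by (auto simp: ls_def)
  define rk where "rk = the_inv_into {..<length ls} ((!) ls)"
  have bij: "bij_betw ((!) ls) {..<length ls} L" using ls bij_betw_nth by blast
  have rk: "rk s < length ls" "ls ! rk s = s" if "s \<in> L" for s
    using bij that bij_betwE[OF bij_betw_the_inv_into[OF bij]] f_the_inv_into_f_bij_betw[OF bij]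
    unfolding rk_def by auto
  have "ranked_complex K L rk"
  proof
    show "inj_on rk L" using rk(2) by (metis inj_onI)
    fix s t assume "s \<in> L" "t \<in> L" "rk s \<le> rk t"
    then show "entry_time K s \<le> entry_time K t"
      using sorted_nth_mono[OF ls(3), of "rk s" "rk t"] rk by auto
  qed fact
  then show ?thesis by (rule that)
qed

section \<open>Counting diagram points by dimensions\<close>

text \<open>Lower sets instead of thresholds: \<open>{..a}\<close>, \<open>{..<a}\<close> and
  \<open>UNIV\<close> are treated at once, the last one including the time \<infinity>.\<close>

definition down_closed :: "'a::order set \<Rightarrow> bool" where
  "down_closed S \<longleftrightarrow> (\<forall>a b. b \<in> S \<longrightarrow> a \<le> b \<longrightarrow> a \<in> S)"

definition sublevel :: "(real \<Rightarrow> 'v set set) \<Rightarrow> ennreal set \<Rightarrow> ('v set \<Rightarrow>\<^sub>0 'f::field) set" where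
  "sublevel K S = {x. \<forall>s\<in>keys x. entry_time K s \<in> S}"

lemma subspace_sublevel: "chains.subspace (sublevel K S :: ('v set \<Rightarrow>\<^sub>0 'f::field) set)"
  unfolding chains.subspace_def sublevel_def
  by (auto dest!: keys_add[THEN subsetD] keys_chain_scale[THEN subsetD])

lemma level_attained:
  assumes "x \<noteq> 0"
  obtains s where "s \<in> keys x" "level K x = enn2ereal (entry_time K s)"
    "\<And>t. t \<in> keys x \<Longrightarrow> entry_time K t \<le> entry_time K s"
proof -
  let ?A = "(\<lambda>s. enn2ereal (entry_time K s)) ` keys x"
  have ne: "?A \<noteq> {}" using assms by simp
  then have "Max ?A \<in> ?A" by (intro Max_in) auto
  then obtain s where s: "s \<in> keys x" "Max ?A = enn2ereal (entry_time K s)" by auto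
  have "level K x = max (-\<infinity>) (Max ?A)"
    unfolding level_def using ne by (intro Max_insert) auto
  then have lev: "level K x = enn2ereal (entry_time K s)"
    using s by (simp add: max_def)
  then have "\<forall>t\<in>keys x. entry_time K t \<le> entry_time K s"
    using level_le_iff[of K x "entry_time K s"] by simp
  with s lev show ?thesis by (intro that) auto
qed

lemma level_in_iff:
  assumes "x \<noteq> 0" "down_closed S"
  shows "e2ennreal (level K x) \<in> S \<longleftrightarrow> x \<in> sublevel K S"
proof -
  obtain s where s: "s \<in> keys x" "level K x = enn2ereal (entry_time K s)"
    "\<And>t. t \<in> keys x \<Longrightarrow> entry_time K t \<le> entry_time K s"
    using level_attained[OF assms(1), of K] by blast
  then show ?thesis using assms(2) by (auto simp: sublevel_def down_closed_def e2ennreal_enn2ereal)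
qed

text \<open>Orthogonality forbids cancellation: no term that occurs can have a higher level than the
  whole combination.\<close>

lemma orthogonal_sublevel:
  fixes B :: "('v set \<Rightarrow>\<^sub>0 'f::field) set"
  assumes B: "orthogonal_chains K B" and S: "down_closed S"
    and z: "(\<Sum>x\<in>B. chain_scale (c x) x) \<in> sublevel K S" and b: "b \<in> B" "c b \<noteq> 0"
  shows "b \<in> sublevel K S"
proof (cases "b = 0")
  case True
  then show ?thesis using chains.subspace_0[OF subspace_sublevel] by simp
next
  case False
  let ?z = "\<Sum>x\<in>B. chain_scale (c x) x"
  obtain s where s: "level K b = enn2ereal (entry_time K s)"
    using level_attained[OF False, of K] by blast
  have "level K b \<le> level K ?z"
  proof -
    have "finite B" "level K ?z = Max (insert (-\<infinity>) (level K ` {x \<in> B. c x \<noteq> 0}))"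
      using B unfolding orthogonal_chains_def by blast+
    then show ?thesis using b by (auto intro!: Max_ge)
  qed
  then have "?z \<noteq> 0" using s by auto
  then have "e2ennreal (level K ?z) \<in> S" using z level_in_iff[OF _ S] by blast
  moreover have "e2ennreal (level K b) \<le> e2ennreal (level K ?z)"
    by (rule e2ennreal_mono) fact
  ultimately have "e2ennreal (level K b) \<in> S" using S by (auto simp: down_closed_def)
  then show ?thesis using level_in_iff[OF False S] by blast
qed

lemma card_nth_set: "distinct bs \<Longrightarrow> card {i. i < length bs \<and> P (bs ! i)} = card {x \<in> set bs. P x}"
  by (metis distinct_card distinct_filter length_filter_conv_card set_filter)

text \<open>By \<open>orthogonal_sublevel\<close> the basis vectors in the sublevel space already
  span its intersection with \<open>V\<close>. The count is thus a dimension and does not depend on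
  the basis.\<close>

lemma orthogonal_basis_sublevel:
  assumes bs: "orthogonal_basis K V bs" and S: "down_closed S"
  shows "card {i. i < length bs \<and> bs ! i \<in> sublevel K S} = chains.dim (V \<inter> sublevel K S)"
proof -
  let ?B = "{x \<in> set bs. x \<in> sublevel K S}"
  have "chains.dim (V \<inter> sublevel K S) = card ?B"
  proof (rule chains.dim_unique)
    show "?B \<subseteq> V \<inter> sublevel K S"
      using bs by (auto simp: orthogonal_basis_def intro: chains.span_base)
    show "\<not> chains.dependent ?B"
      by (rule chains.independent_mono[of "set bs"]) (use bs in \<open>auto simp: orthogonal_basis_def\<close>)
    show "V \<inter> sublevel K S \<subseteq> chains.span ?B"
    proof
      fix x assume x: "x \<in> V \<inter> sublevel K S"
      then obtain c where c: "x = (\<Sum>v\<in>set bs. chain_scale (c v) v)"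
        using bs by (auto simp: orthogonal_basis_def chains.span_finite)
      have "v \<in> sublevel K S" if "v \<in> set bs" "c v \<noteq> 0" for v
        using bs x c orthogonal_sublevel[OF _ S, of K "set bs" c v] that
        by (auto simp: orthogonal_basis_def)
      then have "chain_scale (c v) v \<in> chains.span ?B" if "v \<in> set bs" for v
        using that by (cases "c v = 0") (auto intro: chains.span_base chains.span_scale chains.span_zero)
      then show "x \<in> chains.span ?B" unfolding c by (rule chains.span_sum)
    qed
  qed simp
  then show ?thesis using bs card_nth_set[of bs] by (auto simp: orthogonal_basis_def)
qed

text \<open>\<open>take r\<close> and \<open>drop r\<close> truncate silently; these bounds ensure
  that the first \<open>r\<close> entries of both lists exist.\<close>

lemma svd_lengths:
  fixes ys xs :: "('v set \<Rightarrow>\<^sub>0 'f::field) list"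
  assumes "is_svd K num q ys xs"
  defines "r \<equiv> boundary_rank TYPE('f) num (q + 1) (total_complex K)"
  shows "r \<le> length xs" "r \<le> length ys"
proof -
  let ?C = "chain_group (q + 1) (total_complex K) :: ('v set \<Rightarrow>\<^sub>0 'f) set"
  interpret D: Vector_Spaces.linear chain_scale chain_scale "boundary num :: ('v set \<Rightarrow>\<^sub>0 'f) \<Rightarrow> _"
    by (rule linear_boundary)
  have ys: "orthogonal_basis K ?C ys" and xs: "orthogonal_basis K (boundary num ` ?C) (take r xs)"
    using assms(1) by (simp_all add: is_svd_def Let_def r_def)
  have "r = chains.dim (boundary num ` ?C)" by (simp add: r_def boundary_rank_def)
  also have "\<dots> = card (set (take r xs))"
    using xs unfolding orthogonal_basis_def by (intro chains.dim_eq_card) (metis chains.span_span, simp)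
  also have "\<dots> \<le> length xs"
    using card_length[of "take r xs"] by simp
  finally show "r \<le> length xs" .
  have "r = chains.dim (boundary num ` ?C)" by (simp add: r_def boundary_rank_def)
  also have "boundary num ` ?C = chains.span (boundary num ` set ys)"
    using ys by (auto simp: orthogonal_basis_def D.span_image)
  also have "chains.dim \<dots> \<le> card (boundary num ` set ys)"
    by (intro chains.dim_le_card) auto
  also have "\<dots> \<le> length ys" by (meson List.finite_set card_image_le card_length le_trans)
  finally show "r \<le> length ys" .
qed

text \<open>Both orthogonalities are used: that of \<open>ys\<close> shows that a chain in the
  sublevel \<open>J\<close> involves only such \<open>ys ! i\<close>, and that of the first
  \<open>r\<close> entries of \<open>xs\<close> does the same for its boundary and
  \<open>I\<close>.\<close>

lemma svd_deaths:
  fixes ys xs :: "('v set \<Rightarrow>\<^sub>0 'f::field) list"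
  assumes svd: "is_svd K num q ys xs" and I: "down_closed I" and J: "down_closed J"
  defines "r \<equiv> boundary_rank TYPE('f) num (q + 1) (total_complex K)"
  shows "card {i. i < r \<and> xs ! i \<in> sublevel K I \<and> ys ! i \<in> sublevel K J} =
    chains.dim (boundary num ` (chain_group (q + 1) (total_complex K) \<inter> sublevel K J) \<inter> sublevel K I
      :: ('v set \<Rightarrow>\<^sub>0 'f) set)"
proof -
  let ?C = "chain_group (q + 1) (total_complex K) :: ('v set \<Rightarrow>\<^sub>0 'f) set"
  let ?d = "boundary num :: ('v set \<Rightarrow>\<^sub>0 'f) \<Rightarrow> _"
  interpret D: Vector_Spaces.linear chain_scale chain_scale ?d by (rule linear_boundary)
  have ys: "orthogonal_basis K ?C ys" and xs: "orthogonal_basis K (?d ` ?C) (take r xs)"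
    and ker: "orthogonal_basis K (cycles num (q + 1) (total_complex K)) (drop r ys)"
    and dy: "\<And>i. i < r \<Longrightarrow> ?d (ys ! i) = xs ! i"
    using svd by (simp_all add: is_svd_def Let_def r_def)
  have r: "r \<le> length xs" "r \<le> length ys" using svd_lengths[OF svd] by (simp_all add: r_def)
  let ?I = "{i. i < r \<and> xs ! i \<in> sublevel K I \<and> ys ! i \<in> sublevel K J}"
  let ?B = "(!) xs ` ?I"
  let ?V = "?d ` (?C \<inter> sublevel K J) \<inter> sublevel K I"
  have dist: "distinct (take r xs)" "distinct ys" using xs ys by (simp_all add: orthogonal_basis_def)
  have bij: "bij_betw ((!) (take r xs)) {..<r} (set (take r xs))"
    using bij_betw_nth[OF dist(1) refl refl] r by simp
  have inj: "inj_on ((!) xs) {..<r}"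
    using bij_betw_imp_inj_on[OF bij] by (simp add: inj_on_def)
  have xs_take: "xs ! i \<in> set (take r xs)" if "i < r" for i
    using nth_mem[of i "take r xs"] that r by simp
  have "chains.dim ?V = card ?B"
  proof (rule chains.dim_unique)
    show "?B \<subseteq> ?V"
    proof
      fix x assume "x \<in> ?B"
      then obtain i where i: "i < r" "xs ! i \<in> sublevel K I" "ys ! i \<in> sublevel K J" "x = xs ! i" by auto
      have "ys ! i \<in> chains.span (set ys)" using i r by (intro chains.span_base) simp
      then have "ys ! i \<in> ?C" using ys by (simp add: orthogonal_basis_def)
      then have "?d (ys ! i) \<in> ?d ` (?C \<inter> sublevel K J)" using i by (intro imageI) auto
      then show "x \<in> ?V" using i dy[OF i(1)] by simp
    qed
    have "?B \<subseteq> set (take r xs)" using xs_take by auto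
    then show "\<not> chains.dependent ?B"
      by (rule chains.independent_mono[rotated]) (use xs in \<open>simp add: orthogonal_basis_def\<close>)
    show "?V \<subseteq> chains.span ?B"
    proof
      fix z assume z: "z \<in> ?V"
      then obtain w where w: "w \<in> ?C" "w \<in> sublevel K J" "z = ?d w" by auto
      have "w \<in> chains.span (set ys)" using ys w by (simp add: orthogonal_basis_def)
      then obtain c where c: "w = (\<Sum>v\<in>set ys. chain_scale (c v) v)"
        by (auto simp: chains.span_finite)
      have cJ: "v \<in> sublevel K J" if "v \<in> set ys" "c v \<noteq> 0" for v
        using ys w c orthogonal_sublevel[OF _ J, of K "set ys" c v] that
        by (auto simp: orthogonal_basis_def)
      have "z = (\<Sum>v\<in>set ys. chain_scale (c v) (?d v))" using w c by (simp add: D.sum D.scale)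
      also have "\<dots> = (\<Sum>i<length ys. chain_scale (c (ys ! i)) (?d (ys ! i)))"
        by (rule sum.reindex_bij_betw[symmetric]) (rule bij_betw_nth[OF dist(2) refl refl])
      \<comment> \<open>The vectors from index \<open>r\<close> on are cycles and contribute
        nothing.\<close>
      also have "\<dots> = (\<Sum>i<r. chain_scale (c (ys ! i)) (?d (ys ! i)))"
      proof (rule sum.mono_neutral_right)
        have "?d (ys ! i) = 0" if "r \<le> i" "i < length ys" for i
        proof -
          have "ys ! i \<in> set (drop r ys)" using that nth_mem[of "i - r" "drop r ys"] by simp
          then have "ys ! i \<in> chains.span (set (drop r ys))" by (rule chains.span_base)
          then show ?thesis using ker by (simp add: orthogonal_basis_def cycles_def)
        qed
        then show "\<forall>i\<in>{..<length ys} - {..<r}. chain_scale (c (ys ! i)) (?d (ys ! i)) = 0" by auto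
      qed (use r in auto)
      also have "\<dots> = (\<Sum>i<r. chain_scale (c (ys ! i)) (xs ! i))" by (simp add: dy)
      finally have z1: "z = (\<Sum>i<r. chain_scale (c (ys ! i)) (xs ! i))" .
      \<comment> \<open>\<open>orthogonal_sublevel\<close> takes coefficients indexed by vectors, so
        the index is recovered from the vector.\<close>
      define g where "g = the_inv_into {..<r} ((!) xs)"
      have g: "g (xs ! i) = i" if "i < r" for i
        unfolding g_def using that inj by (simp add: the_inv_into_f_f)
      have "z = (\<Sum>i<r. chain_scale (c (ys ! g (take r xs ! i))) (take r xs ! i))"
        unfolding z1 by (intro sum.cong) (auto simp: g)
      also have "\<dots> = (\<Sum>x\<in>set (take r xs). chain_scale (c (ys ! g x)) x)"
        by (rule sum.reindex_bij_betw[OF bij])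
      finally have z2: "(\<Sum>x\<in>set (take r xs). chain_scale (c (ys ! g x)) x) \<in> sublevel K I"
        using z by simp
      have "chain_scale (c (ys ! i)) (xs ! i) \<in> chains.span ?B" if "i < r" for i
      proof (cases "c (ys ! i) = 0")
        case False
        have "xs ! i \<in> sublevel K I"
          using xs_take[OF that] orthogonal_sublevel[OF _ I z2] xs False that by (simp add: orthogonal_basis_def g)
        moreover have "ys ! i \<in> sublevel K J" using cJ False that r by simp
        ultimately have "xs ! i \<in> ?B" using that by auto
        then show ?thesis by (intro chains.span_scale chains.span_base)
      qed (simp add: chains.span_zero)
      then show "z \<in> chains.span ?B" unfolding z1 by (intro chains.span_sum) auto
    qed
  qed simp
  also have "card ?B = card ?I"
    by (rule card_image) (rule inj_on_subset[OF inj], auto)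
  finally show ?thesis by simp
qed

lemma svd_nonzero:
  fixes ys xs :: "('v set \<Rightarrow>\<^sub>0 'f::field) list"
  assumes "is_svd K num q ys xs"
  shows "0 \<notin> set xs" "0 \<notin> set ys"
  using assms chains.dependent_zero by (auto simp: is_svd_def Let_def orthogonal_basis_def)

lemma size_svd_diagram:
  fixes ys xs :: "('v set \<Rightarrow>\<^sub>0 'f::field) list"
  assumes "r = boundary_rank TYPE('f) num (q + 1) (total_complex K)"
  shows "size (filter_mset P (svd_diagram K num q ys xs)) =
    card {i. i < length xs \<and> P (e2ennreal (level K (xs ! i)), if i < r then e2ennreal (level K (ys ! i)) else \<infinity>)}"
proof -
  have "size (filter_mset P (svd_diagram K num q ys xs)) =
    length (filter P (map (\<lambda>i. (e2ennreal (level K (xs ! i)), if i < r then e2ennreal (level K (ys ! i)) else \<infinity>))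
       [0..<length xs]))"
    by (simp only: svd_diagram_def Let_def assms mset_filter[symmetric] size_mset)
  also have "\<dots> = card {i. i < length xs \<and> P (e2ennreal (level K (xs ! i)), if i < r then e2ennreal (level K (ys ! i)) else \<infinity>)}"
    unfolding length_filter_conv_card by (intro arg_cong[where f = card]) auto
  finally show ?thesis .
qed

text \<open>A down-closed \<open>J\<close> containing \<infinity> is everything, so only births are
  tested and all cycles count. Any other \<open>J\<close> excludes the points with death
  \<infinity>, and what remains are boundaries of chains in the sublevel \<open>J\<close>.\<close>

definition diagram_rank ::
  "'f::field itself \<Rightarrow> (real \<Rightarrow> 'v set set) \<Rightarrow> ('v \<Rightarrow> nat) \<Rightarrow> nat \<Rightarrow> ennreal set \<Rightarrow> ennreal set \<Rightarrow> nat" where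
  "diagram_rank _ K num q I J =
     (if \<infinity> \<in> J then chains.dim (cycles num q (total_complex K) \<inter> sublevel K I :: ('v set \<Rightarrow>\<^sub>0 'f) set)
      else chains.dim (boundary num ` (chain_group (q + 1) (total_complex K) \<inter> sublevel K J) \<inter> sublevel K I
        :: ('v set \<Rightarrow>\<^sub>0 'f) set))"

text \<open>No decomposition occurs on the right-hand side; this removes one of the two choices
  hidden in \<open>verbose_diagram\<close>, and relabelling will remove the numbering.\<close>

lemma size_svd_diagram_rectangle:
  fixes ys xs :: "('v set \<Rightarrow>\<^sub>0 'f::field) list"
  assumes svd: "is_svd K num q ys xs" and I: "down_closed I" and J: "down_closed J"
  shows "size (filter_mset (\<lambda>p. p \<in> I \<times> J) (svd_diagram K num q ys xs)) = diagram_rank TYPE('f) K num q I J"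
proof -
  define r where "r = boundary_rank TYPE('f) num (q + 1) (total_complex K)"
  have r: "r \<le> length xs" "r \<le> length ys" using svd_lengths[OF svd] by (simp_all add: r_def)
  have x: "e2ennreal (level K (xs ! i)) \<in> I \<longleftrightarrow> xs ! i \<in> sublevel K I" if "i < length xs" for i
    using svd_nonzero[OF svd] that by (intro level_in_iff I) (metis nth_mem)
  have y: "e2ennreal (level K (ys ! i)) \<in> J \<longleftrightarrow> ys ! i \<in> sublevel K J" if "i < length ys" for i
    using svd_nonzero[OF svd] that by (intro level_in_iff J) (metis nth_mem)
  show ?thesis
  proof (cases "\<infinity> \<in> J")
    case True
    then have J: "a \<in> J" for a
      using J unfolding down_closed_def by (metis infinity_ennreal_def top_greatest)
    have "orthogonal_basis K (cycles num q (total_complex K)) xs"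
      using svd by (simp add: is_svd_def Let_def)
    from orthogonal_basis_sublevel[OF this I] show ?thesis
      unfolding size_svd_diagram[OF r_def] diagram_rank_def using True J x
      by (auto intro!: arg_cong[where f = card] cong: conj_cong)
  next
    case False
    have "{i. i < length xs \<and> (e2ennreal (level K (xs ! i)), if i < r then e2ennreal (level K (ys ! i)) else \<infinity>) \<in> I \<times> J}
       = {i. i < r \<and> xs ! i \<in> sublevel K I \<and> ys ! i \<in> sublevel K J}"
      using False x y r by auto
    then show ?thesis
      unfolding size_svd_diagram[OF r_def] diagram_rank_def using False svd_deaths[OF svd I J] by (simp add: r_def)
  qed
qed

text \<open>\<open>chains.dim\<close> is a cardinality and would be 0 for an infinite basis; the
  finite set \<open>T\<close> excludes this for \<open>V'\<close>.\<close>

lemma dim_le_injective_image: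
  fixes V V' T :: "('v set \<Rightarrow>\<^sub>0 'f::field) set"
  assumes "Vector_Spaces.linear chain_scale chain_scale f"
    and "chains.subspace V" "inj_on f V" "f ` V \<subseteq> V'" "V' \<subseteq> chains.span T" "finite T"
  shows "chains.dim V \<le> chains.dim V'"
proof -
  interpret f: Vector_Spaces.linear chain_scale chain_scale f by fact
  obtain B where B: "B \<subseteq> V" "\<not> chains.dependent B" "V \<subseteq> chains.span B" "card B = chains.dim V"
    by (rule chains.basis_exists)
  obtain B' where B': "B' \<subseteq> V'" "\<not> chains.dependent B'" "V' \<subseteq> chains.span B'" "card B' = chains.dim V'"
    by (rule chains.basis_exists)
  have "finite B'"
    using chains.independent_span_bound[of T B'] B' assms by auto
  moreover have "\<not> chains.dependent (f ` B)"
    using B assms by (intro f.independent_injective_image inj_on_subset[OF assms(3)] chains.span_minimal)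
  moreover have "f ` B \<subseteq> chains.span B'" using B(1) B'(3) assms(4) by blast
  ultimately have "card (f ` B) \<le> card B'"
    using chains.independent_span_bound[of B' "f ` B"] by auto
  moreover have "card (f ` B) = card B"
    by (rule card_image) (rule inj_on_subset[OF assms(3) B(1)])
  ultimately show ?thesis using B B' by simp
qed

lemma independent_card_le_dim:
  fixes V T :: "('v set \<Rightarrow>\<^sub>0 'f::field) set"
  assumes "\<not> chains.dependent E" "E \<subseteq> V" "V \<subseteq> chains.span T" "finite T"
  shows "card E \<le> chains.dim V"
proof -
  obtain B' where B': "B' \<subseteq> V" "\<not> chains.dependent B'" "V \<subseteq> chains.span B'" "card B' = chains.dim V"
    by (rule chains.basis_exists)
  have "finite B'"
    using chains.independent_span_bound[of T B'] B' assms by auto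
  then show ?thesis
    using chains.independent_span_bound[of B' E] B' assms by auto
qed

lemma chain_group_subset_span:
  fixes L :: "'v set set"
  shows "chain_group q L \<subseteq> chains.span ((\<lambda>s. psingle s (1 :: 'f::field)) ` {s \<in> L. card s = q + 1})"
proof
  fix x :: "'v set \<Rightarrow>\<^sub>0 'f" assume x: "x \<in> chain_group q L"
  have "x = (\<Sum>s\<in>keys x. chain_scale (lookup x s) (psingle s 1))"
    using lin_ext_id[of x] by (simp add: lin_ext_def)
  also have "\<dots> \<in> chains.span ((\<lambda>s. psingle s 1) ` {s \<in> L. card s = q + 1})"
    using x by (intro chains.span_sum chains.span_scale chains.span_base) (auto simp: chain_group_def)
  finally show "x \<in> chains.span ((\<lambda>s. psingle s 1) ` {s \<in> L. card s = q + 1})" .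
qed

section \<open>Relabelling invariance and finite weights\<close>

text \<open>
  Simplices are oriented by a numbering, so carrying them along a bijection \<open>h\<close> commutes with the
  boundary only up to sign; the parity of the number of inversions corrects this. In particular
  (\<open>h = id\<close>) the ranks do not depend on the numbering.
\<close>

definition relabel :: "('v \<Rightarrow> 'v) \<Rightarrow> ('v \<Rightarrow> nat) \<Rightarrow> ('v \<Rightarrow> nat) \<Rightarrow> ('v set \<Rightarrow>\<^sub>0 'f::field) \<Rightarrow> ('v set \<Rightarrow>\<^sub>0 'f)" where
  "relabel h num num' =
     lin_ext (\<lambda>s. psingle (h ` s) ((-1) ^ card {(u, w) \<in> s \<times> s. num u < num w \<and> num' (h w) < num' (h u)}))"

lemma linear_relabel: "Vector_Spaces.linear chain_scale chain_scale (relabel h num num')"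
  unfolding relabel_def by (rule linear_lin_ext)

text \<open>Removing \<open>v\<close> removes the inversions that involve \<open>v\<close>. They
  correspond to the vertices preceding \<open>v\<close> in exactly one of the two orders, and their
  number has the parity of the change in the position of \<open>v\<close>.\<close>

lemma sign_inversions:
  fixes num num' :: "'v \<Rightarrow> nat"
  assumes "finite s" "v \<in> s" "inj_on num s" "inj_on num' (h ` s)" "inj_on h s"
  shows "(-1 :: 'f::field) ^ card {(u, w) \<in> s \<times> s. num u < num w \<and> num' (h w) < num' (h u)}
       * (-1) ^ card {u \<in> s. num' (h u) < num' (h v)}
     = (-1) ^ card {u \<in> s. num u < num v}
       * (-1) ^ card {(u, w) \<in> (s - {v}) \<times> (s - {v}). num u < num w \<and> num' (h w) < num' (h u)}"
proof -
  let ?R = "\<lambda>u w. num u < num w \<and> num' (h w) < num' (h u)"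
  define a where "a = {u \<in> s. num u < num v}"
  define b where "b = {u \<in> s. num' (h u) < num' (h v)}"
  let ?P = "{(u, w) \<in> s \<times> s. ?R u w}" and ?Q = "{(u, w) \<in> (s - {v}) \<times> (s - {v}). ?R u w}"
  have fin: "finite a" "finite b" "finite ?Q"
    using assms by (auto simp: a_def b_def intro: finite_subset[of _ "s \<times> s"])
  have less_num: "num v < num u \<longleftrightarrow> \<not> num u < num v" if "u \<in> s" "u \<noteq> v" for u
    using assms that by (metis inj_onD linorder_neqE_nat not_less_iff_gr_or_eq)
  have less_num': "num' (h v) < num' (h u) \<longleftrightarrow> \<not> num' (h u) < num' (h v)" if "u \<in> s" "u \<noteq> v" for u
    using assms that by (metis inj_onD linorder_neqE_nat not_less_iff_gr_or_eq imageI)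
  \<comment> \<open>In \<open>a - b\<close> are the vertices that pass from before \<open>v\<close>
    to after it, in \<open>b - a\<close> those that move the other way.\<close>
  have "?P = ?Q \<union> (\<lambda>u. (u, v)) ` (a - b) \<union> (\<lambda>u. (v, u)) ` (b - a)"
    using assms(2) less_num less_num' unfolding a_def b_def by auto
  then have "card ?P = card (?Q \<union> (\<lambda>u. (u, v)) ` (a - b)) + card ((\<lambda>u. (v, u)) ` (b - a))"
    using fin by (simp only:) (intro card_Un_disjoint, auto simp: a_def b_def)
  also have "card (?Q \<union> (\<lambda>u. (u, v)) ` (a - b)) = card ?Q + card ((\<lambda>u. (u, v)) ` (a - b))"
    using fin by (intro card_Un_disjoint) auto
  finally have 1: "card ?P = card ?Q + card (a - b) + card (b - a)"
    by (simp add: card_image inj_on_def)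
  have 2: "card a = card (a - b) + card (a \<inter> b)" "card b = card (b - a) + card (a \<inter> b)"
    using fin card_Diff_subset_Int[of a b] card_Diff_subset_Int[of b a] card_mono[of a "a \<inter> b"] card_mono[of b "a \<inter> b"]
    by (auto simp: Int_commute)
  \<comment> \<open>The set \<open>b - a\<close> is counted once among the inversions and once in
    \<open>b\<close>, hence the even difference of the exponents.\<close>
  have "(-1 :: 'f) ^ (card ?P + card b) = (-1) ^ (card a + card ?Q + 2 * card (b - a))"
    using 1 2 by (intro arg_cong[where f = "\<lambda>n. (-1) ^ n"]) simp
  also have "\<dots> = (-1) ^ (card a + card ?Q)" by (simp add: power_add power_mult)
  finally show ?thesis by (simp add: a_def b_def power_add)
qed

lemma relabel_boundary:
  fixes x :: "'v set \<Rightarrow>\<^sub>0 'f::field"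
  assumes "finite X" "\<And>s. s \<in> keys x \<Longrightarrow> s \<subseteq> X" "inj_on num X" "inj_on num' (h ` X)" "inj_on h X"
  shows "boundary num' (relabel h num num' x) = relabel h num num' (boundary num x)"
proof -
  let ?e = "\<lambda>s. (-1 :: 'f) ^ card {(u, w) \<in> s \<times> s. num u < num w \<and> num' (h w) < num' (h u)}"
  have "lin_ext (simplex_boundary num') (psingle (h ` s) (?e s)) = relabel h num num' (simplex_boundary num s)"
    if s: "s \<in> keys x" for s
  proof -
    have sX: "s \<subseteq> X" by (rule assms(2)[OF s])
    have s: "finite s" "inj_on num s" "inj_on num' (h ` s)" "inj_on h s"
      by (rule finite_subset[OF sX assms(1)], rule inj_on_subset[OF assms(3) sX],
        rule inj_on_subset[OF assms(4) image_mono[OF sX]], rule inj_on_subset[OF assms(5) sX])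
    have hs: "h ` s = {h v} \<longleftrightarrow> s = {v}" if "v \<in> s" for v
      using inj_on_image_eq_iff[OF s(4), of s "{v}"] that by simp
    have num'_card: "card {u \<in> h ` s. num' u < num' (h v)} = card {u \<in> s. num' (h u) < num' (h v)}" for v
    proof -
      have "{u \<in> h ` s. num' u < num' (h v)} = h ` {u \<in> s. num' (h u) < num' (h v)}" by auto
      moreover have "inj_on h {u \<in> s. num' (h u) < num' (h v)}" by (rule inj_on_subset[OF s(4)]) auto
      ultimately show ?thesis by (simp add: card_image)
    qed
    have "lin_ext (simplex_boundary num') (psingle (h ` s) (?e s)) =
      (\<Sum>v\<in>{v \<in> h ` s. h ` s \<noteq> {v}}. psingle (h ` s - {v}) (?e s * (-1) ^ card {u \<in> h ` s. num' u < num' v}))"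
      by (simp add: lin_ext_single simplex_boundary_def chains.scale_sum_right chain_scale_single)
    also have "\<dots> = (\<Sum>v\<in>{v \<in> s. s \<noteq> {v}}. psingle (h ` s - {h v}) (?e s * (-1) ^ card {u \<in> s. num' (h u) < num' (h v)}))"
    proof -
      have "{v \<in> h ` s. h ` s \<noteq> {v}} = h ` {v \<in> s. s \<noteq> {v}}" using hs by blast
      moreover have "inj_on h {v \<in> s. s \<noteq> {v}}" by (rule inj_on_subset[OF s(4)]) auto
      ultimately show ?thesis by (simp add: sum.reindex num'_card)
    qed
    also have "\<dots> = (\<Sum>v\<in>{v \<in> s. s \<noteq> {v}}. psingle (h ` (s - {v})) ((-1) ^ card {u \<in> s. num u < num v} * ?e (s - {v})))"
    proof (intro sum.cong refl)
      fix v assume "v \<in> {v \<in> s. s \<noteq> {v}}"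
      then have v: "v \<in> s" by simp
      have "h ` s - {h v} = h ` (s - {v})" using s v by (auto simp: inj_on_def)
      then show "psingle (h ` s - {h v}) (?e s * (-1) ^ card {u \<in> s. num' (h u) < num' (h v)}) =
         psingle (h ` (s - {v})) ((-1) ^ card {u \<in> s. num u < num v} * ?e (s - {v}))"
        by (simp only: sign_inversions[OF s(1) v s(2-4)])
    qed
    also have "\<dots> = relabel h num num' (simplex_boundary num s)"
    proof -
      interpret R: Vector_Spaces.linear chain_scale chain_scale "relabel h num num'" by (rule linear_relabel)
      show ?thesis
        by (simp add: simplex_boundary_def R.sum) (simp add: relabel_def lin_ext_single chain_scale_single)
    qed
    finally show ?thesis .
  qed
  then show ?thesis
    unfolding boundary_eq_lin_ext
    by (subst relabel_def) (simp add: lin_ext_lin_ext relabel_def cong: lin_ext_cong)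
qed

lemma lookup_relabel:
  assumes "\<And>s. s \<in> keys x \<Longrightarrow> s \<subseteq> X" "inj_on h X" "s \<subseteq> X"
  shows "lookup (relabel h num num' x) (h ` s) =
    lookup x s * (-1) ^ card {(u, w) \<in> s \<times> s. num u < num w \<and> num' (h w) < num' (h u)}"
proof -
  let ?e = "\<lambda>s. (-1) ^ card {(u, w) \<in> s \<times> s. num u < num w \<and> num' (h w) < num' (h u)}"
  have "h ` t = h ` s \<longleftrightarrow> t = s" if "t \<in> keys x" for t
    using assms that by (metis inj_on_image_eq_iff)
  then have "lookup (relabel h num num' x) (h ` s) = (\<Sum>t\<in>keys x. if t = s then lookup x s * ?e s else 0)"
    unfolding relabel_def lin_ext_def lookup_chain_sum
    by (intro sum.cong) (auto simp: lookup_single when_def)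
  also have "\<dots> = lookup x s * ?e s" by (simp add: in_keys_iff)
  finally show ?thesis .
qed

lemma keys_relabel: "keys (relabel h num num' x) \<subseteq> (`) h ` keys x"
  unfolding relabel_def
  by (rule subset_trans[OF keys_lin_ext]) (auto split: if_splits)

lemma inj_on_relabel:
  assumes "inj_on h X"
  shows "inj_on (relabel h num num') {x. \<forall>s\<in>keys x. s \<subseteq> X}"
proof (rule inj_onI)
  fix x y assume x: "x \<in> {x. \<forall>s\<in>keys x. s \<subseteq> X}" and y: "y \<in> {x. \<forall>s\<in>keys x. s \<subseteq> X}"
    and eq: "relabel h num num' x = relabel h num num' y"
  show "x = y"
  proof (rule poly_mapping_eqI)
    fix s show "lookup x s = lookup y s"
    proof (cases "s \<subseteq> X")
      case True
      then show ?thesis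
        using lookup_relabel[OF _ assms True, of x num num'] lookup_relabel[OF _ assms True, of y num num'] x y eq
        by simp
    next
      case False
      then show ?thesis using x y by (metis (mono_tags, lifting) in_keys_iff mem_Collect_eq)
    qed
  qed
qed

section \<open>Filtrations of a full simplex by a finite monotone weight\<close>

locale finite_weight =
  fixes \<kappa> :: "'v set \<Rightarrow> ennreal"
  assumes kappa_mono: "\<sigma> \<noteq> {} \<Longrightarrow> finite \<tau> \<Longrightarrow> \<sigma> \<subseteq> \<tau> \<Longrightarrow> \<kappa> \<sigma> \<le> \<kappa> \<tau>"
    and kappa_finite: "finite \<sigma> \<Longrightarrow> \<sigma> \<noteq> {} \<Longrightarrow> \<kappa> \<sigma> < \<infinity>"
begin

text \<open>Finiteness of the weight enters here: every nonempty subset of \<open>X\<close> appears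
  at some finite time, so the filtration ends with the full simplex.\<close>

lemma total_complex_kappa:
  assumes "finite X"
  shows "total_complex (kappa_filtration \<kappa> X) = {\<sigma>. \<sigma> \<noteq> {} \<and> \<sigma> \<subseteq> X}"
proof -
  have "\<exists>t\<ge>0. \<kappa> \<sigma> \<le> ennreal t" if "\<sigma> \<noteq> {}" "\<sigma> \<subseteq> X" for \<sigma>
    using kappa_finite[of \<sigma>] that assms
    by (intro exI[of _ "enn2real (\<kappa> \<sigma>)"]) (auto simp: finite_subset)
  then show ?thesis unfolding total_complex_def kappa_filtration_def by blast
qed

lemma entry_time_kappa:
  assumes "finite X" "\<sigma> \<noteq> {}" "\<sigma> \<subseteq> X"
  shows "entry_time (kappa_filtration \<kappa> X) \<sigma> = \<kappa> \<sigma>"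
proof -
  have "\<kappa> \<sigma> = ennreal (enn2real (\<kappa> \<sigma>))" using kappa_finite[of \<sigma>] assms by (simp add: finite_subset)
  then show ?thesis
    unfolding entry_time_def using assms
    by (intro antisym Inf_greatest Inf_lower)
      (auto simp: kappa_filtration_def intro!: exI[of _ "enn2real (\<kappa> \<sigma>)"])
qed

lemma ex_inj_num:
  fixes X :: "'v set"
  assumes "finite X"
  obtains num :: "'v \<Rightarrow> nat" where "inj_on num X"
  using finite_imp_inj_to_nat_seg[OF assms] by auto

text \<open>Resolves \<open>SOME\<close>: the diagram comes from some numbering and some
  decomposition, about which nothing further is known.\<close>

lemma verbose_diagram_svd:
  assumes X: "finite X"
  obtains num and ys xs :: "('v set \<Rightarrow>\<^sub>0 'f::field) list"
  where "inj_on num X" "is_svd (kappa_filtration \<kappa> X) num q ys xs"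
    "verbose_diagram TYPE('f) q (kappa_filtration \<kappa> X) = svd_diagram (kappa_filtration \<kappa> X) num q ys xs"
proof -
  let ?K = "kappa_filtration \<kappa> X"
  let ?L = "{\<sigma>. \<sigma> \<noteq> {} \<and> \<sigma> \<subseteq> X}"
  have tot: "total_complex ?K = ?L" by (rule total_complex_kappa[OF X])
  have Un: "\<Union>?L = X" by auto
  obtain num :: "'v \<Rightarrow> nat" where num: "inj_on num X" by (rule ex_inj_num[OF X])
  have "finite ?L" by (rule finite_subset[of _ "Pow X"]) (use X in auto)
  then obtain rk where "ranked_complex ?K ?L rk" by (rule ex_ranked_complex)
  then interpret ranked_complex ?K ?L rk .
  have "\<exists>(ys :: ('v set \<Rightarrow>\<^sub>0 'f) list) xs. is_svd ?K num q ys xs"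
    by (rule ex_svd[OF tot]) (use X num finite_subset in \<open>auto simp: Un\<close>)
  then have "\<exists>D num (ys :: ('v set \<Rightarrow>\<^sub>0 'f) list) xs.
     inj_on num (\<Union>(total_complex ?K)) \<and> is_svd ?K num q ys xs \<and> D = svd_diagram ?K num q ys xs"
    using num unfolding tot Un by blast
  from someI_ex[OF this] show ?thesis
    using that unfolding tot Un verbose_diagram_def by blast
qed

lemma verbose_diagram_rectangle:
  assumes X: "finite X"
  obtains num where "inj_on num X"
    "\<And>I J. down_closed I \<Longrightarrow> down_closed J \<Longrightarrow>
      size (filter_mset (\<lambda>p. p \<in> I \<times> J) (verbose_diagram TYPE('f::field) q (kappa_filtration \<kappa> X)))
       = diagram_rank TYPE('f) (kappa_filtration \<kappa> X) num q I J"
  by (rule verbose_diagram_svd[OF X, where 'f = 'f and q = q], rule that)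
    (simp_all add: size_svd_diagram_rectangle)

text \<open>A simplex realising the birth of a boundary is a face of a simplex in the bounding
  chain, so monotonicity puts births before deaths; births are values of \<kappa> and hence finite.
  No point is therefore lost when the Dirac sum is restricted to \<open>Delta'\<close>.\<close>

lemma verbose_diagram_subset_Delta':
  assumes X: "finite X"
  shows "set_mset (verbose_diagram TYPE('f::field) q (kappa_filtration \<kappa> X)) \<subseteq> Delta'"
proof
  fix p assume p: "p \<in># verbose_diagram TYPE('f) q (kappa_filtration \<kappa> X)"
  let ?K = "kappa_filtration \<kappa> X"
  obtain num and ys xs :: "('v set \<Rightarrow>\<^sub>0 'f::field) list"
    where num: "inj_on num X" and svd: "is_svd ?K num q ys xs"
     and D: "verbose_diagram TYPE('f) q ?K = svd_diagram ?K num q ys xs"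
    by (rule verbose_diagram_svd[OF X])
  note tot = total_complex_kappa[OF X]
  let ?r = "boundary_rank TYPE('f) num (q + 1) (total_complex ?K)"
  obtain i where i: "i < length xs"
    "p = (e2ennreal (level ?K (xs ! i)), if i < ?r then e2ennreal (level ?K (ys ! i)) else \<infinity>)"
    using p unfolding D svd_diagram_def Let_def by auto
  have "xs ! i \<in> cycles num q (total_complex ?K)"
    using svd i(1) chains.span_base[of "xs ! i" "set xs"] by (auto simp: is_svd_def Let_def orthogonal_basis_def)
  then have keys_x: "keys (xs ! i) \<subseteq> total_complex ?K" by (auto simp: cycles_def chain_group_def)
  have "xs ! i \<noteq> 0" using svd_nonzero(1)[OF svd] i(1) by (metis nth_mem)
  then obtain s where s: "s \<in> keys (xs ! i)" "level ?K (xs ! i) = enn2ereal (entry_time ?K s)"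
    using level_attained by metis
  then have s': "s \<noteq> {}" "s \<subseteq> X" "finite s" using keys_x X finite_subset unfolding tot by auto
  then have birth: "e2ennreal (level ?K (xs ! i)) = \<kappa> s"
    using s entry_time_kappa[OF X] by (simp add: e2ennreal_enn2ereal)
  have birth_fin: "\<kappa> s < \<infinity>" using kappa_finite s' by simp
  show "p \<in> Delta'"
  proof (cases "i < ?r")
    case True
    then have "xs ! i = boundary num (ys ! i)" using svd by (auto simp: is_svd_def Let_def)
    with s have "s \<in> keys (boundary num (ys ! i))" by simp
    then obtain t v where t: "t \<in> keys (ys ! i)" "v \<in> t" "t \<noteq> {v}" "s = t - {v}"
      by (rule in_keys_boundaryE)
    have "i < length ys" using svd_lengths(2)[OF svd] True by simp
    then have "ys ! i \<in> chain_group (q + 1) (total_complex ?K)"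
      using svd chains.span_base[of "ys ! i" "set ys"] by (auto simp: is_svd_def Let_def orthogonal_basis_def)
    then have "t \<in> total_complex ?K" using t by (auto simp: chain_group_def)
    then have t': "t \<noteq> {}" "t \<subseteq> X" "finite t" using X finite_subset unfolding tot by auto
    have "enn2ereal (entry_time ?K t) \<le> level ?K (ys ! i)"
      using t unfolding level_def by (intro Max_ge) auto
    then have "enn2ereal (\<kappa> t) \<le> level ?K (ys ! i)"
      using entry_time_kappa[OF X t'(1,2)] by simp
    then have "e2ennreal (enn2ereal (\<kappa> t)) \<le> e2ennreal (level ?K (ys ! i))" by (rule e2ennreal_mono)
    moreover have "\<kappa> s \<le> \<kappa> t" using s' t t' by (intro kappa_mono) auto
    ultimately show ?thesis using True i birth birth_fin by (auto simp: Delta'_def e2ennreal_enn2ereal)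
  qed (use i birth birth_fin in \<open>auto simp: Delta'_def\<close>)
qed

lemma sublevel_iff:
  assumes "finite X" "x \<in> chain_group q (total_complex (kappa_filtration \<kappa> X))"
  shows "x \<in> sublevel (kappa_filtration \<kappa> X) S \<longleftrightarrow> (\<forall>s\<in>keys x. \<kappa> s \<in> S)"
proof -
  have "entry_time (kappa_filtration \<kappa> X) s = \<kappa> s" if "s \<in> keys x" for s
    using that assms(2) unfolding total_complex_kappa[OF assms(1)] chain_group_def
    by (intro entry_time_kappa assms(1)) auto
  then show ?thesis by (simp add: sublevel_def)
qed

lemma boundary_chain_group:
  fixes x :: "'v set \<Rightarrow>\<^sub>0 'f::field"
  assumes X: "finite X" and x: "x \<in> chain_group (q + 1) (total_complex (kappa_filtration \<kappa> X))"
  shows "boundary num x \<in> chain_group q (total_complex (kappa_filtration \<kappa> X))"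
  unfolding chain_group_def
proof safe
  fix t assume "t \<in> keys (boundary num x)"
  then obtain s v where s: "s \<in> keys x" "v \<in> s" "s \<noteq> {v}" "t = s - {v}" by (rule in_keys_boundaryE)
  then have "s \<noteq> {}" "s \<subseteq> X" "card s = q + 2"
    using x total_complex_kappa[OF X] by (auto simp: chain_group_def)
  moreover from this have "finite s" using X finite_subset by auto
  ultimately show "t \<in> total_complex (kappa_filtration \<kappa> X)" "card t = q + 1"
    using s total_complex_kappa[OF X] by auto
qed

lemma chain_group_finite_span:
  assumes X: "finite X"
  obtains T :: "('v set \<Rightarrow>\<^sub>0 'f::field) set"
  where "finite T" "chain_group q (total_complex (kappa_filtration \<kappa> X)) \<subseteq> chains.span T"
    "card T \<le> card X choose (q + 1)"
proof -
  let ?A = "{s. s \<subseteq> X \<and> card s = q + 1}"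
  have A: "{s \<in> total_complex (kappa_filtration \<kappa> X). card s = q + 1} = ?A"
    unfolding total_complex_kappa[OF X] by auto
  have fin: "finite ?A" by (rule finite_subset[of _ "Pow X"]) (use X in auto)
  show ?thesis
  proof (rule that)
    show "chain_group q (total_complex (kappa_filtration \<kappa> X)) \<subseteq> chains.span ((\<lambda>s. psingle s (1::'f)) ` ?A)"
      using chain_group_subset_span unfolding A[symmetric] .
    show "card ((\<lambda>s. psingle s (1::'f)) ` ?A) \<le> card X choose (q + 1)"
      using card_image_le[OF fin] n_subsets[OF X] by metis
  qed (use fin in simp)
qed

lemma relabel_chain_group:
  fixes x :: "'v set \<Rightarrow>\<^sub>0 'f::field"
  assumes X: "finite X" "bij_betw h X X'" and x: "x \<in> chain_group q (total_complex (kappa_filtration \<kappa> X))"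
  shows "relabel h num num' x \<in> chain_group q (total_complex (kappa_filtration \<kappa> X'))"
  unfolding chain_group_def
proof safe
  have X': "finite X'" using X bij_betw_finite by auto
  fix t assume "t \<in> keys (relabel h num num' x)"
  then obtain s where s: "s \<in> keys x" "t = h ` s"
    by (auto dest!: keys_relabel[THEN subsetD])
  have "s \<noteq> {}" "s \<subseteq> X" "card s = q + 1"
    using x s total_complex_kappa[OF X(1)] by (auto simp: chain_group_def)
  moreover have "card (h ` s) = card s"
    using X(2) \<open>s \<subseteq> X\<close> by (intro card_image) (auto simp: bij_betw_def intro: inj_on_subset)
  ultimately show "t \<in> total_complex (kappa_filtration \<kappa> X')" "card t = q + 1"
    using s X(2) total_complex_kappa[OF X'] by (auto simp: bij_betw_def)
qed

text \<open>The relabelling map embeds the space counted on the left into the one on the right. The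
  hypotheses go one way only, so equality comes from applying this to the inverse bijection as
  well.\<close>

lemma diagram_rank_relabel:
  assumes X: "finite X" "bij_betw h X X'" and num: "inj_on num X" "inj_on num' X'"
    and I: "\<And>\<sigma>. \<sigma> \<noteq> {} \<Longrightarrow> \<sigma> \<subseteq> X \<Longrightarrow> \<kappa> \<sigma> \<in> I \<Longrightarrow> \<kappa> (h ` \<sigma>) \<in> I"
    and J: "\<And>\<sigma>. \<sigma> \<noteq> {} \<Longrightarrow> \<sigma> \<subseteq> X \<Longrightarrow> \<kappa> \<sigma> \<in> J \<Longrightarrow> \<kappa> (h ` \<sigma>) \<in> J"
  shows "diagram_rank TYPE('f::field) (kappa_filtration \<kappa> X) num q I J
    \<le> diagram_rank TYPE('f) (kappa_filtration \<kappa> X') num' q I J"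
proof -
  let ?K = "kappa_filtration \<kappa> X" and ?K' = "kappa_filtration \<kappa> X'"
  let ?T = "relabel h num num' :: ('v set \<Rightarrow>\<^sub>0 'f) \<Rightarrow> _"
  let ?C = "\<lambda>q. chain_group q (total_complex ?K) :: ('v set \<Rightarrow>\<^sub>0 'f) set"
  let ?C' = "\<lambda>q. chain_group q (total_complex ?K') :: ('v set \<Rightarrow>\<^sub>0 'f) set"
  have X': "finite X'" and hX: "h ` X = X'" "inj_on h X"
    using X bij_betw_finite by (auto simp: bij_betw_def)
  interpret T: Vector_Spaces.linear chain_scale chain_scale ?T by (rule linear_relabel)
  interpret D: Vector_Spaces.linear chain_scale chain_scale "boundary num :: ('v set \<Rightarrow>\<^sub>0 'f) \<Rightarrow> _"
    by (rule linear_boundary)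
  have keys_C: "s \<noteq> {} \<and> s \<subseteq> X" if "x \<in> ?C q" "s \<in> keys x" for x q s
    using that total_complex_kappa[OF X(1)] by (auto simp: chain_group_def)
  have inj: "inj_on ?T (?C q)" for q
    by (rule inj_on_subset[OF inj_on_relabel[OF hX(2)]]) (use keys_C in auto)
  have comm: "boundary num' (?T x) = ?T (boundary num x)" if "x \<in> ?C q" for x q
    using keys_C[OF that] num hX by (intro relabel_boundary[OF X(1)]) auto
  have sub: "?T x \<in> sublevel ?K' S"
    if x: "x \<in> ?C q" "x \<in> sublevel ?K S"
      and S: "\<And>\<sigma>. \<sigma> \<noteq> {} \<Longrightarrow> \<sigma> \<subseteq> X \<Longrightarrow> \<kappa> \<sigma> \<in> S \<Longrightarrow> \<kappa> (h ` \<sigma>) \<in> S" for x q S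
  proof -
    have "\<forall>s\<in>keys (?T x). \<kappa> s \<in> S"
    proof
      fix t assume "t \<in> keys (?T x)"
      then obtain s where "s \<in> keys x" "t = h ` s"
        by (auto dest!: keys_relabel[THEN subsetD])
      then show "\<kappa> t \<in> S" using S keys_C[OF x(1)] x sublevel_iff[OF X(1) x(1)] by auto
    qed
    then show ?thesis using sublevel_iff[OF X' relabel_chain_group[OF X x(1)]] by blast
  qed
  obtain U :: "('v set \<Rightarrow>\<^sub>0 'f) set" where U: "finite U" "?C' q \<subseteq> chains.span U"
    by (rule chain_group_finite_span[OF X'])
  show ?thesis
  proof (cases "\<infinity> \<in> J")
    case True
    let ?V = "cycles num q (total_complex ?K) \<inter> sublevel ?K I :: ('v set \<Rightarrow>\<^sub>0 'f) set"
    let ?V' = "cycles num' q (total_complex ?K') \<inter> sublevel ?K' I :: ('v set \<Rightarrow>\<^sub>0 'f) set"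
    have VC: "?V \<subseteq> ?C q" by (auto simp: cycles_def)
    have "chains.dim ?V \<le> chains.dim ?V'"
    proof (rule dim_le_injective_image[OF linear_relabel])
      show "chains.subspace ?V" by (intro chains.subspace_inter subspace_cycles subspace_sublevel)
      show "inj_on ?T ?V" by (rule inj_on_subset[OF inj VC])
      show "?T ` ?V \<subseteq> ?V'"
      proof (rule image_subsetI)
        fix x assume "x \<in> ?V"
        then have x: "x \<in> ?C q" "boundary num x = 0" "x \<in> sublevel ?K I" by (auto simp: cycles_def)
        then have "boundary num' (?T x) = 0" by (simp add: comm)
        then show "?T x \<in> ?V'"
          using sub[OF x(1,3) I] relabel_chain_group[OF X x(1)] by (simp add: cycles_def)
      qed
      show "?V' \<subseteq> chains.span U" using U by (auto simp: cycles_def)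
    qed (rule U(1))
    then show ?thesis using True by (simp add: diagram_rank_def)
  next
    case False
    let ?V = "boundary num ` (?C (q + 1) \<inter> sublevel ?K J) \<inter> sublevel ?K I"
    let ?V' = "boundary num' ` (?C' (q + 1) \<inter> sublevel ?K' J) \<inter> sublevel ?K' I"
    have VC: "?V \<subseteq> ?C q" using boundary_chain_group[OF X(1)] by auto
    have "chains.dim ?V \<le> chains.dim ?V'"
    proof (rule dim_le_injective_image[OF linear_relabel])
      show "chains.subspace ?V"
        by (intro chains.subspace_inter D.subspace_image subspace_chain_group subspace_sublevel)
      show "inj_on ?T ?V" by (rule inj_on_subset[OF inj VC])
      show "?T ` ?V \<subseteq> ?V'"
      proof (rule image_subsetI)
        fix x assume x: "x \<in> ?V"
        then obtain w where w: "w \<in> ?C (q + 1)" "w \<in> sublevel ?K J" "x = boundary num w" by auto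
        have "?T w \<in> ?C' (q + 1) \<inter> sublevel ?K' J"
          using relabel_chain_group[OF X w(1)] sub[OF w(1,2) J] by simp
        then have "?T x \<in> boundary num' ` (?C' (q + 1) \<inter> sublevel ?K' J)"
          unfolding w(3) comm[OF w(1), symmetric] by (rule imageI)
        moreover have "?T x \<in> sublevel ?K' I" using x VC sub[OF _ _ I] by blast
        ultimately show "?T x \<in> ?V'" by simp
      qed
      show "?V' \<subseteq> chains.span U" using U boundary_chain_group[OF X'] by auto
    qed (rule U(1))
    then show ?thesis using False by (simp add: diagram_rank_def)
  qed
qed

end

section \<open>Cones and lower bounds for the number of births\<close>

text \<open>The coefficients at the test simplices \<open>t j\<close> form a diagonal matrix without
  zeros on the diagonal.\<close>

lemma independent_dual:
  fixes e :: "'i \<Rightarrow> ('v set \<Rightarrow>\<^sub>0 'f::field)"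
  assumes fin: "finite A" and diag: "\<And>i. i \<in> A \<Longrightarrow> lookup (e i) (t i) \<noteq> 0"
    and off: "\<And>i j. i \<in> A \<Longrightarrow> j \<in> A \<Longrightarrow> i \<noteq> j \<Longrightarrow> lookup (e i) (t j) = 0"
  shows "inj_on e A" "\<not> chains.dependent (e ` A)"
proof -
  show inj: "inj_on e A"
    by (rule inj_onI) (metis diag off)
  show "\<not> chains.dependent (e ` A)"
  proof
    assume "chains.dependent (e ` A)"
    then obtain u where u: "\<exists>v\<in>e ` A. u v \<noteq> 0" "(\<Sum>v\<in>e ` A. chain_scale (u v) v) = 0"
      using chains.dependent_finite[of "e ` A"] fin by auto
    then obtain j where j: "j \<in> A" "u (e j) \<noteq> 0" by auto
    have "0 = lookup (\<Sum>i\<in>A. chain_scale (u (e i)) (e i)) (t j)"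
      using u(2) by (simp add: sum.reindex[OF inj])
    also have "\<dots> = (\<Sum>i\<in>A. if i = j then u (e j) * lookup (e j) (t j) else 0)"
      unfolding lookup_chain_sum by (intro sum.cong) (auto simp: off j)
    also have "\<dots> = u (e j) * lookup (e j) (t j)" using fin j by simp
    finally show False using diag j by simp
  qed
qed

lemma boundary_psingle: "boundary num (psingle s 1) = simplex_boundary num s"
  by (simp add: boundary_eq_lin_ext lin_ext_single)

lemma lookup_simplex_boundary_face:
  assumes "finite s" "v \<in> s" "s \<noteq> {v}"
  shows "lookup (simplex_boundary num s) (s - {v}) \<noteq> (0 :: 'f::field)"
proof -
  have "s - {u} = s - {v} \<longleftrightarrow> u = v" if "u \<in> s" for u using that assms by auto
  then have "lookup (simplex_boundary num s) (s - {v})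
    = (\<Sum>u\<in>{u \<in> s. s \<noteq> {u}}. if u = v then (-1 :: 'f) ^ card {u \<in> s. num u < num v} else 0)"
    unfolding simplex_boundary_def lookup_sum by (intro sum.cong) (auto simp: lookup_single when_def)
  also have "\<dots> = (-1) ^ card {u \<in> s. num u < num v}"
    using assms by simp
  finally show ?thesis by simp
qed

lemma simplex_boundary_vertex: "simplex_boundary num {v} = 0"
proof -
  have "{u \<in> {v}. {v} \<noteq> {u}} = {}" by auto
  then show ?thesis unfolding simplex_boundary_def by (simp only: sum.empty)
qed

text \<open>The dimension of the q-cycles of the full simplex on \<open>k\<close> vertices. In the
  unreduced complex every vertex is a cycle; for \<open>q \<ge> 1\<close> the boundaries of the
  cones over the q-simplices avoiding one fixed vertex form a basis. At \<open>k = 0\<close> the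
  truncated subtraction still gives 0.\<close>

definition cone_count :: "nat \<Rightarrow> nat \<Rightarrow> nat" where
  "cone_count q k = (if q = 0 then k else (k - 1) choose (q + 1))"

context finite_weight
begin

text \<open>There are at most as many births as q-simplices. This is crude for
  \<open>q \<ge> 1\<close>, where it yields integrability from the moments, but sharp for
  \<open>q = 0\<close>.\<close>

lemma size_verbose_diagram_le:
  assumes X: "finite X"
  shows "size (verbose_diagram TYPE('f::field) q (kappa_filtration \<kappa> X)) \<le> card X choose (q + 1)"
proof -
  let ?K = "kappa_filtration \<kappa> X"
  obtain num where num: "inj_on num X"
    "\<And>I J. down_closed I \<Longrightarrow> down_closed J \<Longrightarrow>
      size (filter_mset (\<lambda>p. p \<in> I \<times> J) (verbose_diagram TYPE('f::field) q ?K))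
       = diagram_rank TYPE('f) ?K num q I J"
    using verbose_diagram_rectangle[OF X, where 'f = 'f and q = q] by blast
  obtain T :: "('v set \<Rightarrow>\<^sub>0 'f::field) set"
  where T: "finite T" "chain_group q (total_complex ?K) \<subseteq> chains.span T" "card T \<le> card X choose (q + 1)"
    by (rule chain_group_finite_span[OF X])
  have "size (verbose_diagram TYPE('f) q ?K) = diagram_rank TYPE('f) ?K num q UNIV UNIV"
    using num(2)[of UNIV UNIV] by (simp add: down_closed_def)
  also have "\<dots> \<le> card T"
    unfolding diagram_rank_def using T by (auto simp: cycles_def intro!: chains.dim_le_card)
  finally show ?thesis using T by simp
qed

text \<open>The numbering behind \<open>verbose_diagram\<close> is unknown, so the cycles
  \<open>e num i\<close> are supplied for every numbering; the test simplices \<open>t i\<close> are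
  fixed beforehand.\<close>

lemma verbose_births_ge_independent:
  fixes e :: "('v \<Rightarrow> nat) \<Rightarrow> 'i \<Rightarrow> ('v set \<Rightarrow>\<^sub>0 'f::field)"
  assumes X: "finite X" and A: "finite A"
    and e: "\<And>num i. inj_on num X \<Longrightarrow> i \<in> A \<Longrightarrow> e num i \<in> cycles num q (total_complex (kappa_filtration \<kappa> X))"
    and lev: "\<And>num i s. i \<in> A \<Longrightarrow> s \<in> keys (e num i) \<Longrightarrow> \<kappa> s \<le> a"
    and diag: "\<And>num i. i \<in> A \<Longrightarrow> lookup (e num i) (t i) \<noteq> 0"
    and off: "\<And>num i j. i \<in> A \<Longrightarrow> j \<in> A \<Longrightarrow> i \<noteq> j \<Longrightarrow> lookup (e num i) (t j) = 0"
  shows "card A \<le> size (filter_mset (\<lambda>p. fst p \<le> a) (verbose_diagram TYPE('f) q (kappa_filtration \<kappa> X)))"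
proof -
  let ?K = "kappa_filtration \<kappa> X"
  obtain num where num: "inj_on num X"
    "\<And>I J. down_closed I \<Longrightarrow> down_closed J \<Longrightarrow>
      size (filter_mset (\<lambda>p. p \<in> I \<times> J) (verbose_diagram TYPE('f::field) q ?K))
       = diagram_rank TYPE('f) ?K num q I J"
    using verbose_diagram_rectangle[OF X, where 'f = 'f and q = q] by blast
  obtain T :: "('v set \<Rightarrow>\<^sub>0 'f::field) set"
    where T: "finite T" "chain_group q (total_complex ?K) \<subseteq> chains.span T"
    by (rule chain_group_finite_span[OF X])
  let ?V = "cycles num q (total_complex ?K) \<inter> sublevel ?K {..a} :: ('v set \<Rightarrow>\<^sub>0 'f) set"
  have "card A = card (e num ` A)"
    by (rule card_image[symmetric], rule independent_dual(1)[OF A diag off])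
  also have "\<dots> \<le> chains.dim ?V"
  proof (rule independent_card_le_dim)
    show "\<not> chains.dependent (e num ` A)"
      by (rule independent_dual(2)[OF A diag off])
    show "e num ` A \<subseteq> ?V"
    proof (rule image_subsetI)
      fix i assume i: "i \<in> A"
      have "e num i \<in> chain_group q (total_complex ?K)" using e[OF num(1) i] by (simp add: cycles_def)
      from sublevel_iff[OF X this, of "{..a}"] show "e num i \<in> ?V"
        using e[OF num(1) i] lev[OF i] by auto
    qed
  qed (use T in \<open>auto simp: cycles_def\<close>)
  also have "\<dots> = size (filter_mset (\<lambda>p. p \<in> {..a} \<times> UNIV) (verbose_diagram TYPE('f::field) q ?K))"
    by (subst num(2)) (auto simp: down_closed_def diagram_rank_def)
  finally show ?thesis by (simp add: mem_Times_iff)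
qed

text \<open>Every face of the cone over \<open>s\<close> other than \<open>s\<close> itself contains
  the apex, so among the cones of one set \<open>s\<close> occurs only in its own boundary; cones of
  different sets share no vertex. All simplices involved lie in some \<open>Y j\<close>, and by
  monotonicity they have weight at most \<open>a\<close>.\<close>

lemma verbose_births_ge:
  fixes Y :: "'i \<Rightarrow> 'v set"
  assumes X: "finite X" and A: "finite A" and Y: "\<And>j. j \<in> A \<Longrightarrow> Y j \<subseteq> X" "disjoint_family_on Y A"
  shows "(\<Sum>j\<in>A. if Y j \<noteq> {} \<and> \<kappa> (Y j) \<le> a then cone_count q (card (Y j)) else 0)
    \<le> size (filter_mset (\<lambda>p. fst p \<le> a) (verbose_diagram TYPE('f::field) q (kappa_filtration \<kappa> X)))"
proof -
  let ?L = "total_complex (kappa_filtration \<kappa> X)"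
  define A' where "A' = {j \<in> A. Y j \<noteq> {} \<and> \<kappa> (Y j) \<le> a}"
  have A': "finite A'" "A' \<subseteq> A" using A by (auto simp: A'_def)
  have finY: "finite (Y j)" if "j \<in> A'" for j using that A' Y X finite_subset by blast
  have same: "i = j" if "i \<in> A'" "j \<in> A'" "x \<in> Y i" "x \<in> Y j" for i j x
    using that A' Y(2) by (auto simp: disjoint_family_on_def)
  have kap: "\<kappa> s \<le> a" if "j \<in> A'" "s \<subseteq> Y j" "s \<noteq> {}" for s j
    using kappa_mono[of s "Y j"] finY that by (force simp: A'_def)
  have tot: "?L = {\<sigma>. \<sigma> \<noteq> {} \<and> \<sigma> \<subseteq> X}" by (rule total_complex_kappa[OF X])
  have YX: "Y j \<subseteq> X" if "j \<in> A'" for j using that A' Y by auto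
  have "(\<Sum>j\<in>A. if Y j \<noteq> {} \<and> \<kappa> (Y j) \<le> a then cone_count q (card (Y j)) else 0)
    = (\<Sum>j\<in>A'. cone_count q (card (Y j)))"
    unfolding A'_def by (subst sum.inter_filter[OF A]) simp
  also have "\<dots> \<le> size (filter_mset (\<lambda>p. fst p \<le> a) (verbose_diagram TYPE('f::field) q (kappa_filtration \<kappa> X)))"
  proof (cases "q = 0")
    case True
    \<comment> \<open>In degree 0 the vertices themselves are independent cycles, and no vertex is
      spent as an apex.\<close>
    define I where "I = Sigma A' Y"
    define e where "e = (\<lambda>(num :: 'v \<Rightarrow> nat) (j :: 'i, v :: 'v). psingle {v} (1 :: 'f))"
    have "(\<Sum>j\<in>A'. cone_count q (card (Y j))) = card I"
      using True A' finY by (simp add: cone_count_def I_def card_SigmaI)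
    also have "\<dots> \<le> size (filter_mset (\<lambda>p. fst p \<le> a) (verbose_diagram TYPE('f) q (kappa_filtration \<kappa> X)))"
    proof (rule verbose_births_ge_independent[OF X, where e = e and t = "\<lambda>(j, v). {v}"])
      show "finite I" using A' finY by (auto simp: I_def)
      show "e num i \<in> cycles num q ?L" if "i \<in> I" for num i
      proof -
        obtain j v where "i = (j, v)" "j \<in> A'" "v \<in> Y j" using \<open>i \<in> I\<close> unfolding I_def by blast
        moreover from this have "v \<in> X" using YX by blast
        ultimately show ?thesis
          using True by (simp add: e_def cycles_def chain_group_def tot boundary_psingle simplex_boundary_vertex)
      qed
      show "\<kappa> s \<le> a" if "i \<in> I" "s \<in> keys (e num i)" for num i s
        using that kap by (auto simp: e_def I_def split: if_splits)
      show "lookup (e num i) ((\<lambda>(j, v). {v}) i) \<noteq> 0" for num i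
        by (auto simp: e_def split: prod.splits)
      show "lookup (e num i) ((\<lambda>(j, v). {v}) i') = 0" if ii': "i \<in> I" "i' \<in> I" "i \<noteq> i'" for num i i'
      proof -
        obtain j v j' v' where eq: "i = (j, v)" "i' = (j', v')" by (cases i, cases i')
        then have "v \<noteq> v'" using ii' same[of j j' v] unfolding I_def by blast
        then show ?thesis by (simp add: e_def eq lookup_single)
      qed
    qed
    finally show ?thesis .
  next
    case False
    define v where "v j = (SOME v. v \<in> Y j)" for j
    have v: "v j \<in> Y j" if "j \<in> A'" for j
      unfolding v_def by (rule someI_ex) (use that in \<open>auto simp: A'_def\<close>)
    \<comment> \<open>Leaving out the apex \<open>v j\<close> accounts for the \<open>k - 1\<close>
      in \<open>cone_count\<close>.\<close>
    define B where "B j = {s. s \<subseteq> Y j - {v j} \<and> card s = q + 1}" for j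
    define I where "I = Sigma A' B"
    define e where "e = (\<lambda>(num :: 'v \<Rightarrow> nat) (j, s). boundary num (psingle (insert (v j) s) (1 :: 'f)))"
    have I: "j \<in> A'" "s \<subseteq> Y j" "v j \<notin> s" "card s = q + 1" "s \<noteq> {}" "finite s" "v j \<in> Y j"
      "insert (v j) s \<subseteq> Y j" "insert (v j) s \<noteq> {v j}"
      if "(j, s) \<in> I" for j s
    proof -
      have js: "j \<in> A'" "s \<subseteq> Y j - {v j}" "card s = q + 1" using that by (auto simp: I_def B_def)
      then show "j \<in> A'" "s \<subseteq> Y j" "v j \<notin> s" "card s = q + 1" by auto
      show "finite s" using js finY by (meson finite_Diff finite_subset)
      show "s \<noteq> {}" using js by auto
      then obtain u where "u \<in> s" by auto
      with js show "insert (v j) s \<noteq> {v j}" by auto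
      show "v j \<in> Y j" using v js by simp
      with js show "insert (v j) s \<subseteq> Y j" by auto
    qed
    have finB: "finite (B j)" if "j \<in> A'" for j
      by (rule finite_subset[of _ "Pow (Y j)"]) (use that finY in \<open>auto simp: B_def\<close>)
    have cardB: "card (B j) = cone_count q (card (Y j))" if "j \<in> A'" for j
      using that v finY False by (simp add: B_def n_subsets cone_count_def)
    have keys_e: "\<exists>u\<in>insert (v j) s. k = insert (v j) s - {u}" if "k \<in> keys (e num (j, s))" for k num j s
      using that keys_simplex_boundary[of num "insert (v j) s"] by (auto simp: e_def boundary_psingle)
    have "(\<Sum>j\<in>A'. cone_count q (card (Y j))) = card I"
      using A' finB cardB by (simp add: I_def card_SigmaI)
    also have "\<dots> \<le> size (filter_mset (\<lambda>p. fst p \<le> a) (verbose_diagram TYPE('f) q (kappa_filtration \<kappa> X)))"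
    proof (rule verbose_births_ge_independent[OF X, where e = e and t = snd])
      show "finite I" using A' finB by (auto simp: I_def)
      show "e num i \<in> cycles num q ?L" if num: "inj_on num X" and i: "i \<in> I" for num i
      proof -
        obtain j s where i': "i = (j, s)" by (cases i)
        note js = I[OF i[unfolded i']]
        have sX: "insert (v j) s \<subseteq> X" using js YX by blast
        have "psingle (insert (v j) s) (1 :: 'f) \<in> chain_group (q + 1) ?L"
          using js sX by (simp add: chain_group_def tot)
        then have "e num i \<in> chain_group q ?L"
          unfolding i' e_def by (simp only: prod.case boundary_chain_group[OF X])
        moreover have "boundary num (e num i) = 0"
          unfolding i' e_def prod.case
        proof (rule boundary_boundary)
          fix k assume "k \<in> keys (psingle (insert (v j) s) (1 :: 'f))"
          then have "k = insert (v j) s" by simp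
          then show "finite k \<and> inj_on num k" using js(6) inj_on_subset[OF num sX] by blast
        qed
        ultimately show ?thesis by (simp add: cycles_def)
      qed
      show "\<kappa> k \<le> a" if "i \<in> I" and k: "k \<in> keys (e num i)" for num i k
      proof -
        obtain j s where i': "i = (j, s)" by (cases i)
        note js = I[OF that(1)[unfolded i']]
        obtain u where u: "u \<in> insert (v j) s" "k = insert (v j) s - {u}"
          using keys_e[of k num j s] k i' by blast
        have "k \<noteq> {}" using u js by auto
        moreover have "k \<subseteq> Y j" unfolding u(2) using js(8) by (rule subset_trans[OF Diff_subset])
        ultimately show ?thesis using kap[OF js(1)] by simp
      qed
      show "lookup (e num i) (snd i) \<noteq> 0" if "i \<in> I" for num i
      proof -
        obtain j s where i': "i = (j, s)" by (cases i)
        note js = I[OF that(1)[unfolded i']]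
        have "insert (v j) s - {v j} = s" using js(3) by simp
        then show ?thesis
          using lookup_simplex_boundary_face[of "insert (v j) s" "v j" num] js
          by (simp add: e_def i' boundary_psingle)
      qed
      show "lookup (e num i) (snd i') = 0" if "i \<in> I" "i' \<in> I" "i \<noteq> i'" for num i i'
      proof (rule ccontr)
        assume "lookup (e num i) (snd i') \<noteq> 0"
        obtain j s j' s' where js_eq: "i = (j, s)" "i' = (j', s')" by (cases i, cases i')
        note js = I[OF that(1)[unfolded js_eq]] and js' = I[OF that(2)[unfolded js_eq]]
        have "s' \<in> keys (e num (j, s))"
          using \<open>lookup (e num i) (snd i') \<noteq> 0\<close> js_eq by (simp add: in_keys_iff)
        then obtain u where u: "u \<in> insert (v j) s" "s' = insert (v j) s - {u}"
          using keys_e by blast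
        obtain x where x: "x \<in> s'" using js'(5) by blast
        \<comment> \<open>A face of the cone over \<open>s\<close> shares a vertex with
          \<open>Y j\<close>, which forces \<open>j = j'\<close>; a face without the apex can only
          be \<open>s\<close>.\<close>
        have "s' \<subseteq> Y j" unfolding u(2) using js(8) by (rule subset_trans[OF Diff_subset])
        then have jj: "j = j'" using same[OF js(1) js'(1), of x] x js'(2) by blast
        then have "v j \<notin> s'" using js'(3) by simp
        then have "u = v j" using u(2) by auto
        then have "s' = s" using u(2) js(3) by simp
        then show False using jj \<open>i \<noteq> i'\<close> js_eq by simp
      qed
    qed
    finally show ?thesis .
  qed
  finally show ?thesis .
qed

end

section \<open>Evaluation of measures in the vague topology\<close>

lemma borel_sets_radon [measurable_cong]:
  "\<mu> \<in> radon_measures UNIV \<Longrightarrow> sets \<mu> = sets borel"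
  by (simp add: radon_measures_def sets_restrict_space)

lemma integer_measures_radon: "\<mu> \<in> integer_measures S \<Longrightarrow> \<mu> \<in> radon_measures S"
  by (simp add: integer_measures_def)

lemma integer_measures_sets: "\<mu> \<in> integer_measures UNIV \<Longrightarrow> sets \<mu> = sets borel"
  by (simp add: integer_measures_radon borel_sets_radon)

lemma integer_measures_UNIV_cases:
  assumes "\<mu> \<in> integer_measures UNIV" "B \<in> sets borel" "emeasure \<mu> B < \<infinity>"
  obtains k :: nat where "emeasure \<mu> B = of_nat k"
  using assms integer_measures_sets[OF assms(1)] by (auto simp: integer_measures_def)

lemma cont_comp_suppI:
  fixes f :: "'a::t2_space \<Rightarrow> real"
  assumes "continuous_on UNIV f" "compact K" "\<And>x. x \<notin> K \<Longrightarrow> f x = 0"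
  shows "f \<in> cont_comp_supp UNIV"
proof -
  have "closure {x. f x \<noteq> 0} \<subseteq> K"
    using assms by (intro closure_minimal compact_imp_closed) auto
  then have "compact (K \<inter> closure {x. f x \<noteq> 0})"
    using assms(2) by (intro compact_Int_closed) auto
  then show ?thesis
    using assms(1) \<open>closure _ \<subseteq> K\<close> by (simp add: cont_comp_supp_def inf_absorb2)
qed

lemma cont_comp_suppE:
  fixes f :: "'a::t2_space \<Rightarrow> real"
  assumes "f \<in> cont_comp_supp UNIV"
  obtains K where "continuous_on UNIV f" "compact K" "\<And>x. x \<notin> K \<Longrightarrow> f x = 0"
proof
  show "compact (closure {x. f x \<noteq> 0})" "continuous_on UNIV f"
    using assms by (simp_all add: cont_comp_supp_def)
  show "f x = 0" if "x \<notin> closure {x. f x \<noteq> 0}" for x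
    using that closure_subset[of "{x. f x \<noteq> 0}"] by auto
qed

lemma Hausdorff_space_t2: "Hausdorff_space (euclidean :: 'a::t2_space topology)"
  unfolding Hausdorff_space_def disjnt_def by (metis hausdorff open_openin)

text \<open>Complete regularity separates \<open>x\<close> from the complement of
  \<open>W \<inter> U\<close>, where \<open>U\<close> lies in a compact set \<open>K\<close>; the
  bump then vanishes outside \<open>K\<close>.\<close>

lemma urysohn_cont_comp_supp:
  fixes W :: "'a::t2_space set"
  assumes lc: "locally_compact_space (euclidean :: 'a topology)" and W: "open W" "x \<in> W"
  obtains g :: "'a \<Rightarrow> real" where "g \<in> cont_comp_supp UNIV" "\<And>y. 0 \<le> g y" "\<And>y. g y \<le> 1" "g x = 1"
    "\<And>y. y \<notin> W \<Longrightarrow> g y = 0"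
proof -
  obtain U K where U: "open U" "compact K" "x \<in> U" "U \<subseteq> K"
  proof -
    have "\<exists>U K. open U \<and> compact K \<and> x \<in> U \<and> U \<subseteq> K"
      using lc by (simp add: locally_compact_space_def)
    then show ?thesis using that by blast
  qed
  have "completely_regular_space (euclidean :: 'a topology)"
    by (rule locally_compact_regular_imp_completely_regular_space[OF lc]) (rule disjI1[OF Hausdorff_space_t2])
  moreover have "closed (- (W \<inter> U))" "x \<notin> - (W \<inter> U)" using W U by auto
  ultimately obtain f :: "'a \<Rightarrow> real" where f: "continuous_map euclidean (top_of_set {0..1}) f" "f x = 0"
    "f ` (- (W \<inter> U)) \<subseteq> {1}"
    unfolding completely_regular_space_def
    by (metis DiffI UNIV_I closed_closedin topspace_euclidean)
  then have f': "continuous_on UNIV f" "range f \<subseteq> {0..1}"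
    by (auto simp: continuous_map_in_subtopology)
  show ?thesis
  proof
    show "(\<lambda>y. 1 - f y) \<in> cont_comp_supp UNIV"
      using f' f(3) U by (intro cont_comp_suppI[of _ K] continuous_intros) auto
  qed (use f f' in \<open>auto simp: image_subset_iff\<close>)
qed

text \<open>The bump at a point exceeds 1/2 on a neighbourhood, and countably many of these
  neighbourhoods cover \<open>W\<close>. Doubling and truncating makes the bumps equal to 1 there,
  and running maxima make the sequence increase.\<close>

lemma open_approx_cont_comp_supp:
  fixes W :: "'a::{t2_space, second_countable_topology} set"
  assumes lc: "locally_compact_space (euclidean :: 'a topology)" and W: "open W"
  obtains h :: "nat \<Rightarrow> 'a \<Rightarrow> real" where "\<And>n. h n \<in> cont_comp_supp UNIV"
    "\<And>n y. 0 \<le> h n y" "\<And>n y. h n y \<le> 1" "\<And>n y. h n y \<le> h (Suc n) y"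
    "\<And>n y. y \<notin> W \<Longrightarrow> h n y = 0" "\<And>y. y \<in> W \<Longrightarrow> \<exists>n. h n y = 1"
proof -
  have "\<forall>x\<in>W. \<exists>g :: 'a \<Rightarrow> real. g \<in> cont_comp_supp UNIV \<and> (\<forall>y. 0 \<le> g y) \<and> (\<forall>y. g y \<le> 1) \<and> g x = 1
    \<and> (\<forall>y. y \<notin> W \<longrightarrow> g y = 0)"
    using urysohn_cont_comp_supp[OF lc W] by metis
  from bchoice[OF this] obtain g :: "'a \<Rightarrow> 'a \<Rightarrow> real" where
    "\<forall>x\<in>W. g x \<in> cont_comp_supp UNIV \<and> (\<forall>y. 0 \<le> g x y) \<and> (\<forall>y. g x y \<le> 1) \<and> g x x = 1
      \<and> (\<forall>y. y \<notin> W \<longrightarrow> g x y = 0)" by blast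
  then have g: "\<And>x. x \<in> W \<Longrightarrow> g x \<in> cont_comp_supp UNIV"
    "\<And>x y. x \<in> W \<Longrightarrow> 0 \<le> g x y" "\<And>x y. x \<in> W \<Longrightarrow> g x y \<le> 1" "\<And>x. x \<in> W \<Longrightarrow> g x x = 1"
    "\<And>x y. x \<in> W \<Longrightarrow> y \<notin> W \<Longrightarrow> g x y = 0"
    by blast+
  have "open S" if S: "S \<in> (\<lambda>x. {y. 1/2 < g x y}) ` W" for S
  proof -
    obtain x where x: "x \<in> W" "S = {y. 1/2 < g x y}" using S by blast
    have "continuous_on UNIV (g x)" using g(1)[OF x(1)] by (simp add: cont_comp_supp_def)
    then show ?thesis unfolding x(2) by (intro open_Collect_less continuous_intros)
  qed
  then obtain F where F: "F \<subseteq> (\<lambda>x. {y. 1/2 < g x y}) ` W" "countable F" "\<Union>F = (\<Union>x\<in>W. {y. 1/2 < g x y})"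
    by (rule Lindelof)
  then have "countable F \<and> F \<subseteq> (\<lambda>x. {y. 1/2 < g x y}) ` W" by simp
  then obtain C where C: "C \<subseteq> W" "countable C" "F = (\<lambda>x. {y. 1/2 < g x y}) ` C"
    unfolding countable_subset_image by blast
  \<comment> \<open>\<open>from_nat_into\<close> enumerates only nonempty sets; \<open>C\<close> is
    empty when \<open>W\<close> is.\<close>
  define e where "e n = (if C = {} then (\<lambda>_. 0) else g (from_nat_into C n))" for n
  have eW: "C \<noteq> {} \<Longrightarrow> from_nat_into C n \<in> W" for n
    using C from_nat_into[of C n] by auto
  have zero: "(\<lambda>_. 0) \<in> cont_comp_supp (UNIV :: 'a set)"
    by (rule cont_comp_suppI[of _ "{}"]) auto
  have e: "e n \<in> cont_comp_supp UNIV" "0 \<le> e n y" "e n y \<le> 1" "y \<notin> W \<Longrightarrow> e n y = 0" for n y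
    using g eW[of n] zero by (auto simp: e_def)
  have e1: "\<exists>n. 1/2 < e n y" if "y \<in> W" for y
  proof -
    have "y \<in> \<Union>F" using that g(4) F(3) by force
    then obtain x where x: "x \<in> C" "1/2 < g x y" using C by auto
    then obtain n where "from_nat_into C n = x" using C by (meson from_nat_into_surj)
    then show ?thesis using x by (intro exI[of _ n]) (auto simp: e_def)
  qed
  define h where "h = rec_nat (\<lambda>_. 0) (\<lambda>n f y. max (f y) (min 1 (2 * e n y)))"
  have h0: "h 0 y = 0" and hS: "h (Suc n) y = max (h n y) (min 1 (2 * e n y))" for n y
    by (simp_all add: h_def)
  show ?thesis
  proof
    show "h n \<in> cont_comp_supp UNIV" for n
    proof (induction n)
      case 0
      have "h 0 = (\<lambda>_. 0)" by (rule ext) (rule h0)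
      then show ?case using zero by simp
    next
      case (Suc n)
      obtain K1 where K1: "continuous_on UNIV (h n)" "compact K1" "\<And>x. x \<notin> K1 \<Longrightarrow> h n x = 0"
        using cont_comp_suppE[OF Suc] by blast
      obtain K2 where K2: "continuous_on UNIV (e n)" "compact K2" "\<And>x. x \<notin> K2 \<Longrightarrow> e n x = 0"
        using cont_comp_suppE[OF e(1)] by blast
      have "h (Suc n) = (\<lambda>y. max (h n y) (min 1 (2 * e n y)))" by (rule ext) (rule hS)
      moreover have "(\<lambda>y. max (h n y) (min 1 (2 * e n y))) \<in> cont_comp_supp UNIV"
      proof (rule cont_comp_suppI)
        show "continuous_on UNIV (\<lambda>y. max (h n y) (min 1 (2 * e n y)))"
          using K1(1) K2(1) by (intro continuous_intros)
        show "compact (K1 \<union> K2)" using K1 K2 by auto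
        show "max (h n x) (min 1 (2 * e n x)) = 0" if "x \<notin> K1 \<union> K2" for x
          using that K1(3)[of x] K2(3)[of x] by simp
      qed
      ultimately show ?case by simp
    qed
    show "0 \<le> h n y" for n y by (induction n) (auto simp: h0 hS)
    show "h n y \<le> 1" for n y by (induction n) (auto simp: h0 hS)
    show "h n y \<le> h (Suc n) y" for n y by (simp add: hS)
    show "h n y = 0" if "y \<notin> W" for n y using that e by (induction n) (auto simp: h0 hS)
    show "\<exists>n. h n y = 1" if y: "y \<in> W" for y
    proof -
      obtain n where "1/2 < e n y" using e1[OF y] by auto
      moreover have "h n y \<le> 1" by (induction n) (auto simp: h0 hS)
      ultimately have "h (Suc n) y = 1" by (simp add: hS)
      then show ?thesis by blast
    qed
  qed
qed

text \<open>The vague topology is defined by Bochner integrals, which are 0 in the absence of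
  integrability. A compact support of finite mass rules this out.\<close>

lemma radon_nn_integral_cont_comp_supp:
  fixes f :: "'a::t2_space \<Rightarrow> real"
  assumes \<mu>: "\<mu> \<in> radon_measures UNIV" and f: "f \<in> cont_comp_supp UNIV" "\<And>x. 0 \<le> f x" "\<And>x. f x \<le> 1"
  shows "(\<integral>\<^sup>+x. ennreal (f x) \<partial>\<mu>) = ennreal (integral\<^sup>L \<mu> f)"
proof -
  obtain K where K: "continuous_on UNIV f" "compact K" "\<And>x. x \<notin> K \<Longrightarrow> f x = 0"
    using cont_comp_suppE[OF f(1)] by blast
  have K': "K \<in> sets \<mu>" using K(2) \<mu> by (simp add: borel_sets_radon borel_compact)
  have meas: "f \<in> borel_measurable \<mu>"
    using borel_measurable_continuous_onI[OF K(1)] by (simp cong: measurable_cong_sets add: borel_sets_radon[OF \<mu>])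
  have "(\<integral>\<^sup>+x. ennreal (f x) \<partial>\<mu>) \<le> (\<integral>\<^sup>+x. indicator K x \<partial>\<mu>)"
    using K(3) f by (intro nn_integral_mono) (auto simp: indicator_def)
  also have "\<dots> = emeasure \<mu> K" using K' by simp
  also have "\<dots> < \<infinity>" using \<mu> K(2) by (simp add: radon_measures_def)
  finally show ?thesis
    using meas f by (subst integral_eq_nn_integral) auto
qed

text \<open>One sequence serves all measures, so evaluation at \<open>W\<close> becomes a countable
  supremum of vaguely continuous functions of \<mu>.\<close>

lemma emeasure_open_eq_SUP:
  fixes W :: "'a::{t2_space, second_countable_topology} set"
  assumes lc: "locally_compact_space (euclidean :: 'a topology)" and W: "open W"
  obtains h :: "nat \<Rightarrow> 'a \<Rightarrow> real" where "\<And>n. h n \<in> cont_comp_supp UNIV"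
    "\<And>\<mu>. \<mu> \<in> radon_measures UNIV \<Longrightarrow> emeasure \<mu> W = (SUP n. ennreal (integral\<^sup>L \<mu> (h n)))"
proof -
  obtain h :: "nat \<Rightarrow> 'a \<Rightarrow> real" where h: "\<And>n. h n \<in> cont_comp_supp UNIV"
    "\<And>n y. 0 \<le> h n y" "\<And>n y. h n y \<le> 1" "\<And>n y. h n y \<le> h (Suc n) y"
    "\<And>n y. y \<notin> W \<Longrightarrow> h n y = 0" "\<And>y. y \<in> W \<Longrightarrow> \<exists>n. h n y = 1"
    using open_approx_cont_comp_supp[OF lc W] by blast
  show ?thesis
  proof
    fix \<mu> :: "'a measure" assume \<mu>: "\<mu> \<in> radon_measures UNIV"
    have sup: "(SUP n. ennreal (h n y)) = indicator W y" for y
    proof (cases "y \<in> W")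
      case True
      then obtain n where "h n y = 1" using h(6) by auto
      then have "1 \<le> (SUP n. ennreal (h n y))" by (metis SUP_upper UNIV_I ennreal_1)
      moreover have "(SUP n. ennreal (h n y)) \<le> 1" using h(3) by (intro SUP_least) (simp add: ennreal_le_1)
      ultimately have "(SUP n. ennreal (h n y)) = 1" by (intro antisym)
      then show ?thesis using True by simp
    qed (simp add: h)
    have "emeasure \<mu> W = (\<integral>\<^sup>+y. indicator W y \<partial>\<mu>)"
      using W \<mu> by (simp add: borel_sets_radon)
    also have "\<dots> = (\<integral>\<^sup>+y. (SUP n. ennreal (h n y)) \<partial>\<mu>)" by (simp add: sup)
    also have "\<dots> = (SUP n. \<integral>\<^sup>+y. ennreal (h n y) \<partial>\<mu>)"
    proof (rule nn_integral_monotone_convergence_SUP)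
      show "incseq (\<lambda>n y. ennreal (h n y))"
        by (intro incseq_SucI le_funI ennreal_leI h)
      show "(\<lambda>y. ennreal (h n y)) \<in> borel_measurable \<mu>" for n
      proof -
        have "h n \<in> borel_measurable borel"
          using h(1)[of n] by (intro borel_measurable_continuous_onI) (simp add: cont_comp_supp_def)
        then have "h n \<in> borel_measurable \<mu>" by (simp cong: measurable_cong_sets add: borel_sets_radon[OF \<mu>])
        then show ?thesis by measurable
      qed
    qed
    also have "\<dots> = (SUP n. ennreal (integral\<^sup>L \<mu> (h n)))"
      by (simp add: radon_nn_integral_cont_comp_supp[OF \<mu> h(1-3)])
    finally show "emeasure \<mu> W = (SUP n. ennreal (integral\<^sup>L \<mu> (h n)))" .
  qed (rule h(1))
qed

lemma openin_vague_topology: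
  "f \<in> cont_comp_supp S \<Longrightarrow> open U \<Longrightarrow> openin (vague_topology S) {\<mu> \<in> radon_measures S. integral\<^sup>L \<mu> f \<in> U}"
  unfolding vague_topology_def by (rule topology_generated_by_Basis) auto

lemma topspace_vague_topology: "topspace (vague_topology S) = radon_measures S"
proof -
  have "(\<lambda>_. 0) \<in> cont_comp_supp S" by (simp add: cont_comp_supp_def)
  then have "radon_measures S \<subseteq> topspace (vague_topology S)"
    using openin_subset[OF openin_vague_topology[of "\<lambda>_. 0" S UNIV]] by auto
  moreover have "topspace (vague_topology S) \<subseteq> radon_measures S"
    unfolding vague_topology_def topology_generated_by_topspace by auto
  ultimately show ?thesis by auto
qed

lemma integer_measure_space_generator:
  "{U. openin (subtopology (vague_topology S) (integer_measures S)) U} \<subseteq> Pow (integer_measures S)"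
  using openin_subset by fastforce

lemma space_integer_measure_space [simp]: "space (integer_measure_space S) = integer_measures S"
  unfolding integer_measure_space_def using integer_measure_space_generator by (rule space_measure_of)

lemma sets_integer_measure_spaceI:
  "openin (subtopology (vague_topology S) (integer_measures S)) U \<Longrightarrow> U \<in> sets (integer_measure_space S)"
  unfolding integer_measure_space_def by (rule in_measure_of[OF integer_measure_space_generator]) simp

lemma measurable_integral_integer_measure_space:
  assumes "f \<in> cont_comp_supp S"
  shows "(\<lambda>\<mu>. integral\<^sup>L \<mu> f) \<in> borel_measurable (integer_measure_space S)"
proof (rule borel_measurableI)
  fix U :: "real set" assume "open U"
  have "(\<lambda>\<mu>. integral\<^sup>L \<mu> f) -` U \<inter> space (integer_measure_space S)
     = {\<mu> \<in> radon_measures S. integral\<^sup>L \<mu> f \<in> U} \<inter> integer_measures S"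
    by (auto dest: integer_measures_radon)
  also have "\<dots> \<in> sets (integer_measure_space S)"
    using openin_vague_topology[OF assms \<open>open U\<close>]
    by (intro sets_integer_measure_spaceI) (auto simp: openin_subtopology)
  finally show "(\<lambda>\<mu>. integral\<^sup>L \<mu> f) -` U \<inter> space (integer_measure_space S) \<in> sets (integer_measure_space S)" .
qed

text \<open>With infinite masses complements cannot be handled by subtraction. Hence the Dynkin
  argument is run inside open sets of finite mass, which then exhaust the space.\<close>

lemma measurable_emeasure_integer_measure_space:
  fixes B :: "'a::{t2_space, second_countable_topology} set"
  assumes lc: "locally_compact_space (euclidean :: 'a topology)" and B: "B \<in> sets borel"
  shows "(\<lambda>\<mu>. emeasure \<mu> B) \<in> borel_measurable (integer_measure_space UNIV)"
proof -
  let ?M = "integer_measure_space (UNIV :: 'a set)"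
  have opn: "(\<lambda>\<mu>. emeasure \<mu> W) \<in> borel_measurable ?M" if W: "open W" for W :: "'a set"
  proof -
    obtain h :: "nat \<Rightarrow> 'a \<Rightarrow> real" where h: "\<And>n. h n \<in> cont_comp_supp UNIV"
      "\<And>\<mu>. \<mu> \<in> radon_measures UNIV \<Longrightarrow> emeasure \<mu> W = (SUP n. ennreal (integral\<^sup>L \<mu> (h n)))"
      using emeasure_open_eq_SUP[OF lc W] by blast
    have "(\<lambda>\<mu>. SUP n. ennreal (integral\<^sup>L \<mu> (h n))) \<in> borel_measurable ?M"
      using measurable_integral_integer_measure_space[OF h(1)] by measurable
    then show ?thesis
      by (rule subst[OF measurable_cong, rotated]) (simp add: h(2) integer_measures_radon)
  qed
  have fin: "(\<lambda>\<mu>. emeasure \<mu> (B \<inter> U)) \<in> borel_measurable ?M"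
    if U: "open U" "\<And>\<mu>. \<mu> \<in> radon_measures UNIV \<Longrightarrow> emeasure \<mu> U < \<infinity>" for U
  proof -
    have Int: "Int_stable {S :: 'a set. open S}" by (auto simp: Int_stable_def)
    have sub: "{S :: 'a set. open S} \<subseteq> Pow UNIV" by simp
    have "B \<in> sigma_sets UNIV {S. open S}" using B by (simp add: borel_def)
    with Int sub show ?thesis
    proof (induction rule: sigma_sets_induct_disjoint)
      fix A :: "'a set" assume "A \<in> {S. open S}"
      then show "(\<lambda>\<mu>. emeasure \<mu> (A \<inter> U)) \<in> borel_measurable ?M" using U by (intro opn) auto
    next
      fix A :: "'a set" assume A: "A \<in> sigma_sets UNIV {S. open S}"
        and IH: "(\<lambda>\<mu>. emeasure \<mu> (A \<inter> U)) \<in> borel_measurable ?M"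
      have A': "A \<in> sets borel" using A by (simp add: borel_def)
      have "(\<lambda>\<mu>. emeasure \<mu> U - emeasure \<mu> (A \<inter> U)) \<in> borel_measurable ?M"
        using opn[OF U(1)] IH by measurable
      moreover have "emeasure \<mu> U - emeasure \<mu> (A \<inter> U) = emeasure \<mu> ((UNIV - A) \<inter> U)"
        if "\<mu> \<in> integer_measures UNIV" for \<mu>
      proof -
        have sets: "A \<inter> U \<in> sets \<mu>" "U \<in> sets \<mu>"
          using U(1) A' integer_measures_sets[OF that] by auto
        have "emeasure \<mu> (A \<inter> U) \<le> emeasure \<mu> U" using sets by (intro emeasure_mono) auto
        also have "\<dots> < \<infinity>" by (rule U(2)[OF integer_measures_radon[OF that]])
        finally have "emeasure \<mu> (U - (A \<inter> U)) = emeasure \<mu> U - emeasure \<mu> (A \<inter> U)"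
          using sets by (intro emeasure_Diff) auto
        moreover have "U - (A \<inter> U) = (UNIV - A) \<inter> U" by auto
        ultimately show ?thesis by simp
      qed
      ultimately show "(\<lambda>\<mu>. emeasure \<mu> ((UNIV - A) \<inter> U)) \<in> borel_measurable ?M"
        by (subst measurable_cong[where g = "\<lambda>\<mu>. emeasure \<mu> U - emeasure \<mu> (A \<inter> U)"]) auto
    next
      fix A :: "nat \<Rightarrow> 'a set" assume A: "disjoint_family A" "range A \<subseteq> sigma_sets UNIV {S. open S}"
        and IH: "\<And>i. (\<lambda>\<mu>. emeasure \<mu> (A i \<inter> U)) \<in> borel_measurable ?M"
      have A': "A i \<in> sets borel" for i using A by (auto simp: borel_def)
      have "(\<lambda>\<mu>. suminf (\<lambda>i. emeasure \<mu> (A i \<inter> U))) \<in> borel_measurable ?M"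
        using IH by measurable
      moreover have "suminf (\<lambda>i. emeasure \<mu> (A i \<inter> U)) = emeasure \<mu> (\<Union> (range A) \<inter> U)"
        if "\<mu> \<in> integer_measures UNIV" for \<mu>
        using A A' U integer_measures_sets[OF that]
        by (subst suminf_emeasure) (auto simp: disjoint_family_on_def)
      ultimately show "(\<lambda>\<mu>. emeasure \<mu> (\<Union> (range A) \<inter> U)) \<in> borel_measurable ?M"
        by (subst measurable_cong[where g = "\<lambda>\<mu>. suminf (\<lambda>i. emeasure \<mu> (A i \<inter> U))"]) auto
    qed simp
  qed
  obtain h :: "nat \<Rightarrow> 'a \<Rightarrow> real" where h: "\<And>n. h n \<in> cont_comp_supp UNIV"
    "\<And>n y. 0 \<le> h n y" "\<And>n y. h n y \<le> 1" "\<And>n y. h n y \<le> h (Suc n) y"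
    "\<And>n y. y \<notin> UNIV \<Longrightarrow> h n y = 0" "\<And>y. y \<in> UNIV \<Longrightarrow> \<exists>n. h n y = 1"
    using open_approx_cont_comp_supp[OF lc open_UNIV] by blast
  \<comment> \<open>Where a test function is positive: open, inside a compact set, and hence of
    finite mass for every Radon measure.\<close>
  define U where "U n = {y. 0 < h n y}" for n
  have openU: "open (U n)" for n
    unfolding U_def using h(1)[of n] by (intro open_Collect_less continuous_intros) (simp add: cont_comp_supp_def)
  have finU: "emeasure \<mu> (U n) < \<infinity>" if \<mu>: "\<mu> \<in> radon_measures UNIV" for \<mu> n
  proof -
    obtain K where "continuous_on UNIV (h n)" and K: "compact K" "\<And>x. x \<notin> K \<Longrightarrow> h n x = 0"
      using cont_comp_suppE[OF h(1)[of n]] by blast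
    have "U n \<subseteq> K"
      unfolding U_def using K(2) by (metis (mono_tags, lifting) less_irrefl mem_Collect_eq subsetI)
    then have "emeasure \<mu> (U n) \<le> emeasure \<mu> K"
      using K(1) \<mu> by (intro emeasure_mono) (auto simp: borel_sets_radon borel_compact)
    also have "\<dots> < \<infinity>" using \<mu> K(1) by (simp add: radon_measures_def)
    finally show ?thesis .
  qed
  have "(\<lambda>\<mu>. SUP n. emeasure \<mu> (B \<inter> U n)) \<in> borel_measurable ?M"
    using fin[OF openU finU] by measurable
  moreover have "(SUP n. emeasure \<mu> (B \<inter> U n)) = emeasure \<mu> B" if "\<mu> \<in> integer_measures UNIV" for \<mu>
  proof -
    have "incseq (\<lambda>n. B \<inter> U n)"
      using h(4) by (intro incseq_SucI) (auto simp: U_def intro: less_le_trans)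
    then have "(SUP n. emeasure \<mu> (B \<inter> U n)) = emeasure \<mu> (\<Union>n. B \<inter> U n)"
      using B openU integer_measures_sets[OF that] by (intro SUP_emeasure_incseq) auto
    also have "(\<Union>n. B \<inter> U n) = B"
      using h(6) by (auto simp: U_def) (metis zero_less_one)
    finally show ?thesis .
  qed
  ultimately show ?thesis
    by (subst measurable_cong[where g = "\<lambda>\<mu>. SUP n. emeasure \<mu> (B \<inter> U n)"]) auto
qed

section \<open>Atoms of integer-valued measures\<close>

definition atoms_in :: "'a set \<Rightarrow> 'a measure \<Rightarrow> 'a set" where
  "atoms_in S \<mu> = {z \<in> S. emeasure \<mu> {z} \<noteq> 0}"

text \<open>For bounded regions this event is almost sure, and it is the set on which functionals of
  the atoms are shown to be measurable.\<close>

definition simple_on :: "'a::topological_space set \<Rightarrow> 'a measure set" where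
  "simple_on S = {\<mu> \<in> integer_measures UNIV. emeasure \<mu> S < \<infinity> \<and> (\<forall>z\<in>S. emeasure \<mu> {z} \<le> 1)}"

lemma integer_measures_ge_1:
  assumes "\<mu> \<in> integer_measures UNIV" "B \<in> sets borel" "emeasure \<mu> B \<noteq> 0"
  shows "1 \<le> emeasure \<mu> B"
proof (cases "emeasure \<mu> B < \<infinity>")
  case True
  then obtain k :: nat where k: "emeasure \<mu> B = of_nat k"
    using integer_measures_UNIV_cases[OF assms(1,2)] by blast
  with assms(3) have "1 \<le> k" by (cases k) auto
  then have "of_nat 1 \<le> (of_nat k :: ennreal)" unfolding of_nat_le_iff .
  then show ?thesis using k by simp
next
  case False
  then have "emeasure \<mu> B = \<infinity>" by (metis infinity_ennreal_def less_top)
  then show ?thesis by simp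
qed

lemma finite_atoms_in:
  fixes S :: "'a::{t2_space, second_countable_topology} set"
  assumes \<mu>: "\<mu> \<in> integer_measures UNIV" and S: "S \<in> sets borel" "emeasure \<mu> S < \<infinity>"
  shows "finite (atoms_in S \<mu>)"
proof (rule ccontr)
  assume inf: "infinite (atoms_in S \<mu>)"
  obtain k :: nat where k: "emeasure \<mu> S = of_nat k"
    using integer_measures_UNIV_cases[OF \<mu> S] by blast
  obtain F where F: "F \<subseteq> atoms_in S \<mu>" "finite F" "card F = Suc k"
    using infinite_arbitrarily_large[OF inf] by blast
  have sets: "sets \<mu> = sets borel" by (rule integer_measures_sets[OF \<mu>])
  have "of_nat (Suc k) = (\<Sum>z\<in>F. (1 :: ennreal))" using F by simp
  also have "\<dots> \<le> (\<Sum>z\<in>F. emeasure \<mu> {z})"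
    using F by (intro sum_mono integer_measures_ge_1[OF \<mu>]) (auto simp: atoms_in_def)
  also have "\<dots> = emeasure \<mu> F"
    using F sets by (intro emeasure_eq_sum_singleton[symmetric]) auto
  also have "\<dots> \<le> emeasure \<mu> S"
    using F S sets by (intro emeasure_mono) (auto simp: atoms_in_def)
  finally have "of_nat (Suc k) \<le> (of_nat k :: ennreal)" unfolding k .
  then show False unfolding of_nat_le_iff by simp
qed

text \<open>
  The neighbourhoods of a non-atom have measure tending to \<open>0\<close>, hence by integrality some of them
  have measure \<open>0\<close>; countably many of these suffice.
\<close>

lemma emeasure_nonatomic_part:
  fixes S :: "'a::{t2_space, second_countable_topology} set"
  assumes \<mu>: "\<mu> \<in> integer_measures UNIV" and S: "S \<in> sets borel" "emeasure \<mu> S < \<infinity>"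
  shows "emeasure \<mu> (S - atoms_in S \<mu>) = 0"
proof -
  let ?N = "S - atoms_in S \<mu>"
  have sets [simp]: "sets \<mu> = sets borel" by (rule integer_measures_sets[OF \<mu>])
  have "atoms_in S \<mu> \<in> sets borel"
    using finite_atoms_in[OF assms] by (intro borel_closed finite_imp_closed)
  then have N: "?N \<in> sets borel" using S by auto
  have fin: "emeasure \<mu> (A \<inter> ?N) < \<infinity>" for A
    using S by (intro le_less_trans[OF emeasure_mono S(2)]) auto
  have "\<exists>U. open U \<and> z \<in> U \<and> emeasure \<mu> (U \<inter> ?N) = 0" if z: "z \<in> ?N" for z
  proof -
    obtain A where A: "\<And>i. open (A i)" "\<And>i. z \<in> A i"
      "\<And>V. open V \<Longrightarrow> z \<in> V \<Longrightarrow> eventually (\<lambda>i::nat. A i \<subseteq> V) sequentially"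
      using countable_basis_at_decseq[of z] by blast
    define B where "B n = (\<Inter>i\<le>n. A i)" for n
    have B: "open (B n)" "z \<in> B n" for n using A by (auto simp: B_def)
    have dec: "decseq (\<lambda>n. B n \<inter> ?N)" by (auto simp: decseq_def B_def)
    have int: "(\<Inter>n. B n \<inter> ?N) = {z}"
    proof
      show "{z} \<subseteq> (\<Inter>n. B n \<inter> ?N)" using B z by auto
      show "(\<Inter>n. B n \<inter> ?N) \<subseteq> {z}"
      proof
        fix w assume w: "w \<in> (\<Inter>n. B n \<inter> ?N)"
        show "w \<in> {z}"
        proof (rule ccontr)
          assume "w \<notin> {z}"
          then have "open (- {w})" "z \<in> - {w}" by auto
          then have "eventually (\<lambda>i. A i \<subseteq> - {w}) sequentially" by (rule A(3))
          then obtain i where "A i \<subseteq> - {w}" by (auto simp: eventually_sequentially)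
          moreover have "w \<in> A i" using w by (auto simp: B_def)
          ultimately show False by auto
        qed
      qed
    qed
    have "(INF n. emeasure \<mu> (B n \<inter> ?N)) = emeasure \<mu> (\<Inter>n. B n \<inter> ?N)"
      using B N fin by (intro INF_emeasure_decseq dec) (auto simp: less_top[symmetric])
    also have "\<dots> = 0" unfolding int using z by (auto simp: atoms_in_def)
    finally have "(INF n. emeasure \<mu> (B n \<inter> ?N)) < 1" by simp
    then obtain n where n: "emeasure \<mu> (B n \<inter> ?N) < 1" by (auto simp: INF_less_iff)
    have "emeasure \<mu> (B n \<inter> ?N) = 0"
    proof (rule ccontr)
      assume "emeasure \<mu> (B n \<inter> ?N) \<noteq> 0"
      then have "1 \<le> emeasure \<mu> (B n \<inter> ?N)" using B N by (intro integer_measures_ge_1[OF \<mu>]) auto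
      then show False using n by simp
    qed
    then show ?thesis using B by blast
  qed
  then have "\<forall>z\<in>?N. \<exists>U. open U \<and> z \<in> U \<and> emeasure \<mu> (U \<inter> ?N) = 0" by blast
  from bchoice[OF this] obtain U where U: "\<forall>z\<in>?N. open (U z) \<and> z \<in> U z \<and> emeasure \<mu> (U z \<inter> ?N) = 0"
    by blast
  obtain F where F: "F \<subseteq> U ` ?N" "countable F" "\<Union>F = \<Union>(U ` ?N)"
    by (rule Lindelof[of "U ` ?N"]) (use U in auto)
  have "(\<Union>V\<in>F. V \<inter> ?N) \<in> null_sets \<mu>"
  proof (rule null_sets_UN'[OF F(2)])
    fix V assume "V \<in> F"
    then obtain z where "z \<in> ?N" "V = U z" using F(1) by blast
    then show "V \<inter> ?N \<in> null_sets \<mu>" using U N by (auto intro!: null_setsI)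
  qed
  moreover have "(\<Union>V\<in>F. V \<inter> ?N) = ?N" using F(3) U by blast
  ultimately show ?thesis by (simp add: null_sets_def)
qed

lemma emeasure_eq_sum_atoms:
  fixes S :: "'a::{t2_space, second_countable_topology} set"
  assumes \<mu>: "\<mu> \<in> integer_measures UNIV" and S: "S \<in> sets borel" "emeasure \<mu> S < \<infinity>" and B: "B \<in> sets borel"
  shows "emeasure \<mu> (B \<inter> S) = (\<Sum>z\<in>atoms_in S \<mu> \<inter> B. emeasure \<mu> {z})"
proof -
  have sets [simp]: "sets \<mu> = sets borel" by (rule integer_measures_sets[OF \<mu>])
  note fin = finite_atoms_in[OF \<mu> S]
  have at: "atoms_in S \<mu> \<in> sets borel" using fin by (intro borel_closed finite_imp_closed)
  have "emeasure \<mu> (B \<inter> S) = emeasure \<mu> ((atoms_in S \<mu> \<inter> B) \<union> (B \<inter> (S - atoms_in S \<mu>)))"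
    by (rule arg_cong[where f = "emeasure \<mu>"]) (auto simp: atoms_in_def)
  also have "\<dots> = emeasure \<mu> (atoms_in S \<mu> \<inter> B)"
  proof (rule emeasure_Un_null_set)
    have "S - atoms_in S \<mu> \<in> null_sets \<mu>"
      using emeasure_nonatomic_part[OF \<mu> S] S at by (intro null_setsI) auto
    then show "B \<inter> (S - atoms_in S \<mu>) \<in> null_sets \<mu>" using B by (intro null_set_Int1) auto
  qed (use at B in auto)
  also have "\<dots> = (\<Sum>z\<in>atoms_in S \<mu> \<inter> B. emeasure \<mu> {z})"
    using fin by (intro emeasure_eq_sum_singleton) auto
  finally show ?thesis .
qed

lemma simple_onD:
  fixes S :: "'a::{t2_space, second_countable_topology} set"
  assumes \<mu>: "\<mu> \<in> simple_on S" and S: "S \<in> sets borel"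
  shows "\<mu> \<in> integer_measures UNIV" "finite (atoms_in S \<mu>)"
    "B \<in> sets borel \<Longrightarrow> emeasure \<mu> (B \<inter> S) = of_nat (card (atoms_in S \<mu> \<inter> B))"
    "emeasure \<mu> S = of_nat (card (atoms_in S \<mu>))"
proof -
  have \<mu>': "\<mu> \<in> integer_measures UNIV" "emeasure \<mu> S < \<infinity>" "\<And>z. z \<in> S \<Longrightarrow> emeasure \<mu> {z} \<le> 1"
    using \<mu> by (auto simp: simple_on_def)
  then show "\<mu> \<in> integer_measures UNIV" by simp
  show "finite (atoms_in S \<mu>)" by (rule finite_atoms_in[OF \<mu>'(1) S \<mu>'(2)])
  have count: "emeasure \<mu> (B \<inter> S) = of_nat (card (atoms_in S \<mu> \<inter> B))" if "B \<in> sets borel" for B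
  proof -
    have "emeasure \<mu> {z} = 1" if "z \<in> atoms_in S \<mu>" for z
      using that \<mu>'(3)[of z] integer_measures_ge_1[OF \<mu>'(1), of "{z}"]
      by (intro antisym) (auto simp: atoms_in_def)
    then have "(\<Sum>z\<in>atoms_in S \<mu> \<inter> B. emeasure \<mu> {z}) = (\<Sum>z\<in>atoms_in S \<mu> \<inter> B. 1)"
      by (intro sum.cong) auto
    then show ?thesis
      using emeasure_eq_sum_atoms[OF \<mu>'(1) S \<mu>'(2) that] by simp
  qed
  then show "B \<in> sets borel \<Longrightarrow> emeasure \<mu> (B \<inter> S) = of_nat (card (atoms_in S \<mu> \<inter> B))" .
  from count[of UNIV] show "emeasure \<mu> S = of_nat (card (atoms_in S \<mu>))" by simp
qed

lemma finite_separation: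
  fixes X :: "'a::t2_space set"
  assumes X: "finite X" and basis: "topological_basis \<B>"
  obtains u where "\<And>x. x \<in> X \<Longrightarrow> u x \<in> \<B> \<and> x \<in> u x" "disjoint_family_on u X"
proof -
  have "\<forall>p\<in>{(x, y). x \<noteq> (y :: 'a)}. \<exists>UV. open (fst UV) \<and> open (snd UV) \<and> fst p \<in> fst UV \<and> snd p \<in> snd UV \<and> fst UV \<inter> snd UV = {}"
  proof
    fix p :: "'a \<times> 'a" assume "p \<in> {(x, y). x \<noteq> y}"
    then have "fst p \<noteq> snd p" by auto
    from hausdorff[OF this] obtain U V where "open U" "open V" "fst p \<in> U" "snd p \<in> V" "U \<inter> V = {}" by blast
    then show "\<exists>UV. open (fst UV) \<and> open (snd UV) \<and> fst p \<in> fst UV \<and> snd p \<in> snd UV \<and> fst UV \<inter> snd UV = {}"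
      by (intro exI[of _ "(U, V)"]) simp
  qed
  from bchoice[OF this] obtain c :: "'a \<times> 'a \<Rightarrow> 'a set \<times> 'a set" where c: "\<forall>p\<in>{(x, y). x \<noteq> y}. open (fst (c p)) \<and> open (snd (c p)) \<and>
    fst p \<in> fst (c p) \<and> snd p \<in> snd (c p) \<and> fst (c p) \<inter> snd (c p) = {}" by blast
  have c': "open (fst (c (x, y)))" "open (snd (c (x, y)))" "x \<in> fst (c (x, y))" "y \<in> snd (c (x, y))"
    "fst (c (x, y)) \<inter> snd (c (x, y)) = {}" if "x \<noteq> y" for x y
    using c[rule_format, of "(x, y)"] that by auto
  define T where "T x = (\<Inter>y\<in>X - {x}. fst (c (x, y)) \<inter> snd (c (y, x)))" for x
  have T: "open (T x)" "x \<in> T x" for x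
  proof -
    show "open (T x)"
      unfolding T_def using X c'(1,2) by (intro open_INT open_Int ballI) auto
    show "x \<in> T x"
      unfolding T_def
    proof
      fix y assume "y \<in> X - {x}"
      then show "x \<in> fst (c (x, y)) \<inter> snd (c (y, x))"
        using c'(3)[of x y] c'(4)[of y x] by auto
    qed
  qed
  have disj: "T x \<inter> T y = {}" if "x \<in> X" "y \<in> X" "x \<noteq> y" for x y
  proof -
    have "T x \<subseteq> fst (c (x, y))" "T y \<subseteq> snd (c (x, y))" using that by (auto simp: T_def)
    then show ?thesis using c'(5)[OF that(3)] by blast
  qed
  have "\<forall>x. \<exists>V. V \<in> \<B> \<and> x \<in> V \<and> V \<subseteq> T x"
    using topological_basisE[OF basis T] by metis
  from choice[OF this] obtain u where u: "\<forall>x. u x \<in> \<B> \<and> x \<in> u x \<and> u x \<subseteq> T x" by blast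
  show ?thesis
  proof
    show "disjoint_family_on u X"
      unfolding disjoint_family_on_def
    proof (intro ballI impI)
      fix x y assume "x \<in> X" "y \<in> X" "x \<noteq> y"
      from disj[OF this] u show "u x \<inter> u y = {}" by blast
    qed
  qed (use u in blast)
qed

text \<open>
  Simplicity on \<open>S\<close> is certified by finitely many disjoint basic open sets that carry mass one each
  and exhaust the mass of \<open>S\<close>. There are only countably many certificates, and where a fixed one
  applies, the atom in each of its open sets is a measurable function of the measure.
\<close>

definition pattern_set :: "'a::topological_space set \<Rightarrow> 'a set list \<Rightarrow> 'a measure set" where
  "pattern_set S us = {\<mu> \<in> integer_measures UNIV. emeasure \<mu> S = of_nat (length us) \<and>
     (\<forall>i<length us. emeasure \<mu> (us ! i \<inter> S) = 1)}"

definition patterns :: "'a::topological_space set set \<Rightarrow> 'a set list set" where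
  "patterns \<B> = {us \<in> lists \<B>. disjoint_family_on ((!) us) {..<length us}}"

lemma simple_on_eq_Union_patterns:
  fixes S :: "'a::{t2_space, second_countable_topology} set"
  assumes S: "S \<in> sets borel" and basis: "topological_basis \<B>"
  shows "simple_on S = (\<Union>us\<in>patterns \<B>. pattern_set S us)"
proof
  show "simple_on S \<subseteq> (\<Union>us\<in>patterns \<B>. pattern_set S us)"
  proof
    fix \<mu> assume \<mu>: "\<mu> \<in> simple_on S"
    note D = simple_onD[OF \<mu> S]
    obtain u where u: "\<And>x. x \<in> atoms_in S \<mu> \<Longrightarrow> u x \<in> \<B> \<and> x \<in> u x" "disjoint_family_on u (atoms_in S \<mu>)"
      using finite_separation[OF D(2) basis] by blast
    obtain xs where xs: "set xs = atoms_in S \<mu>" "distinct xs"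
      using finite_distinct_list[OF D(2)] by blast
    let ?us = "map u xs"
    have nth: "xs ! i \<in> atoms_in S \<mu>" if "i < length xs" for i using xs that nth_mem by blast
    have "?us \<in> patterns \<B>"
      unfolding patterns_def
    proof (intro CollectI conjI)
      show "?us \<in> lists \<B>" using u xs by auto
      show "disjoint_family_on ((!) ?us) {..<length ?us}"
        unfolding disjoint_family_on_def
      proof (intro ballI impI)
        fix i j assume ij: "i \<in> {..<length ?us}" "j \<in> {..<length ?us}" "i \<noteq> j"
        then have "xs ! i \<noteq> xs ! j" using xs(2) by (simp add: nth_eq_iff_index_eq)
        then show "?us ! i \<inter> ?us ! j = {}"
          using u(2) nth ij by (auto simp: disjoint_family_on_def)
      qed
    qed
    moreover have "\<mu> \<in> pattern_set S ?us"
      unfolding pattern_set_def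
    proof (intro CollectI conjI allI impI)
      show "emeasure \<mu> S = of_nat (length ?us)"
        using D(4) distinct_card[OF xs(2)] xs(1) by simp
      fix i assume i: "i < length ?us"
      then have x: "xs ! i \<in> atoms_in S \<mu>" using nth by simp
      have "open (u (xs ! i))" using u(1)[OF x] basis topological_basis_open by blast
      moreover have "atoms_in S \<mu> \<inter> u (xs ! i) = {xs ! i}"
      proof
        show "atoms_in S \<mu> \<inter> u (xs ! i) \<subseteq> {xs ! i}"
        proof
          fix w assume w: "w \<in> atoms_in S \<mu> \<inter> u (xs ! i)"
          show "w \<in> {xs ! i}"
          proof (rule ccontr)
            assume "w \<notin> {xs ! i}"
            then have "u w \<inter> u (xs ! i) = {}" using u(2) w x by (auto simp: disjoint_family_on_def)
            then show False using w u(1)[of w] by auto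
          qed
        qed
      qed (use u(1)[OF x] x in auto)
      ultimately show "emeasure \<mu> (?us ! i \<inter> S) = 1"
        using D(3)[of "u (xs ! i)"] i by simp
    qed (rule D(1))
    ultimately show "\<mu> \<in> (\<Union>us\<in>patterns \<B>. pattern_set S us)" by blast
  qed
  show "(\<Union>us\<in>patterns \<B>. pattern_set S us) \<subseteq> simple_on S"
  proof
    fix \<mu> assume "\<mu> \<in> (\<Union>us\<in>patterns \<B>. pattern_set S us)"
    then obtain us where us: "us \<in> patterns \<B>" and \<mu>: "\<mu> \<in> pattern_set S us" by blast
    have \<mu>': "\<mu> \<in> integer_measures UNIV" "emeasure \<mu> S = of_nat (length us)"
      "\<And>i. i < length us \<Longrightarrow> emeasure \<mu> (us ! i \<inter> S) = 1"
      using \<mu> by (auto simp: pattern_set_def)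
    have sets [simp]: "sets \<mu> = sets borel" by (rule integer_measures_sets[OF \<mu>'(1)])
    have opn: "us ! i \<in> sets borel" if "i < length us" for i
    proof -
      have "us ! i \<in> \<B>" using us that unfolding patterns_def by (auto intro: nth_mem)
      then have "open (us ! i)" by (rule topological_basis_open[OF basis])
      then show ?thesis by (rule borel_open)
    qed
    let ?V = "\<Union>i<length us. us ! i \<inter> S"
    have V: "?V \<in> sets borel" using opn S by auto
    \<comment> \<open>The disjoint sets of the certificate exhaust the mass of \<open>S\<close>, so
      the rest of \<open>S\<close> is null and every atom lies in a set of mass one.\<close>
    have "emeasure \<mu> ?V = (\<Sum>i<length us. emeasure \<mu> (us ! i \<inter> S))"
      using us opn S by (intro sum_emeasure[symmetric]) (auto simp: patterns_def disjoint_family_on_def)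
    also have "\<dots> = emeasure \<mu> S" using \<mu>' by simp
    finally have "emeasure \<mu> (S - ?V) = 0"
      using V S \<mu>'(2) by (subst emeasure_Diff) auto
    have "emeasure \<mu> {z} \<le> 1" if z: "z \<in> S" for z
    proof (cases "z \<in> ?V")
      case True
      then obtain i where "i < length us" "z \<in> us ! i \<inter> S" by auto
      then show ?thesis
        using emeasure_mono[of "{z}" "us ! i \<inter> S" \<mu>] opn[of i] S \<mu>'(3)[of i] by auto
    next
      case False
      then have "emeasure \<mu> {z} \<le> emeasure \<mu> (S - ?V)" using z V S by (intro emeasure_mono) auto
      then show ?thesis using \<open>emeasure \<mu> (S - ?V) = 0\<close> by simp
    qed
    then show "\<mu> \<in> simple_on S" using \<mu>' by (auto simp: simple_on_def of_nat_less_top)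
  qed
qed

section \<open>Measurability of functionals of the atoms\<close>

context
  fixes S :: "'a::{t2_space, second_countable_topology} set" and \<B> :: "'a set set"
  assumes lc: "locally_compact_space (euclidean :: 'a topology)"
    and S: "S \<in> sets borel" and basis: "topological_basis \<B>"
begin

definition select_atom :: "'a set list \<Rightarrow> nat \<Rightarrow> 'a measure \<Rightarrow> 'a" where
  "select_atom us i \<mu> = (THE z. z \<in> atoms_in S \<mu> \<inter> us ! i)"

lemma pattern_nth_borel:
  assumes "us \<in> patterns \<B>" "i < length us"
  shows "us ! i \<in> sets borel"
proof -
  have "us ! i \<in> \<B>" using assms unfolding patterns_def by (auto intro: nth_mem)
  then have "open (us ! i)" by (rule topological_basis_open[OF basis])
  then show ?thesis by (rule borel_open)
qed

lemma pattern_set_measurable: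
  assumes us: "us \<in> patterns \<B>"
  shows "pattern_set S us \<in> sets (integer_measure_space UNIV)"
proof -
  let ?M = "integer_measure_space (UNIV :: 'a set)"
  have level: "{\<mu> \<in> space ?M. emeasure \<mu> B = c} \<in> sets ?M" if "B \<in> sets borel" for B c
    using measurable_emeasure_integer_measure_space[OF lc that] by measurable
  have "{\<mu> \<in> space ?M. \<forall>i\<in>{..<length us}. emeasure \<mu> (us ! i \<inter> S) = 1} \<in> sets ?M"
    using level S pattern_nth_borel[OF us] by (intro sets.sets_Collect_finite_All) auto
  with level[OF S, of "of_nat (length us)"]
  have "{\<mu> \<in> space ?M. emeasure \<mu> S = of_nat (length us)} \<inter>
     {\<mu> \<in> space ?M. \<forall>i\<in>{..<length us}. emeasure \<mu> (us ! i \<inter> S) = 1} \<in> sets ?M"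
    by (rule sets.Int)
  also have "{\<mu> \<in> space ?M. emeasure \<mu> S = of_nat (length us)} \<inter>
     {\<mu> \<in> space ?M. \<forall>i\<in>{..<length us}. emeasure \<mu> (us ! i \<inter> S) = 1} = pattern_set S us"
    by (auto simp: pattern_set_def)
  finally show ?thesis .
qed

lemma pattern_set_subset_simple: "us \<in> patterns \<B> \<Longrightarrow> pattern_set S us \<subseteq> simple_on S"
  using simple_on_eq_Union_patterns[OF S basis] by blast

lemma
  assumes us: "us \<in> patterns \<B>" and \<mu>: "\<mu> \<in> pattern_set S us"
  shows atoms_Int_pattern: "i < length us \<Longrightarrow> atoms_in S \<mu> \<inter> us ! i = {select_atom us i \<mu>}"
    and inj_select_atom: "inj_on (\<lambda>i. select_atom us i \<mu>) {..<length us}"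
    and image_select_atom: "(\<lambda>i. select_atom us i \<mu>) ` {..<length us} = atoms_in S \<mu>"
proof -
  have simple: "\<mu> \<in> simple_on S" using pattern_set_subset_simple[OF us] \<mu> by blast
  note D = simple_onD[OF simple S]
  have single: "atoms_in S \<mu> \<inter> us ! i = {select_atom us i \<mu>}" if i: "i < length us" for i
  proof -
    have "of_nat (card (atoms_in S \<mu> \<inter> us ! i)) = (of_nat 1 :: ennreal)"
      using D(3)[OF pattern_nth_borel[OF us i]] \<mu> i by (simp add: pattern_set_def)
    then have "card (atoms_in S \<mu> \<inter> us ! i) = 1" unfolding of_nat_eq_iff .
    then obtain z where z: "atoms_in S \<mu> \<inter> us ! i = {z}" by (rule card_1_singletonE)
    then show ?thesis by (simp add: select_atom_def)
  qed
  then show "i < length us \<Longrightarrow> atoms_in S \<mu> \<inter> us ! i = {select_atom us i \<mu>}" .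
  show inj: "inj_on (\<lambda>i. select_atom us i \<mu>) {..<length us}"
  proof (rule inj_onI, rule ccontr)
    fix i j assume ij: "i \<in> {..<length us}" "j \<in> {..<length us}" "i \<noteq> j"
      and eq: "select_atom us i \<mu> = select_atom us j \<mu>"
    have "us ! i \<inter> us ! j = {}" using us ij by (auto simp: patterns_def disjoint_family_on_def)
    moreover have "select_atom us i \<mu> \<in> us ! i" "select_atom us j \<mu> \<in> us ! j"
      using single[of i] single[of j] ij by auto
    ultimately show False using eq by auto
  qed
  show "(\<lambda>i. select_atom us i \<mu>) ` {..<length us} = atoms_in S \<mu>"
  proof (rule card_subset_eq)
    show "(\<lambda>i. select_atom us i \<mu>) ` {..<length us} \<subseteq> atoms_in S \<mu>" using single by auto
    have "of_nat (card (atoms_in S \<mu>)) = (of_nat (length us) :: ennreal)"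
      using D(4) \<mu> by (simp add: pattern_set_def)
    then have "card (atoms_in S \<mu>) = length us" unfolding of_nat_eq_iff .
    then show "card ((\<lambda>i. select_atom us i \<mu>) ` {..<length us}) = card (atoms_in S \<mu>)"
      by (simp add: card_image[OF inj])
  qed (rule D(2))
qed

text \<open>The selected atom lies in \<open>B\<close> iff
  \<open>B \<inter> us ! i \<inter> S\<close> has mass one, and masses of Borel sets are measurable
  in \<mu>.\<close>

lemma measurable_select_atom:
  assumes us: "us \<in> patterns \<B>" and i: "i < length us"
  shows "select_atom us i \<in> measurable (restrict_space (integer_measure_space UNIV) (pattern_set S us)) borel"
proof (rule measurableI)
  let ?M = "integer_measure_space (UNIV :: 'a set)"
  fix B :: "'a set" assume B: "B \<in> sets borel"
  have sp: "space (restrict_space ?M (pattern_set S us)) = pattern_set S us"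
    using sets.sets_into_space[OF pattern_set_measurable[OF us]] by (auto simp: space_restrict_space)
  have iff: "select_atom us i \<mu> \<in> B \<longleftrightarrow> emeasure \<mu> ((B \<inter> us ! i) \<inter> S) = 1" if \<mu>: "\<mu> \<in> pattern_set S us" for \<mu>
  proof -
    have simple: "\<mu> \<in> simple_on S" using pattern_set_subset_simple[OF us] \<mu> by blast
    have "atoms_in S \<mu> \<inter> (B \<inter> us ! i) = {select_atom us i \<mu>} \<inter> B"
      using atoms_Int_pattern[OF us \<mu> i] by blast
    also have "\<dots> = (if select_atom us i \<mu> \<in> B then {select_atom us i \<mu>} else {})" by auto
    finally have "atoms_in S \<mu> \<inter> (B \<inter> us ! i) = (if select_atom us i \<mu> \<in> B then {select_atom us i \<mu>} else {})" .
    moreover have "emeasure \<mu> ((B \<inter> us ! i) \<inter> S) = of_nat (card (atoms_in S \<mu> \<inter> (B \<inter> us ! i)))"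
      using B pattern_nth_borel[OF us i] by (intro simple_onD(3)[OF simple S]) auto
    ultimately show ?thesis by simp
  qed
  have "(\<lambda>\<mu>. emeasure \<mu> ((B \<inter> us ! i) \<inter> S)) \<in> borel_measurable ?M"
    using B S pattern_nth_borel[OF us i] by (intro measurable_emeasure_integer_measure_space[OF lc]) auto
  then have "{\<mu> \<in> space ?M. emeasure \<mu> ((B \<inter> us ! i) \<inter> S) = 1} \<in> sets ?M" by measurable
  then have "{\<mu> \<in> space ?M. emeasure \<mu> ((B \<inter> us ! i) \<inter> S) = 1} \<inter> pattern_set S us \<in> sets ?M"
    using pattern_set_measurable[OF us] by (rule sets.Int)
  moreover have "{\<mu> \<in> space ?M. emeasure \<mu> ((B \<inter> us ! i) \<inter> S) = 1} \<inter> pattern_set S us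
     = select_atom us i -` B \<inter> pattern_set S us"
    using iff by (auto simp: pattern_set_def)
  ultimately show "select_atom us i -` B \<inter> space (restrict_space ?M (pattern_set S us))
      \<in> sets (restrict_space ?M (pattern_set S us))"
    unfolding sp sets_restrict_space by (intro image_eqI[rotated]) auto
qed simp

end

lemma simple_on_measurable:
  fixes S :: "'a::{t2_space, second_countable_topology} set"
  assumes lc: "locally_compact_space (euclidean :: 'a topology)" and S: "S \<in> sets borel"
  shows "simple_on S \<in> sets (integer_measure_space UNIV)"
proof -
  obtain \<B> :: "'a set set" where \<B>: "countable \<B>" "topological_basis \<B>" using ex_countable_basis by blast
  have "countable (patterns \<B>)"
    by (rule countable_subset[of _ "lists \<B>"]) (use \<B> in \<open>auto simp: patterns_def\<close>)
  then show ?thesis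
    unfolding simple_on_eq_Union_patterns[OF S \<B>(2)]
    using pattern_set_measurable[OF lc S \<B>(2)] by (intro sets.countable_UN') auto
qed

text \<open>Reduces functionals of the random atom set to sets enumerated by measurable, pointwise
  distinct points. The hypothesis ranges over all \<open>M\<close> and \<open>k\<close> because it
  is applied on each pattern set separately.\<close>

lemma measurable_atoms_in:
  fixes S :: "'a::{t2_space, second_countable_topology} set"
  assumes lc: "locally_compact_space (euclidean :: 'a topology)" and S: "S \<in> sets borel"
    and H: "\<And>(M :: 'a measure measure) (k :: nat) Z. (\<And>i. i < k \<Longrightarrow> Z i \<in> measurable M borel) \<Longrightarrow>
      (\<And>w. w \<in> space M \<Longrightarrow> inj_on (\<lambda>i. Z i w) {..<k}) \<Longrightarrow>
      (\<lambda>w. H ((\<lambda>i. Z i w) ` {..<k})) \<in> measurable M N"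
  shows "(\<lambda>\<mu>. H (atoms_in S \<mu>)) \<in> measurable (restrict_space (integer_measure_space UNIV) (simple_on S)) N"
proof -
  let ?M = "integer_measure_space (UNIV :: 'a set)"
  obtain \<B> :: "'a set set" where \<B>: "countable \<B>" "topological_basis \<B>" using ex_countable_basis by blast
  note P = simple_on_eq_Union_patterns[OF S \<B>(2)]
  have cnt: "countable (pattern_set S ` patterns \<B>)"
    by (intro countable_image, rule countable_subset[of _ "lists \<B>"]) (use \<B> in \<open>auto simp: patterns_def\<close>)
  show ?thesis
  proof (rule measurable_piecewise_restrict[OF cnt])
    fix A assume "A \<in> pattern_set S ` patterns \<B>"
    then obtain us where us: "us \<in> patterns \<B>" "A = pattern_set S us" by blast
    have A: "A \<in> sets ?M" "A \<subseteq> simple_on S"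
      using pattern_set_measurable[OF lc S \<B>(2) us(1)] P us by auto
    have AM: "A \<subseteq> space ?M" using sets.sets_into_space[OF A(1)] .
    show "A \<inter> space (restrict_space ?M (simple_on S)) \<in> sets (restrict_space ?M (simple_on S))"
    proof -
      have eq: "A \<inter> space (restrict_space ?M (simple_on S)) = A"
        using A(2) AM by (auto simp: space_restrict_space)
      show ?thesis
        unfolding eq sets_restrict_space by (rule image_eqI[of _ _ A]) (use A in auto)
    qed
    have "restrict_space (restrict_space ?M (simple_on S)) A = restrict_space ?M A"
      using A simple_on_measurable[OF lc S]
      by (subst restrict_restrict_space[OF sets.Int[OF _ sets.top] sets.Int[OF _ sets.top]])
        (auto simp: inf_absorb2)
    moreover have "(\<lambda>\<mu>. H (atoms_in S \<mu>)) \<in> measurable (restrict_space ?M A) N"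
    proof (subst measurable_cong)
      show "(\<lambda>\<mu>. H ((\<lambda>i. select_atom S us i \<mu>) ` {..<length us})) \<in> measurable (restrict_space ?M A) N"
      proof (rule H[of "length us" "select_atom S us"])
        show "select_atom S us i \<in> measurable (restrict_space ?M A) borel" if "i < length us" for i
          unfolding us(2) by (rule measurable_select_atom[OF lc S \<B>(2) us(1) that])
        show "inj_on (\<lambda>i. select_atom S us i w) {..<length us}" if "w \<in> space (restrict_space ?M A)" for w
          using that us by (intro inj_select_atom[OF lc S \<B>(2) us(1)]) (auto simp: space_restrict_space)
      qed
      show "H (atoms_in S w) = H ((\<lambda>i. select_atom S us i w) ` {..<length us})"
        if "w \<in> space (restrict_space ?M A)" for w
        using that us by (subst image_select_atom[OF lc S \<B>(2) us(1)]) (auto simp: space_restrict_space)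
    qed
    ultimately show "(\<lambda>\<mu>. H (atoms_in S \<mu>)) \<in> measurable (restrict_space (restrict_space ?M (simple_on S)) A) N"
      by simp
  next
    show "space (restrict_space ?M (simple_on S)) \<subseteq> \<Union> (pattern_set S ` patterns \<B>)"
      using P by (auto simp: space_restrict_space)
  qed
qed

text \<open>\<open>measurable_on_finite_sets\<close> speaks of injective tuples over an initial
  segment, so \<open>J\<close> is reindexed by \<open>{..<card J}\<close>; the distinctness of the
  points carries over.\<close>

lemma measurable_on_finite_sets_image:
  fixes \<kappa> :: "'a::topological_space set \<Rightarrow> ennreal" and k :: nat
  assumes \<kappa>: "measurable_on_finite_sets \<kappa>"
    and Z: "\<And>i. i < k \<Longrightarrow> Z i \<in> measurable M borel" "\<And>w. w \<in> space M \<Longrightarrow> inj_on (\<lambda>i. Z i w) {..<k}"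
    and J: "J \<subseteq> {..<k}" "J \<noteq> {}"
  shows "(\<lambda>w. \<kappa> ((\<lambda>i. Z i w) ` J)) \<in> borel_measurable M"
proof -
  have fin: "finite J" using J finite_subset by blast
  obtain e where e: "bij_betw e {..<card J} J"
    using ex_bij_betw_nat_finite[OF fin] by (auto simp: lessThan_atLeast0)
  have "1 \<le> card J" using fin J by (simp add: Suc_le_eq card_gt_0_iff)
  from mp[OF spec[OF \<kappa>[unfolded measurable_on_finite_sets_def]] this] obtain g where g: "g \<in> borel_measurable (\<Pi>\<^sub>M i\<in>{..<card J}. (borel :: 'a measure))"
    and g': "\<forall>x \<in> {..<card J} \<rightarrow>\<^sub>E UNIV. inj_on x {..<card J} \<longrightarrow> \<kappa> (x ` {..<card J}) = g x"
    by (elim bexE conjE)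
  have eJ: "e i < k" if "i < card J" for i using e that J by (auto simp: bij_betw_def)
  have "(\<lambda>w. \<lambda>i\<in>{..<card J}. Z (e i) w) \<in> measurable M (\<Pi>\<^sub>M i\<in>{..<card J}. borel)"
    using Z(1) eJ by (intro measurable_restrict) auto
  from measurable_compose[OF this g]
  have "(\<lambda>w. g (\<lambda>i\<in>{..<card J}. Z (e i) w)) \<in> borel_measurable M" .
  moreover have "\<kappa> ((\<lambda>i. Z i w) ` J) = g (\<lambda>i\<in>{..<card J}. Z (e i) w)" if w: "w \<in> space M" for w
  proof -
    have im: "(\<lambda>i. Z i w) ` J = (\<lambda>i\<in>{..<card J}. Z (e i) w) ` {..<card J}"
    proof -
      have "(\<lambda>i. Z i w) ` J = (\<lambda>i. Z i w) ` (e ` {..<card J})" by (simp only: bij_betw_imp_surj_on[OF e])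
      also have "\<dots> = (\<lambda>i\<in>{..<card J}. Z (e i) w) ` {..<card J}"
        unfolding image_image by (rule image_cong) auto
      finally show ?thesis .
    qed
    have "inj_on (\<lambda>i. Z i w) (e ` {..<card J})"
      using inj_on_subset[OF Z(2)[OF w]] J e by (auto simp: bij_betw_def)
    then have "inj_on (\<lambda>i. Z (e i) w) {..<card J}"
      using comp_inj_on[of e "{..<card J}" "\<lambda>i. Z i w"] e by (auto simp: bij_betw_def comp_def)
    then have "inj_on (\<lambda>i\<in>{..<card J}. Z (e i) w) {..<card J}"
      by (simp add: inj_on_def)
    then show ?thesis unfolding im by (intro mp[OF bspec[OF g']]) auto
  qed
  ultimately show ?thesis by (subst measurable_cong) auto
qed

text \<open>\<open>H\<close> factors through the finitely many patterns of truth values, so nothing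
  has to be known about how it depends on them.\<close>

lemma measurable_finite_predicates:
  assumes fin: "finite \<A>" and Q: "\<And>A. A \<in> \<A> \<Longrightarrow> {w \<in> space M. Q A w} \<in> sets M"
    and H: "\<And>w w'. w \<in> space M \<Longrightarrow> w' \<in> space M \<Longrightarrow> (\<And>A. A \<in> \<A> \<Longrightarrow> Q A w \<longleftrightarrow> Q A w') \<Longrightarrow> H w = H w'"
  shows "H \<in> measurable M (count_space UNIV)"
proof -
  define p where "p w = {A \<in> \<A>. Q A w}" for w
  \<comment> \<open>Any point with the given pattern will do, as \<open>H\<close> takes the same
    value at all of them.\<close>
  define h where "h P = H (SOME w. w \<in> space M \<and> p w = P)" for P
  have p: "p \<in> measurable M (count_space (Pow \<A>))"
  proof (subst measurable_count_space_eq2)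
    show "finite (Pow \<A>)" using fin by simp
    have "p -` {P} \<inter> space M \<in> sets M" if "P \<in> Pow \<A>" for P
    proof -
      have "{w \<in> space M. \<forall>A\<in>\<A>. Q A w \<longleftrightarrow> A \<in> P} \<in> sets M"
        using Q fin by (intro sets.sets_Collect_finite_All sets.sets_Collect) auto
      also have "{w \<in> space M. \<forall>A\<in>\<A>. Q A w \<longleftrightarrow> A \<in> P} = p -` {P} \<inter> space M"
      proof -
        have "(\<forall>A\<in>\<A>. Q A w \<longleftrightarrow> A \<in> P) \<longleftrightarrow> p w = P" for w
          using that unfolding p_def by blast
        then show ?thesis by (simp add: vimage_def Int_def conj_commute)
      qed
      finally show ?thesis .
    qed
    then show "p \<in> space M \<rightarrow> Pow \<A> \<and> (\<forall>P\<in>Pow \<A>. p -` {P} \<inter> space M \<in> sets M)"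
      unfolding p_def by blast
  qed
  have "(\<lambda>w. h (p w)) \<in> measurable M (count_space UNIV)"
    by (rule measurable_compose[OF p]) simp
  moreover have "h (p w) = H w" if w: "w \<in> space M" for w
  proof -
    define v where "v = (SOME v. v \<in> space M \<and> p v = p w)"
    have v: "v \<in> space M \<and> p v = p w" unfolding v_def by (rule someI[of _ w]) (simp add: w)
    then have "Q A v \<longleftrightarrow> Q A w" if "A \<in> \<A>" for A using that unfolding p_def by blast
    then have "H v = H w" using v w by (intro H) auto
    then show ?thesis by (simp add: h_def v_def)
  qed
  ultimately show ?thesis by (subst measurable_cong[where g = "\<lambda>w. h (p w)"]) auto
qed

section \<open>Measurability of the number of diagram points in a Borel set\<close>

context finite_weight
begin

text \<open>Only the truth values \<open>\<kappa> \<sigma> \<in> I\<close> and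
  \<open>\<kappa> \<sigma> \<in> J\<close> matter: the rank inequality is applied to
  \<open>h\<close> and to its inverse.\<close>

lemma verbose_count_relabel:
  assumes X: "finite X" "bij_betw h X X'" and I: "down_closed I" and J: "down_closed J"
    and hI: "\<And>\<sigma>. \<sigma> \<noteq> {} \<Longrightarrow> \<sigma> \<subseteq> X \<Longrightarrow> \<kappa> \<sigma> \<in> I \<longleftrightarrow> \<kappa> (h ` \<sigma>) \<in> I"
    and hJ: "\<And>\<sigma>. \<sigma> \<noteq> {} \<Longrightarrow> \<sigma> \<subseteq> X \<Longrightarrow> \<kappa> \<sigma> \<in> J \<longleftrightarrow> \<kappa> (h ` \<sigma>) \<in> J"
  shows "size (filter_mset (\<lambda>p. p \<in> I \<times> J) (verbose_diagram TYPE('f::field) q (kappa_filtration \<kappa> X)))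
    = size (filter_mset (\<lambda>p. p \<in> I \<times> J) (verbose_diagram TYPE('f) q (kappa_filtration \<kappa> X')))"
proof -
  have X': "finite X'" using X bij_betw_finite by blast
  have rank: "\<exists>num. inj_on num Y \<and> size (filter_mset (\<lambda>p. p \<in> I \<times> J) (verbose_diagram TYPE('f) q (kappa_filtration \<kappa> Y)))
       = diagram_rank TYPE('f) (kappa_filtration \<kappa> Y) num q I J" if Y: "finite Y" for Y
  proof (rule verbose_diagram_rectangle[OF Y, where 'f = 'f and q = q])
    fix num assume "inj_on num Y" and r: "\<And>I J. down_closed I \<Longrightarrow> down_closed J \<Longrightarrow>
      size (filter_mset (\<lambda>p. p \<in> I \<times> J) (verbose_diagram TYPE('f) q (kappa_filtration \<kappa> Y)))
       = diagram_rank TYPE('f) (kappa_filtration \<kappa> Y) num q I J"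
    then show ?thesis using r[OF I J] by (intro exI conjI)
  qed
  obtain num where num: "inj_on num X" and
    r: "size (filter_mset (\<lambda>p. p \<in> I \<times> J) (verbose_diagram TYPE('f) q (kappa_filtration \<kappa> X)))
       = diagram_rank TYPE('f) (kappa_filtration \<kappa> X) num q I J"
    using rank[OF X(1)] by (elim exE conjE)
  obtain num' where num': "inj_on num' X'" and
    r': "size (filter_mset (\<lambda>p. p \<in> I \<times> J) (verbose_diagram TYPE('f) q (kappa_filtration \<kappa> X')))
       = diagram_rank TYPE('f) (kappa_filtration \<kappa> X') num' q I J"
    using rank[OF X'] by (elim exE conjE)
  let ?g = "the_inv_into X h"
  have g: "bij_betw ?g X' X" by (rule bij_betw_the_inv_into[OF X(2)])
  have hg: "h ` ?g ` \<sigma> = \<sigma>" "?g ` \<sigma> \<subseteq> X" if "\<sigma> \<subseteq> X'" for \<sigma>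
  proof -
    have "h (?g x) = x" if "x \<in> \<sigma>" for x
      using that \<open>\<sigma> \<subseteq> X'\<close> by (intro f_the_inv_into_f_bij_betw[OF X(2)]) auto
    then show "h ` ?g ` \<sigma> = \<sigma>" by force
    show "?g ` \<sigma> \<subseteq> X" using g that by (auto simp: bij_betw_def)
  qed
  have "diagram_rank TYPE('f) (kappa_filtration \<kappa> X) num q I J \<le> diagram_rank TYPE('f) (kappa_filtration \<kappa> X') num' q I J"
    by (rule diagram_rank_relabel[OF X num num']) (simp_all add: hI hJ)
  moreover have "diagram_rank TYPE('f) (kappa_filtration \<kappa> X') num' q I J \<le> diagram_rank TYPE('f) (kappa_filtration \<kappa> X) num q I J"
  proof (rule diagram_rank_relabel[OF X' g num' num])
    show "\<kappa> (?g ` \<sigma>) \<in> I" if "\<sigma> \<noteq> {}" "\<sigma> \<subseteq> X'" "\<kappa> \<sigma> \<in> I" for \<sigma>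
      using hI[of "?g ` \<sigma>"] hg[OF that(2)] that by simp
    show "\<kappa> (?g ` \<sigma>) \<in> J" if "\<sigma> \<noteq> {}" "\<sigma> \<subseteq> X'" "\<kappa> \<sigma> \<in> J" for \<sigma>
      using hJ[of "?g ` \<sigma>"] hg[OF that(2)] that by simp
  qed
  ultimately show ?thesis unfolding r r' by (rule antisym)
qed

end

text \<open>No ray \<open>{..<a}\<close> contains \<infinity>, so \<open>UNIV\<close> is added to
  the generators; otherwise the rectangles would not cover the space.\<close>

lemma borel_lower_rectangles:
  "sets (borel :: (ennreal \<times> ennreal) measure) =
    sigma_sets UNIV {I \<times> J | I J. I \<in> insert UNIV (range lessThan) \<and> J \<in> insert UNIV (range lessThan)}"
proof -
  let ?E = "insert UNIV (range lessThan) :: ennreal set set"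
  have E: "sets (borel :: ennreal measure) = sigma_sets (space borel) ?E"
  proof -
    have "sigma_sets UNIV (range lessThan :: ennreal set set) \<subseteq> sigma_sets UNIV ?E"
      by (rule sigma_sets_mono') auto
    moreover have "sigma_sets UNIV ?E \<subseteq> sigma_sets UNIV (range lessThan)"
      by (rule sigma_sets_mono) (auto intro: sigma_sets_top)
    ultimately show ?thesis by (simp add: borel_Iio)
  qed
  have "sets (borel \<Otimes>\<^sub>M borel :: (ennreal \<times> ennreal) measure) =
      sets (sigma (space borel \<times> space borel) {a \<times> b | a b. a \<in> ?E \<and> b \<in> ?E})"
    by (rule sets_pair_eq[OF _ E, of "{UNIV}" _ _ "{UNIV}"]) (auto simp: E)
  then show ?thesis by (subst borel_prod[symmetric]) simp
qed

lemma sum_mset_indicator_eq: "(\<Sum>p\<in>#D. indicator B p :: ennreal) = of_nat (size (filter_mset (\<lambda>p. p \<in> B) D))"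
  by (induction D) (auto simp: add.commute)

lemma sum_mset_indicator_UN:
  assumes "disjoint_family A"
  shows "(\<Sum>p\<in>#D. indicator (\<Union>i. A i) p :: ennreal) = suminf (\<lambda>i::nat. \<Sum>p\<in>#D. indicator (A i) p)"
proof (induction D)
  case (add x D)
  have "suminf (\<lambda>i. \<Sum>p\<in>#add_mset x D. indicator (A i) p :: ennreal)
    = suminf (\<lambda>i. indicator (A i) x + (\<Sum>p\<in>#D. indicator (A i) p))" by simp
  also have "\<dots> = suminf (\<lambda>i. indicator (A i) x) + suminf (\<lambda>i. \<Sum>p\<in>#D. indicator (A i) p)"
    by (intro suminf_add[symmetric] summableI)
  also have "suminf (\<lambda>i. indicator (A i) x :: ennreal) = indicator (\<Union>i. A i) x"
    by (rule suminf_indicator[OF assms])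
  finally show ?case using add by simp
qed simp

text \<open>Dynkin's argument from lower rectangles; complements are handled by subtraction, which
  is legitimate because every diagram is finite.\<close>

lemma measurable_sum_mset_indicator:
  fixes D :: "'w \<Rightarrow> (ennreal \<times> ennreal) multiset"
  assumes rect: "\<And>I J. down_closed I \<Longrightarrow> down_closed J \<Longrightarrow> I \<in> sets borel \<Longrightarrow> J \<in> sets borel \<Longrightarrow>
      (\<lambda>w. size (filter_mset (\<lambda>p. p \<in> I \<times> J) (D w))) \<in> measurable M (count_space UNIV)"
    and B: "B \<in> sets borel"
  shows "(\<lambda>w. \<Sum>p\<in>#D w. indicator B p :: ennreal) \<in> borel_measurable M"
proof -
  let ?E = "insert UNIV (range lessThan) :: ennreal set set"
  let ?G = "{I \<times> J | I J. I \<in> ?E \<and> J \<in> ?E}"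
  have E: "down_closed I \<and> I \<in> sets borel" if "I \<in> ?E" for I
    using that by (auto simp: down_closed_def)
  have rect': "(\<lambda>w. \<Sum>p\<in>#D w. indicator (I \<times> J) p :: ennreal) \<in> borel_measurable M" if "I \<in> ?E" "J \<in> ?E" for I J
    unfolding sum_mset_indicator_eq
    by (rule measurable_compose[OF rect]) (use E that in auto)
  have Int: "Int_stable ?G"
  proof (rule Int_stableI)
    have inter: "I \<inter> J \<in> ?E" if "I \<in> ?E" "J \<in> ?E" for I J
    proof -
      have "{..<a} \<inter> {..<b} = {..<min a b}" for a b :: ennreal by auto
      then show ?thesis using that by auto
    qed
    fix A B assume "A \<in> ?G" "B \<in> ?G"
    then obtain I J I' J' where AB: "A = I \<times> J" "B = I' \<times> J'" and E: "I \<in> ?E" "J \<in> ?E" "I' \<in> ?E" "J' \<in> ?E"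
      by blast
    have "A \<inter> B = (I \<inter> I') \<times> (J \<inter> J')" unfolding AB by (rule Times_Int_Times)
    moreover note inter[OF E(1,3)] inter[OF E(2,4)]
    ultimately show "A \<inter> B \<in> ?G" by (intro CollectI exI conjI)
  qed
  have sub: "?G \<subseteq> Pow UNIV" by simp
  have "B \<in> sigma_sets UNIV ?G" using B unfolding borel_lower_rectangles .
  with Int sub show ?thesis
  proof (induction rule: sigma_sets_induct_disjoint)
    case (basic A)
    then obtain I J where "I \<in> ?E" "J \<in> ?E" "A = I \<times> J" by blast
    then show ?case using rect' by blast
  next
    case empty
    then show ?case by simp
  next
    case (compl A)
    have "(\<lambda>w. (\<Sum>p\<in>#D w. indicator UNIV p :: ennreal) - (\<Sum>p\<in>#D w. indicator A p)) \<in> borel_measurable M"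
      using rect'[of UNIV UNIV] compl by (intro borel_measurable_minus_ennreal) auto
    moreover have "(\<Sum>p\<in>#D w. indicator UNIV p :: ennreal) - (\<Sum>p\<in>#D w. indicator A p) = (\<Sum>p\<in>#D w. indicator (UNIV - A) p)" for w
    proof -
      have "(\<Sum>p\<in>#D w. indicator UNIV p :: ennreal) = (\<Sum>p\<in>#D w. indicator (UNIV - A) p) + (\<Sum>p\<in>#D w. indicator A p)"
        unfolding sum_mset.distrib[symmetric]
        by (intro arg_cong[where f = sum_mset] image_mset_cong) (auto simp: indicator_def)
      moreover have "(\<Sum>p\<in>#D w. indicator A p :: ennreal) \<noteq> \<top>" by (simp add: sum_mset_indicator_eq)
      ultimately show ?thesis by (simp add: ennreal_add_diff_cancel_right)
    qed
    ultimately show ?case by simp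
  next
    case (union A)
    show ?case unfolding sum_mset_indicator_UN[OF union(1)]
      using union(3) by (rule borel_measurable_suminf_order)
  qed
qed

text \<open>Once the atoms are enumerated, the count in a rectangle is a function of finitely many
  events \<open>\<kappa> \<sigma> \<in> I\<close> or \<open>\<kappa> \<sigma> \<in> J\<close>, each
  of them measurable.\<close>

lemma measurable_verbose_count:
  fixes \<kappa> :: "'v::{t2_space, second_countable_topology} set \<Rightarrow> ennreal" and S :: "'v::{t2_space, second_countable_topology} set"
  assumes lc: "locally_compact_space (euclidean :: 'v topology)" and S: "S \<in> sets borel"
    and fw: "finite_weight \<kappa>" and \<kappa>: "measurable_on_finite_sets \<kappa>" and B: "B \<in> sets borel"
  shows "(\<lambda>\<mu>. \<Sum>p\<in>#verbose_diagram TYPE('f::field) q (kappa_filtration \<kappa> (atoms_in S \<mu>)). indicator B p :: ennreal)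
    \<in> borel_measurable (restrict_space (integer_measure_space UNIV) (simple_on S))"
proof (rule measurable_sum_mset_indicator[OF _ B])
  interpret finite_weight \<kappa> by (rule fw)
  fix I J :: "ennreal set"
  assume I: "down_closed I" "I \<in> sets borel" and J: "down_closed J" "J \<in> sets borel"
  show "(\<lambda>\<mu>. size (filter_mset (\<lambda>p. p \<in> I \<times> J) (verbose_diagram TYPE('f) q (kappa_filtration \<kappa> (atoms_in S \<mu>)))))
    \<in> measurable (restrict_space (integer_measure_space UNIV) (simple_on S)) (count_space UNIV)"
  proof (rule measurable_atoms_in[OF lc S])
    fix M :: "'v measure measure" and k :: nat and Z :: "nat \<Rightarrow> 'v measure \<Rightarrow> 'v"
    assume Z: "\<And>i. i < k \<Longrightarrow> Z i \<in> measurable M borel" "\<And>w. w \<in> space M \<Longrightarrow> inj_on (\<lambda>i. Z i w) {..<k}"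
    let ?X = "\<lambda>w. (\<lambda>i. Z i w) ` {..<k}"
    \<comment> \<open>The flag in the second component selects between \<open>I\<close> and
      \<open>J\<close>.\<close>
    let ?A = "{A. A \<subseteq> {..<k} \<and> A \<noteq> {}} \<times> (UNIV :: bool set)"
    let ?Q = "\<lambda>(A, b) w. \<kappa> ((\<lambda>i. Z i w) ` A) \<in> (if b then I else J)"
    show "(\<lambda>w. size (filter_mset (\<lambda>p. p \<in> I \<times> J) (verbose_diagram TYPE('f) q (kappa_filtration \<kappa> (?X w)))))
      \<in> measurable M (count_space UNIV)"
    proof (rule measurable_finite_predicates)
      show "finite ?A" by simp
      show "{w \<in> space M. ?Q A w} \<in> sets M" if A: "A \<in> ?A" for A
      proof -
        obtain A' b where A': "A = (A', b)" "A' \<subseteq> {..<k}" "A' \<noteq> {}" using A by blast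
        have "(\<lambda>w. \<kappa> ((\<lambda>i. Z i w) ` A')) \<in> borel_measurable M"
          by (rule measurable_on_finite_sets_image[OF \<kappa> Z A'(2,3)])
        moreover have "(if b then I else J) \<in> sets borel" using I J by simp
        ultimately have "(\<lambda>w. \<kappa> ((\<lambda>i. Z i w) ` A')) -` (if b then I else J) \<inter> space M \<in> sets M"
          by (rule measurable_sets)
        moreover have "(\<lambda>w. \<kappa> ((\<lambda>i. Z i w) ` A')) -` (if b then I else J) \<inter> space M = {w \<in> space M. ?Q A w}"
          unfolding A'(1) by auto
        ultimately show ?thesis by simp
      qed
    next
      fix w w' assume w: "w \<in> space M" "w' \<in> space M" and Q: "\<And>A. A \<in> ?A \<Longrightarrow> ?Q A w \<longleftrightarrow> ?Q A w'"
      \<comment> \<open>Matches the \<open>i\<close>th atom at \<open>w\<close> with the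
        \<open>i\<close>th atom at \<open>w'\<close>.\<close>
      define h where "h = (\<lambda>x. Z (the_inv_into {..<k} (\<lambda>i. Z i w) x) w')"
      have hZ: "h (Z i w) = Z i w'" if "i < k" for i
        unfolding h_def using the_inv_into_f_f[OF Z(2)[OF w(1)], of i] that by simp
      have h_img: "h ` (\<lambda>i. Z i w) ` A = (\<lambda>i. Z i w') ` A" if "A \<subseteq> {..<k}" for A
        unfolding image_image using hZ that by (intro image_cong) auto
      have bij: "bij_betw h (?X w) (?X w')"
        unfolding bij_betw_def
      proof
        show "inj_on h (?X w)"
        proof (rule inj_onI)
          fix x y assume "x \<in> ?X w" "y \<in> ?X w" and eq: "h x = h y"
          then obtain i j where ij: "i < k" "j < k" "x = Z i w" "y = Z j w" by auto
          then have "Z i w' = Z j w'" using eq hZ by simp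
          then have "i = j" using inj_onD[OF Z(2)[OF w(2)], of i j] ij by simp
          then show "x = y" using ij by simp
        qed
        show "h ` ?X w = ?X w'" by (rule h_img) simp
      qed
      have Q': "\<kappa> \<sigma> \<in> I \<longleftrightarrow> \<kappa> (h ` \<sigma>) \<in> I" "\<kappa> \<sigma> \<in> J \<longleftrightarrow> \<kappa> (h ` \<sigma>) \<in> J"
        if \<sigma>: "\<sigma> \<noteq> {}" "\<sigma> \<subseteq> ?X w" for \<sigma>
      proof -
        obtain A where A: "A \<subseteq> {..<k}" "\<sigma> = (\<lambda>i. Z i w) ` A" using \<sigma>(2) by (meson subset_imageE)
        then have "A \<noteq> {}" using \<sigma> by auto
        then have "(A, b) \<in> ?A" for b using A by simp
        from Q[OF this[of True]] Q[OF this[of False]]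
        show "\<kappa> \<sigma> \<in> I \<longleftrightarrow> \<kappa> (h ` \<sigma>) \<in> I" "\<kappa> \<sigma> \<in> J \<longleftrightarrow> \<kappa> (h ` \<sigma>) \<in> J"
          unfolding A(2) h_img[OF A(1)] by simp_all
      qed
      show "size (filter_mset (\<lambda>p. p \<in> I \<times> J) (verbose_diagram TYPE('f) q (kappa_filtration \<kappa> (?X w))))
        = size (filter_mset (\<lambda>p. p \<in> I \<times> J) (verbose_diagram TYPE('f) q (kappa_filtration \<kappa> (?X w'))))"
        by (rule verbose_count_relabel[OF _ bij I(1) J(1) Q']) auto
    qed
  qed
qed

lemma measurable_cone_count:
  fixes \<kappa> :: "'v::{t2_space, second_countable_topology} set \<Rightarrow> ennreal" and S :: "'v::{t2_space, second_countable_topology} set"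
  assumes lc: "locally_compact_space (euclidean :: 'v topology)" and S: "S \<in> sets borel"
    and \<kappa>: "measurable_on_finite_sets \<kappa>"
  shows "(\<lambda>\<mu>. if atoms_in S \<mu> \<noteq> {} \<and> \<kappa> (atoms_in S \<mu>) \<le> a then of_nat (cone_count q (card (atoms_in S \<mu>))) else 0 :: ennreal)
    \<in> borel_measurable (restrict_space (integer_measure_space UNIV) (simple_on S))"
proof (rule measurable_atoms_in[OF lc S])
  fix M :: "'v measure measure" and k :: nat and Z :: "nat \<Rightarrow> 'v measure \<Rightarrow> 'v"
  assume Z: "\<And>i. i < k \<Longrightarrow> Z i \<in> measurable M borel" "\<And>w. w \<in> space M \<Longrightarrow> inj_on (\<lambda>i. Z i w) {..<k}"
  let ?X = "\<lambda>w. (\<lambda>i. Z i w) ` {..<k}"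
  show "(\<lambda>w. if ?X w \<noteq> {} \<and> \<kappa> (?X w) \<le> a then of_nat (cone_count q (card (?X w))) else 0 :: ennreal) \<in> borel_measurable M"
  proof (cases "k = 0")
    case True
    then show ?thesis by simp
  next
    case False
    then have ne: "?X w \<noteq> {}" for w by auto
    have [measurable]: "(\<lambda>w. \<kappa> (?X w)) \<in> borel_measurable M"
      by (rule measurable_on_finite_sets_image[OF \<kappa> Z]) (use False in auto)
    have "(\<lambda>w. if \<kappa> (?X w) \<le> a then of_nat (cone_count q k) else 0 :: ennreal) \<in> borel_measurable M"
      by measurable
    moreover have "(if ?X w \<noteq> {} \<and> \<kappa> (?X w) \<le> a then of_nat (cone_count q (card (?X w))) else 0 :: ennreal)
        = (if \<kappa> (?X w) \<le> a then of_nat (cone_count q k) else 0)" if "w \<in> space M" for w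
      using ne[of w] card_image[OF Z(2)[OF that]] by simp
    ultimately show ?thesis by (subst measurable_cong) auto
  qed
qed

section \<open>Translations of marked measures\<close>

lemma locally_compact_space_Times:
  assumes "locally_compact_space (euclidean :: 'm::topological_space topology)"
  shows "locally_compact_space (euclidean :: ((real^'n) \<times> 'm) topology)"
  using assms locally_compact_space_euclidean[where 'a = "real^'n"]
  by (simp add: locally_compact_space_prod_topology flip: prod_topology_euclidean)

lemma continuous_shift: "continuous_on UNIV (\<lambda>(x :: 'a::real_normed_vector, m :: 'm::topological_space). (x - v, m))"
  unfolding case_prod_unfold by (intro continuous_intros)

lemma sets_translate_measure [simp]: "sets (translate_measure v \<mu>) = sets borel"
  by (simp add: translate_measure_def)

context
  fixes v :: "real^'n" and \<mu> :: "((real^'n) \<times> 'm::{t2_space, second_countable_topology}) measure"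
  assumes sets_mu: "sets \<mu> = sets borel"
begin

lemma measurable_shift: "(\<lambda>(x, m). (x - v, m)) \<in> measurable \<mu> borel"
  using borel_measurable_continuous_onI[OF continuous_shift] by (simp cong: measurable_cong_sets add: sets_mu)

lemma emeasure_translate_measure:
  "B \<in> sets borel \<Longrightarrow> emeasure (translate_measure v \<mu>) B = emeasure \<mu> ((\<lambda>(x, m). (x + v, m)) ` B)"
proof -
  assume B: "B \<in> sets borel"
  have "(\<lambda>(x, m). (x - v, m)) -` B \<inter> space \<mu> = (\<lambda>(x, m). (x + v, m)) ` B"
    using sets_eq_imp_space_eq[OF sets_mu] by (force simp: image_iff)
  then show ?thesis unfolding translate_measure_def
    by (subst emeasure_distr[OF measurable_shift B]) simp
qed

lemma integral_translate_measure:
  fixes f :: "(real^'n) \<times> 'm \<Rightarrow> real"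
  assumes "continuous_on UNIV f"
  shows "integral\<^sup>L (translate_measure v \<mu>) f = integral\<^sup>L \<mu> (\<lambda>(x, m). f (x - v, m))"
  unfolding translate_measure_def
  by (subst integral_distr[OF measurable_shift borel_measurable_continuous_onI[OF assms]])
    (simp add: case_prod_unfold)

end

lemma compact_shift:
  fixes K :: "((real^'n) \<times> 'm::topological_space) set"
  assumes "compact K" shows "compact ((\<lambda>(x, m). (x + v, m)) ` K)"
proof -
  have "continuous_on K (\<lambda>(x :: real^'n, m :: 'm). (x + v, m))"
    unfolding case_prod_unfold by (intro continuous_intros)
  then show ?thesis using assms by (rule compact_continuous_image)
qed

lemma translate_radon_measures:
  fixes \<mu> :: "((real^'n) \<times> 'm::{t2_space, second_countable_topology}) measure"
  assumes \<mu>: "\<mu> \<in> radon_measures UNIV"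
  shows "translate_measure v \<mu> \<in> radon_measures UNIV"
proof -
  have "emeasure (translate_measure v \<mu>) C < \<infinity>" if "compact C" for C
    using that compact_shift[OF that, of v] \<mu> emeasure_translate_measure[OF borel_sets_radon[OF \<mu>] borel_compact[OF that], of v]
    by (simp add: radon_measures_def)
  then show ?thesis by (simp add: radon_measures_def sets_restrict_space)
qed

lemma translate_integer_measures:
  fixes \<mu> :: "((real^'n) \<times> 'm::{t2_space, second_countable_topology}) measure"
  assumes \<mu>: "\<mu> \<in> integer_measures UNIV"
  shows "translate_measure v \<mu> \<in> integer_measures UNIV"
proof -
  have s: "sets \<mu> = sets borel" by (rule integer_measures_sets[OF \<mu>])
  have "emeasure (translate_measure v \<mu>) B = \<infinity> \<or> (\<exists>k::nat. emeasure (translate_measure v \<mu>) B = of_nat k)"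
    if B: "B \<in> sets borel" for B
  proof -
    have "emeasure (translate_measure v \<mu>) B = emeasure \<mu> ((\<lambda>(x, m). (x - v, m)) -` B \<inter> space \<mu>)"
      unfolding translate_measure_def by (rule emeasure_distr[OF measurable_shift[OF s] B])
    moreover have "(\<lambda>(x, m). (x - v, m)) -` B \<inter> space \<mu> \<in> sets \<mu>"
      by (rule measurable_sets[OF measurable_shift[OF s] B])
    ultimately show ?thesis using \<mu> unfolding integer_measures_def by auto
  qed
  then show ?thesis
    using translate_radon_measures[OF integer_measures_radon[OF \<mu>]] by (simp add: integer_measures_def)
qed

text \<open>\<open>distr\<close> is meaningful only along measurable maps, so stationarity cannot be
  exploited before this. Translation is vaguely continuous because a translated test function is
  again a test function.\<close>

lemma measurable_translate_measure:
  "translate_measure v \<in> measurable (integer_measure_space UNIV)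
     (integer_measure_space (UNIV :: ((real^'n) \<times> 'm::{t2_space, second_countable_topology}) set))"
proof -
  let ?E = "UNIV :: ((real^'n) \<times> 'm) set"
  let ?T = "vague_topology ?E" and ?I = "integer_measures ?E"
  have cont: "continuous_map (subtopology ?T ?I) ?T (translate_measure v)"
    unfolding vague_topology_def[of ?E]
  proof (rule continuous_on_generated_topo; unfold vague_topology_def[symmetric])
    fix U assume "U \<in> {{\<mu> \<in> radon_measures ?E. integral\<^sup>L \<mu> f \<in> U} |f U. f \<in> cont_comp_supp ?E \<and> open U}"
    then obtain f V where f: "f \<in> cont_comp_supp ?E" "open V" "U = {\<mu> \<in> radon_measures ?E. integral\<^sup>L \<mu> f \<in> V}"
      by blast
    obtain K where K: "continuous_on UNIV f" "compact K" "\<And>x. x \<notin> K \<Longrightarrow> f x = 0"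
      using cont_comp_suppE[OF f(1)] by blast
    let ?f = "\<lambda>(x, m). f (x - v, m)"
    have f': "?f \<in> cont_comp_supp ?E"
    proof (rule cont_comp_suppI[OF _ compact_shift[OF K(2)]])
      show "continuous_on UNIV ?f"
        using continuous_on_compose2[OF K(1) continuous_shift[of v]] by (simp add: case_prod_unfold)
      show "?f z = 0" if z: "z \<notin> (\<lambda>(x, m). (x + v, m)) ` K" for z
      proof -
        have "(fst z - v, snd z) \<notin> K" using z by (force simp: image_iff)
        then show ?thesis using K(3) by (simp add: case_prod_unfold)
      qed
    qed
    have "translate_measure v -` U \<inter> topspace (subtopology ?T ?I) = {\<mu> \<in> radon_measures ?E. integral\<^sup>L \<mu> ?f \<in> V} \<inter> ?I"
    proof -
      have "translate_measure v \<mu> \<in> U \<longleftrightarrow> integral\<^sup>L \<mu> ?f \<in> V" if "\<mu> \<in> ?I" for \<mu>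
        using translate_radon_measures[OF integer_measures_radon[OF that], of v]
          integral_translate_measure[OF integer_measures_sets[OF that] K(1), of v]
        by (simp add: f(3))
      then show ?thesis
        by (auto simp: topspace_subtopology topspace_vague_topology dest: integer_measures_radon)
    qed
    also have "openin (subtopology ?T ?I) \<dots>"
      using openin_vague_topology[OF f' f(2)] by (auto simp: openin_subtopology)
    finally show "openin (subtopology ?T ?I) (translate_measure v -` U \<inter> topspace (subtopology ?T ?I))" .
  next
    have "\<Union> {{\<mu> \<in> radon_measures ?E. integral\<^sup>L \<mu> f \<in> U} |f U. f \<in> cont_comp_supp ?E \<and> open U} = radon_measures ?E"
      using topspace_vague_topology[of ?E] unfolding vague_topology_def topology_generated_by_topspace .
    then show "translate_measure v ` topspace (subtopology ?T ?I)
       \<subseteq> \<Union> {{\<mu> \<in> radon_measures ?E. integral\<^sup>L \<mu> f \<in> U} |f U. f \<in> cont_comp_supp ?E \<and> open U}"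
      using translate_radon_measures[OF integer_measures_radon, of _ v]
      by (auto simp: topspace_subtopology)
  qed
  have top: "topspace (subtopology ?T ?I) = ?I"
    using integer_measures_radon by (auto simp: topspace_subtopology topspace_vague_topology)
  have "continuous_map (subtopology ?T ?I) (subtopology ?T ?I) (translate_measure v)"
    using cont translate_integer_measures[of _ v] by (auto simp: continuous_map_in_subtopology top)
  then show ?thesis
    unfolding integer_measure_space_def[of ?E]
  proof (intro measurable_measure_of integer_measure_space_generator)
    fix U assume c: "continuous_map (subtopology ?T ?I) (subtopology ?T ?I) (translate_measure v)"
      and U: "U \<in> {U. openin (subtopology ?T ?I) U}"
    have "openin (subtopology ?T ?I) {\<mu> \<in> topspace (subtopology ?T ?I). translate_measure v \<mu> \<in> U}"
      using openin_continuous_map_preimage[OF c] U by simp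
    then have "{\<mu> \<in> ?I. translate_measure v \<mu> \<in> U} \<in> sets (integer_measure_space ?E)"
      unfolding top by (rule sets_integer_measure_spaceI)
    moreover have "{\<mu> \<in> ?I. translate_measure v \<mu> \<in> U} = translate_measure v -` U \<inter> space (sigma ?I {U. openin (subtopology ?T ?I) U})"
      using space_measure_of[OF integer_measure_space_generator] by auto
    ultimately show "translate_measure v -` U \<inter> space (sigma ?I {U. openin (subtopology ?T ?I) U}) \<in> sets (sigma ?I {U. openin (subtopology ?T ?I) U})"
      by (simp add: integer_measure_space_def)
  next
    show "translate_measure v \<in> space (sigma ?I {U. openin (subtopology ?T ?I) U}) \<rightarrow> ?I"
      using space_measure_of[OF integer_measure_space_generator[of ?E]] translate_integer_measures[of _ v] by auto
  qed
qed

section \<open>Translations, cubes and tilings\<close>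

lemma shift_image_Times: "(\<lambda>(x, m). (x + v, m)) ` (Q \<times> UNIV) = ((\<lambda>x. x + v) ` Q) \<times> UNIV"
  by (auto simp: image_iff)

lemma atoms_in_translate:
  fixes \<mu> :: "((real^'n) \<times> 'm::{t2_space, second_countable_topology}) measure"
  assumes \<mu>: "sets \<mu> = sets borel"
  shows "atoms_in (((\<lambda>x. x + v) ` Q) \<times> UNIV) \<mu> = (\<lambda>(x, m). (x + v, m)) ` atoms_in (Q \<times> UNIV) (translate_measure v \<mu>)"
proof -
  have eq: "emeasure (translate_measure v \<mu>) {(x, m)} = emeasure \<mu> {(x + v, m)}" for x m
    by (subst emeasure_translate_measure[OF \<mu>]) auto
  show ?thesis
  proof
    show "atoms_in (((\<lambda>x. x + v) ` Q) \<times> UNIV) \<mu> \<subseteq> (\<lambda>(x, m). (x + v, m)) ` atoms_in (Q \<times> UNIV) (translate_measure v \<mu>)"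
    proof
      fix z assume "z \<in> atoms_in (((\<lambda>x. x + v) ` Q) \<times> UNIV) \<mu>"
      then obtain x m where "z = (x + v, m)" "x \<in> Q" "emeasure \<mu> {(x + v, m)} \<noteq> 0"
        by (auto simp: atoms_in_def)
      then have "(x, m) \<in> atoms_in (Q \<times> UNIV) (translate_measure v \<mu>)" by (simp add: atoms_in_def eq)
      then show "z \<in> (\<lambda>(x, m). (x + v, m)) ` atoms_in (Q \<times> UNIV) (translate_measure v \<mu>)"
        using \<open>z = _\<close> by (intro image_eqI[of _ _ "(x, m)"]) simp
    qed
    show "(\<lambda>(x, m). (x + v, m)) ` atoms_in (Q \<times> UNIV) (translate_measure v \<mu>) \<subseteq> atoms_in (((\<lambda>x. x + v) ` Q) \<times> UNIV) \<mu>"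
      by (auto simp: atoms_in_def eq)
  qed
qed

lemma translate_simple_on:
  fixes \<mu> :: "((real^'n) \<times> 'm::{t2_space, second_countable_topology}) measure"
  assumes \<mu>: "\<mu> \<in> simple_on (((\<lambda>x. x + v) ` Q) \<times> UNIV)" and Q: "Q \<times> (UNIV :: 'm set) \<in> sets borel"
  shows "translate_measure v \<mu> \<in> simple_on (Q \<times> UNIV)"
proof -
  have i: "\<mu> \<in> integer_measures UNIV" using \<mu> by (simp add: simple_on_def)
  note s = integer_measures_sets[OF i]
  have "emeasure (translate_measure v \<mu>) (Q \<times> UNIV) < \<infinity>"
    using \<mu> by (subst emeasure_translate_measure[OF s Q]) (simp add: shift_image_Times simple_on_def)
  moreover have "emeasure (translate_measure v \<mu>) {z} \<le> 1" if "z \<in> Q \<times> UNIV" for z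
  proof -
    have "emeasure (translate_measure v \<mu>) {z} = emeasure \<mu> {(fst z + v, snd z)}"
      by (subst emeasure_translate_measure[OF s]) (auto simp: case_prod_unfold)
    also have "\<dots> \<le> 1" using \<mu> that by (auto simp: simple_on_def)
    finally show ?thesis .
  qed
  ultimately show ?thesis using translate_integer_measures[OF i] by (simp add: simple_on_def)
qed

lemma emeasure_ground:
  fixes \<mu> :: "((real^'n) \<times> 'm::{t2_space, second_countable_topology}) measure"
  assumes \<mu>: "sets \<mu> = sets borel" and A: "A \<in> sets borel"
  shows "emeasure (ground \<mu>) A = emeasure \<mu> (A \<times> UNIV)"
proof -
  have "fst \<in> measurable \<mu> borel"
    using borel_measurable_continuous_onI[OF continuous_on_fst[OF continuous_on_id]]
    by (simp cong: measurable_cong_sets add: \<mu>)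
  moreover have "fst -` A \<inter> space \<mu> = A \<times> UNIV"
    using sets_eq_imp_space_eq[OF \<mu>] by auto
  ultimately show ?thesis unfolding ground_def using A by (simp add: emeasure_distr)
qed

text \<open>\<open>measure_of\<close> yields the null measure unless the given set function is a
  measure, so countable additivity has to be checked first.\<close>

lemma emeasure_dirac_sum:
  assumes "A \<in> sets (restrict_space borel S)"
  shows "emeasure (dirac_sum S D) A = (\<Sum>p\<in>#D. indicator A p)"
proof (rule emeasure_measure_of[OF dirac_sum_def])
  let ?R = "restrict_space borel S"
  have sp: "space ?R = S" by (simp add: space_restrict_space)
  show sub: "sets ?R \<subseteq> Pow S" using sets.space_closed[of ?R] by (simp add: sp)
  have sets: "sets (dirac_sum S D) = sets ?R"
    unfolding dirac_sum_def using sets_measure_of[OF sub] sets.sigma_sets_eq[of ?R] by (simp add: sp)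
  show "A \<in> sets (dirac_sum S D)" using assms by (simp add: sets)
  show "positive (sets (dirac_sum S D)) (\<lambda>A. \<Sum>p\<in>#D. indicator A p)" by (simp add: positive_def)
  show "countably_additive (sets (dirac_sum S D)) (\<lambda>A. \<Sum>p\<in>#D. indicator A p)"
    by (auto simp: countably_additive_def sum_mset_indicator_UN)
qed

text \<open>Half open, so that translates tile a larger cube without overlap;
  \<open>cube 0 1\<close> is the window used in \<open>intensity\<close>.\<close>

definition cube :: "real^'n \<Rightarrow> real \<Rightarrow> (real^'n) set" where
  "cube a l = {x. \<forall>i. a $ i \<le> x $ i \<and> x $ i < a $ i + l}"

lemma cube_shift: "cube a l = (\<lambda>x. x + a) ` cube 0 l"
proof
  show "cube a l \<subseteq> (\<lambda>x. x + a) ` cube 0 l"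
  proof
    fix x assume "x \<in> cube a l"
    then have "x - a \<in> cube 0 l" by (auto simp: cube_def algebra_simps)
    then show "x \<in> (\<lambda>x. x + a) ` cube 0 l" by (intro image_eqI[of _ _ "x - a"]) auto
  qed
qed (auto simp: cube_def)

lemma cube_borel [measurable]: "cube a l \<in> sets borel"
proof -
  have "cube a l = (\<Inter>i. {x. a $ i \<le> x $ i} \<inter> {x. x $ i < a $ i + l})" by (auto simp: cube_def)
  also have "\<dots> \<in> sets borel"
    by (intro sets.countable_INT'' sets.Int borel_closed borel_open closed_Collect_le open_Collect_less continuous_intros) auto
  finally show ?thesis .
qed

lemma cube_subset_cbox: "cube a l \<subseteq> cbox a (a + (\<chi> i. l))"
  by (auto simp: cube_def mem_box_cart less_imp_le)

lemma box_subset_cube: "box a (a + (\<chi> i. l)) \<subseteq> cube a l"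
  by (auto simp: cube_def mem_box_cart less_imp_le)

lemma bounded_cube [simp]: "bounded (cube a l)"
  by (rule bounded_subset[OF bounded_cbox cube_subset_cbox])

lemma convex_cube: "convex (cube (a :: real^'n) l)"
proof -
  have "cube a l = (\<Inter>i. {x. a $ i \<le> x $ i} \<inter> {x. x $ i < a $ i + l})" by (auto simp: cube_def)
  moreover have "convex ((\<lambda>x :: real^'n. x $ i) -` S)" if "convex S" for i S
    using that by (intro convex_linear_vimage bounded_linear.linear bounded_linear_vec_nth)
  then have "convex {x :: real^'n. a $ i \<le> x $ i}" "convex {x :: real^'n. x $ i < a $ i + l}" for i
    using convex_real_interval(1)[of "a $ i"] convex_real_interval(4)[of "a $ i + l"]
    by (force simp: vimage_def)+
  ultimately show ?thesis by (auto intro!: convex_INT convex_Int)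
qed

text \<open>Squeezed between the open and the closed box, whose volumes agree.\<close>

lemma emeasure_cube:
  assumes "0 \<le> l"
  shows "emeasure lborel (cube (a :: real^'n) l) = ennreal (l ^ CARD('n))"
proof -
  let ?b = "a + (\<chi> i. l) :: real^'n"
  have inner: "(\<chi> i. l) \<bullet> b = l" if "b \<in> Basis" for b :: "real^'n"
    using that by (auto simp: Basis_vec_def inner_axis)
  have prod: "(\<Prod>b\<in>Basis. (?b - a) \<bullet> b) = l ^ CARD('n)"
    using inner by (simp add: prod_constant)
  have le: "a \<bullet> b \<le> ?b \<bullet> b" if "b \<in> Basis" for b
    using inner[OF that] assms by (simp add: inner_add_left)
  have "emeasure lborel (cube a l) \<le> emeasure lborel (cbox a ?b)"
    by (rule emeasure_mono[OF cube_subset_cbox]) simp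
  also have "\<dots> = ennreal (l ^ CARD('n))"
    using le by (simp only: emeasure_lborel_cbox prod)
  finally have 1: "emeasure lborel (cube a l) \<le> ennreal (l ^ CARD('n))" .
  have "ennreal (l ^ CARD('n)) = emeasure lborel (box a ?b)"
    using le by (simp only: emeasure_lborel_box prod)
  also have "\<dots> \<le> emeasure lborel (cube a l)"
    by (rule emeasure_mono[OF box_subset_cube]) simp
  finally show ?thesis using 1 by simp
qed

section \<open>Tilings of a cube by congruent cubes\<close>

definition tile_index :: "nat \<Rightarrow> ('n::finite \<Rightarrow> nat) set" where
  "tile_index n = (UNIV :: 'n set) \<rightarrow>\<^sub>E {..<n}"

lemma finite_tile_index [simp]: "finite (tile_index n)"
  by (auto simp: tile_index_def intro!: finite_PiE)

lemma card_tile_index: "card (tile_index n :: ('n::finite \<Rightarrow> nat) set) = n ^ CARD('n)"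
  by (simp add: tile_index_def card_PiE)

definition tile :: "real \<Rightarrow> ('n::finite \<Rightarrow> nat) \<Rightarrow> (real^'n) set" where
  "tile l j = cube (\<chi> i. l * real (j i)) l"

lemma tile_borel [measurable]: "tile l j \<in> sets borel"
  by (simp add: tile_def)

lemma disjoint_tiles:
  assumes "0 < l"
  shows "disjoint_family_on (tile l) T"
  unfolding disjoint_family_on_def
proof (intro ballI impI)
  fix j j' :: "'a \<Rightarrow> nat" assume "j \<noteq> j'"
  then obtain i where i: "j i \<noteq> j' i" by auto
  have "False" if x: "x \<in> tile l j" "x \<in> tile l j'" for x
  proof -
    have 1: "l * real (j i) \<le> x $ i" "x $ i < l * real (j i) + l" "l * real (j' i) \<le> x $ i" "x $ i < l * real (j' i) + l"
      using x by (auto simp: tile_def cube_def)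
    then have "l * real (j i) < l * (real (j' i) + 1)" "l * real (j' i) < l * (real (j i) + 1)"
      by (simp_all add: algebra_simps)
    then have "real (j i) < real (j' i) + 1" "real (j' i) < real (j i) + 1"
      using assms by simp_all
    then show False using i by linarith
  qed
  then show "tile l j \<inter> tile l j' = {}" by auto
qed

lemma cube_eq_Union_tiles:
  assumes "0 < l"
  shows "cube (0 :: real^'n) (l * real n) = (\<Union>j\<in>tile_index n. tile l j)"
proof
  show "cube (0 :: real^'n) (l * real n) \<subseteq> (\<Union>j\<in>tile_index n. tile l j)"
  proof
    fix x :: "real^'n" assume x: "x \<in> cube 0 (l * real n)"
    define j where "j i = nat \<lfloor>x $ i / l\<rfloor>" for i
    have x': "0 \<le> x $ i" "x $ i < l * real n" for i using x by (auto simp: cube_def)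
    have j: "real (j i) \<le> x $ i / l" "x $ i / l < real (j i) + 1" for i
      using x'(1)[of i] assms by (simp_all add: j_def of_nat_nat)
    have "l * real (j i) \<le> x $ i" "x $ i < l * real (j i) + l" for i
      using j[of i] assms by (simp_all add: field_simps)
    then have "x \<in> tile l j" by (simp add: tile_def cube_def)
    moreover have "j i < n" for i
    proof -
      have "x $ i / l < real n" using x'(2)[of i] assms by (simp add: field_simps)
      then have "real (j i) < real n" using j(1)[of i] by linarith
      then show ?thesis by simp
    qed
    then have "j \<in> tile_index n" by (auto simp: tile_index_def)
    ultimately show "x \<in> (\<Union>j\<in>tile_index n. tile l j)" by blast
  qed
  show "(\<Union>j\<in>tile_index n. tile l j) \<subseteq> cube (0 :: real^'n) (l * real n)"
  proof
    fix x :: "real^'n" assume "x \<in> (\<Union>j\<in>tile_index n. tile l j)"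
    then obtain j where j: "j \<in> tile_index n" "x \<in> tile l j" by blast
    have "0 \<le> x $ i \<and> x $ i < l * real n" for i
    proof -
      have "j i < n" using j(1) by (auto simp: tile_index_def PiE_def Pi_def)
      then have "real (j i) + 1 \<le> real n" by linarith
      then have "l * (real (j i) + 1) \<le> l * real n" using assms by simp
      moreover have "l * real (j i) \<le> x $ i" "x $ i < l * real (j i) + l"
        using j(2) by (auto simp: tile_def cube_def)
      moreover have "0 \<le> l * real (j i)" using assms by simp
      moreover have "l * (real (j i) + 1) = l * real (j i) + l" by (simp add: algebra_simps)
      ultimately show ?thesis by linarith
    qed
    then show "x \<in> cube 0 (l * real n)" by (simp add: cube_def)
  qed
qed

lemma inradius_cube:
  assumes "0 < r"
  shows "ennreal r \<le> inradius (cube (0 :: real^'n) (2 * r))"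
proof -
  have "ball (\<chi> i. r) r \<subseteq> cube (0 :: real^'n) (2 * r)"
  proof
    fix x :: "real^'n" assume "x \<in> ball (\<chi> i. r) r"
    then have "norm ((\<chi> i. r) - x) < r" by (simp add: dist_norm)
    then have "\<bar>((\<chi> i. r) - x) $ i\<bar> < r" for i
      using component_le_norm_cart[of "(\<chi> i. r) - x" i] by linarith
    then have "\<bar>r - x $ i\<bar> < r" for i by simp
    then have "0 \<le> x $ i \<and> x $ i < 2 * r" for i by (smt (verit))
    then show "x \<in> cube 0 (2 * r)" by (simp add: cube_def)
  qed
  then show ?thesis unfolding inradius_def using assms by (intro Sup_upper) blast
qed

text \<open>\<open>Suc n\<close> keeps the first cube nonempty, so no volume used for normalisation
  vanishes.\<close>

lemma convex_averaging_cubes: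
  assumes "0 < l"
  shows "convex_averaging (\<lambda>n. cube (0 :: real^'n) (l * real (Suc n)))"
  unfolding convex_averaging_def
proof (intro conjI allI impI)
  show "cube (0 :: real^'n) (l * real (Suc n)) \<subseteq> cube 0 (l * real (Suc m))" if "n \<le> m" for n m
  proof -
    have "l * real (Suc n) \<le> l * real (Suc m)" using that assms by simp
    then show ?thesis by (auto simp: cube_def intro: less_le_trans)
  qed
  show "(SUP n. inradius (cube (0 :: real^'n) (l * real (Suc n)))) = \<infinity>"
  proof -
    have "\<exists>n\<in>UNIV. of_nat k \<le> inradius (cube (0 :: real^'n) (l * real (Suc n)))" for k :: nat
    proof -
      obtain n where n: "2 * (real k + 1) / l \<le> real n" using real_arch_simple by blast
      then have "real k + 1 \<le> l * real (Suc n) / 2" using assms by (simp add: field_simps)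
      then have "ennreal (real k) \<le> ennreal (l * real (Suc n) / 2)" by (intro ennreal_leI) simp
      also have "\<dots> \<le> inradius (cube (0 :: real^'n) (2 * (l * real (Suc n) / 2)))"
        using assms by (intro inradius_cube) simp
      finally have "of_nat k \<le> inradius (cube (0 :: real^'n) (l * real (Suc n)))"
        by (simp add: ennreal_of_nat_eq_real_of_nat)
      then show ?thesis by blast
    qed
    then show ?thesis unfolding infinity_ennreal_def by (rule ennreal_SUP_eq_top)
  qed
qed (simp_all add: convex_cube cube_borel)

section \<open>Stationary marked point processes\<close>

locale stationary_process = prob_space P for P :: "'w measure" +
  fixes \<Phi> :: "'w \<Rightarrow> ((real^'n) \<times> 'm::{t2_space, second_countable_topology}) measure"
    and \<kappa> :: "((real^'n) \<times> 'm) set \<Rightarrow> ennreal"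
  assumes lc_marks: "locally_compact_space (euclidean :: 'm topology)"
    and marked: "marked_point_process P \<Phi>"
    and stat: "stationary P \<Phi>"
    and moments: "all_finite_moments P (\<lambda>\<omega>. ground (\<Phi> \<omega>))"
    and filtration: "filtration_function \<kappa>"
    and finite_kappa: "\<And>\<sigma>. finite \<sigma> \<Longrightarrow> \<sigma> \<noteq> {} \<Longrightarrow> \<kappa> \<sigma> < \<infinity>"
begin

abbreviation IM :: "((real^'n) \<times> 'm) measure measure" where
  "IM \<equiv> integer_measure_space UNIV"

abbreviation pts :: "(real^'n) set \<Rightarrow> 'w \<Rightarrow> ((real^'n) \<times> 'm) set" where
  "pts Q \<omega> \<equiv> atoms_in (Q \<times> UNIV) (\<Phi> \<omega>)"

lemma lc: "locally_compact_space (euclidean :: ((real^'n) \<times> 'm) topology)"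
  by (rule locally_compact_space_Times[OF lc_marks])

lemma kappa_weight: "finite_weight \<kappa>"
  using filtration finite_kappa by unfold_locales (auto simp: filtration_function_def)

lemma kappa_measurable: "measurable_on_finite_sets \<kappa>"
  using filtration by (simp add: filtration_function_def)

lemma kappa_shift: "\<sigma> \<noteq> {} \<Longrightarrow> finite \<sigma> \<Longrightarrow> \<kappa> ((\<lambda>(y, m). (y + x, m)) ` \<sigma>) = \<kappa> \<sigma>"
  using filtration by (simp add: filtration_function_def)

lemma Phi_measurable: "\<Phi> \<in> measurable P IM"
  using marked by (simp add: marked_point_process_def point_process_def)

lemma Phi_integer: "\<omega> \<in> space P \<Longrightarrow> \<Phi> \<omega> \<in> integer_measures UNIV"
  using measurable_space[OF Phi_measurable] by simp

lemma slab_borel: "Q \<in> sets borel \<Longrightarrow> Q \<times> (UNIV :: 'm set) \<in> sets borel"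
  by (intro borel_Times) auto

text \<open>The closure of a bounded set is compact, so the ground process is finite there. An atom
  has at most the mass of the fibre over its location, which simplicity of the ground process bounds
  by 1.\<close>

lemma AE_simple_on:
  assumes Q: "bounded Q" "Q \<in> sets borel"
  shows "AE \<omega> in P. \<Phi> \<omega> \<in> simple_on (Q \<times> UNIV)"
proof -
  have "AE \<omega> in P. ground (\<Phi> \<omega>) \<in> integer_measures UNIV" "AE \<omega> in P. \<forall>x. emeasure (ground (\<Phi> \<omega>)) {x} \<le> 1"
    using marked by (auto simp: marked_point_process_def simple_process_def)
  then show ?thesis
    using AE_space[of P]
  proof eventually_elim
    case (elim \<omega>)
    note i = Phi_integer[OF elim(3)]
    note s = integer_measures_sets[OF i]
    have "emeasure (\<Phi> \<omega>) (Q \<times> UNIV) = emeasure (ground (\<Phi> \<omega>)) Q" by (rule emeasure_ground[OF s Q(2), symmetric])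
    also have "\<dots> \<le> emeasure (ground (\<Phi> \<omega>)) (closure Q)"
      using closure_subset by (intro emeasure_mono) (auto simp: ground_def)
    also have "\<dots> < \<infinity>"
      using elim(1) Q(1) by (auto simp: integer_measures_def radon_measures_def compact_closure)
    finally have fin: "emeasure (\<Phi> \<omega>) (Q \<times> UNIV) < \<infinity>" .
    have "emeasure (\<Phi> \<omega>) {z} \<le> 1" for z
    proof -
      have "emeasure (\<Phi> \<omega>) {z} \<le> emeasure (\<Phi> \<omega>) ({fst z} \<times> UNIV)"
      proof (rule emeasure_mono)
        show "{z} \<subseteq> {fst z} \<times> UNIV" by (cases z) simp
        show "{fst z} \<times> UNIV \<in> sets (\<Phi> \<omega>)" unfolding s by (rule slab_borel) simp
      qed
      also have "\<dots> = emeasure (ground (\<Phi> \<omega>)) {fst z}" by (rule emeasure_ground[OF s, symmetric]) auto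
      also have "\<dots> \<le> 1" using elim(2) by blast
      finally show ?thesis .
    qed
    then show ?case using i fin by (simp add: simple_on_def)
  qed
qed

text \<open>A functional of the atoms is controlled only on the almost sure event
  \<open>simple_on\<close>. Cutting it off there gives a measurable version, on which additivity and
  monotone convergence of integrals are available.\<close>

lemma AE_measurable:
  fixes F :: "((real^'n) \<times> 'm) measure \<Rightarrow> ennreal"
  assumes Q: "bounded Q" "Q \<in> sets borel"
    and F: "F \<in> borel_measurable (restrict_space IM (simple_on (Q \<times> UNIV)))"
  obtains G where "G \<in> borel_measurable P" "AE \<omega> in P. F (\<Phi> \<omega>) = G \<omega>"
proof
  have s: "simple_on (Q \<times> UNIV) \<inter> space IM \<in> sets IM"
    by (intro sets.Int sets.top simple_on_measurable[OF lc slab_borel[OF Q(2)]])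
  have "(\<lambda>\<mu>. F \<mu> * indicator (simple_on (Q \<times> UNIV)) \<mu>) \<in> borel_measurable IM"
    using F by (simp add: borel_measurable_restrict_space_iff_ennreal[OF s])
  from measurable_compose[OF Phi_measurable this]
  show "(\<lambda>\<omega>. F (\<Phi> \<omega>) * indicator (simple_on (Q \<times> UNIV)) (\<Phi> \<omega>)) \<in> borel_measurable P" .
  show "AE \<omega> in P. F (\<Phi> \<omega>) = F (\<Phi> \<omega>) * indicator (simple_on (Q \<times> UNIV)) (\<Phi> \<omega>)"
    using AE_simple_on[OF Q] by eventually_elim simp
qed

lemma nn_integral_translate:
  assumes "G \<in> borel_measurable IM"
  shows "(\<integral>\<^sup>+\<omega>. G (translate_measure v (\<Phi> \<omega>)) \<partial>P) = (\<integral>\<^sup>+\<omega>. G (\<Phi> \<omega>) \<partial>P)"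
proof -
  have "(\<integral>\<^sup>+\<omega>. G (translate_measure v (\<Phi> \<omega>)) \<partial>P)
      = (\<integral>\<^sup>+\<mu>. G \<mu> \<partial>distr P IM (\<lambda>\<omega>. translate_measure v (\<Phi> \<omega>)))"
    by (rule nn_integral_distr[symmetric])
      (use assms measurable_compose[OF Phi_measurable measurable_translate_measure] in auto)
  also have "\<dots> = (\<integral>\<^sup>+\<mu>. G \<mu> \<partial>distr P IM \<Phi>)"
    using stat by (simp add: stationary_def)
  also have "\<dots> = (\<integral>\<^sup>+\<omega>. G (\<Phi> \<omega>) \<partial>P)"
    by (rule nn_integral_distr) (use assms Phi_measurable in auto)
  finally show ?thesis .
qed

text \<open>The atoms in a translated window are the translated atoms of the shifted measure;
  \<open>h\<close> ignores the translation and stationarity ignores the shift.\<close>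

lemma nn_integral_shift_pts:
  fixes h :: "((real^'n) \<times> 'm) set \<Rightarrow> ennreal"
  assumes Q: "bounded Q" "Q \<in> sets borel"
    and h: "(\<lambda>\<mu>. h (atoms_in (Q \<times> UNIV) \<mu>)) \<in> borel_measurable (restrict_space IM (simple_on (Q \<times> UNIV)))"
    and shift: "\<And>X. finite X \<Longrightarrow> h ((\<lambda>(x, m). (x + v, m)) ` X) = h X"
    and Q': "Q' = (\<lambda>x. x + v) ` Q" "Q' \<in> sets borel"
  shows "(\<integral>\<^sup>+\<omega>. h (pts Q' \<omega>) \<partial>P) = (\<integral>\<^sup>+\<omega>. h (pts Q \<omega>) \<partial>P)"
proof -
  let ?S = "simple_on (Q \<times> (UNIV :: 'm set))"
  let ?G = "\<lambda>\<mu>. h (atoms_in (Q \<times> UNIV) \<mu>) * indicator ?S \<mu>"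
  have s: "?S \<inter> space IM \<in> sets IM"
    by (intro sets.Int sets.top simple_on_measurable[OF lc slab_borel[OF Q(2)]])
  have G: "?G \<in> borel_measurable IM"
    using h by (simp add: borel_measurable_restrict_space_iff_ennreal[OF s])
  have "bounded Q'" unfolding Q'(1) using bounded_translation[OF Q(1), of v] by (simp add: add.commute)
  from AE_simple_on[OF this Q'(2)]
  have "AE \<omega> in P. h (pts Q' \<omega>) = ?G (translate_measure v (\<Phi> \<omega>))"
  proof eventually_elim
    case (elim \<omega>)
    then have "\<Phi> \<omega> \<in> integer_measures UNIV" by (simp add: simple_on_def)
    then have sets: "sets (\<Phi> \<omega>) = sets borel" by (rule integer_measures_sets)
    have simple: "translate_measure v (\<Phi> \<omega>) \<in> ?S"
      by (rule translate_simple_on) (use elim Q' slab_borel[OF Q(2)] in auto)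
    have "finite (atoms_in (Q \<times> UNIV) (translate_measure v (\<Phi> \<omega>)))"
      by (rule simple_onD(2)[OF simple slab_borel[OF Q(2)]])
    then show ?case
      unfolding Q'(1) atoms_in_translate[OF sets] using shift simple by simp
  qed
  then have "(\<integral>\<^sup>+\<omega>. h (pts Q' \<omega>) \<partial>P) = (\<integral>\<^sup>+\<omega>. ?G (translate_measure v (\<Phi> \<omega>)) \<partial>P)"
    by (rule nn_integral_cong_AE)
  also have "\<dots> = (\<integral>\<^sup>+\<omega>. ?G (\<Phi> \<omega>) \<partial>P)" by (rule nn_integral_translate[OF G])
  also have "\<dots> = (\<integral>\<^sup>+\<omega>. h (pts Q \<omega>) \<partial>P)"
  proof (rule nn_integral_cong_AE)
    show "AE \<omega> in P. ?G (\<Phi> \<omega>) = h (pts Q \<omega>)"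
      using AE_simple_on[OF Q] by eventually_elim simp
  qed
  finally show ?thesis .
qed

lemma tile_shift: "tile l j = (\<lambda>x. x + (\<chi> i. l * real (j i))) ` cube 0 l"
  unfolding tile_def by (rule cube_shift)

text \<open>A cube of integer side consists of unit tiles, each with the same expected count by
  stationarity.\<close>

lemma mean_count_cube:
  "(\<integral>\<^sup>+\<omega>. emeasure (\<Phi> \<omega>) (cube 0 (real L) \<times> UNIV) \<partial>P) = of_nat (L ^ CARD('n)) * intensity P \<Phi>"
proof -
  have meas: "(\<lambda>\<mu>. emeasure \<mu> (Q \<times> UNIV)) \<in> borel_measurable IM" if "Q \<in> sets borel" for Q :: "(real^'n) set"
    by (rule measurable_emeasure_integer_measure_space[OF lc slab_borel[OF that]])
  have unit: "(\<integral>\<^sup>+\<omega>. emeasure (\<Phi> \<omega>) (tile 1 j \<times> UNIV) \<partial>P) = intensity P \<Phi>" for j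
  proof -
    let ?v = "(\<chi> i. 1 * real (j i)) :: real^'n"
    have "(\<integral>\<^sup>+\<omega>. emeasure (\<Phi> \<omega>) (tile 1 j \<times> UNIV) \<partial>P)
       = (\<integral>\<^sup>+\<omega>. emeasure (translate_measure ?v (\<Phi> \<omega>)) (cube 0 1 \<times> UNIV) \<partial>P)"
    proof (rule nn_integral_cong)
      fix \<omega> assume "\<omega> \<in> space P"
      from integer_measures_sets[OF Phi_integer[OF this]]
      show "emeasure (\<Phi> \<omega>) (tile 1 j \<times> UNIV) = emeasure (translate_measure ?v (\<Phi> \<omega>)) (cube 0 1 \<times> UNIV)"
        by (subst emeasure_translate_measure) (simp_all add: slab_borel cube_borel shift_image_Times tile_shift)
    qed
    also have "\<dots> = (\<integral>\<^sup>+\<omega>. emeasure (\<Phi> \<omega>) (cube 0 1 \<times> UNIV) \<partial>P)"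
      by (rule nn_integral_translate[OF meas]) (rule cube_borel)
    also have "\<dots> = intensity P \<Phi>" by (simp add: intensity_def cube_def)
    finally show ?thesis .
  qed
  have "(\<integral>\<^sup>+\<omega>. emeasure (\<Phi> \<omega>) (cube 0 (real L) \<times> UNIV) \<partial>P)
     = (\<integral>\<^sup>+\<omega>. (\<Sum>j\<in>tile_index L. emeasure (\<Phi> \<omega>) (tile 1 j \<times> UNIV)) \<partial>P)"
  proof (rule nn_integral_cong)
    fix \<omega> assume "\<omega> \<in> space P"
    note s = integer_measures_sets[OF Phi_integer[OF this]]
    have eq: "cube (0 :: real^'n) (real L) \<times> (UNIV :: 'm set) = (\<Union>j\<in>tile_index L. tile 1 j \<times> UNIV)"
      using cube_eq_Union_tiles[of 1 L, where 'n = 'n] by auto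
    have "disjoint_family_on (\<lambda>j. tile 1 j \<times> (UNIV :: 'm set)) (tile_index L :: ('n \<Rightarrow> nat) set)"
      using disjoint_tiles[of 1 "tile_index L :: ('n \<Rightarrow> nat) set"] by (auto simp: disjoint_family_on_def)
    then show "emeasure (\<Phi> \<omega>) (cube 0 (real L) \<times> UNIV) = (\<Sum>j\<in>tile_index L. emeasure (\<Phi> \<omega>) (tile 1 j \<times> UNIV))"
      unfolding eq using s slab_borel[OF tile_borel] by (intro sum_emeasure[symmetric]) auto
  qed
  also have "\<dots> = (\<Sum>j\<in>(tile_index L :: ('n \<Rightarrow> nat) set). \<integral>\<^sup>+\<omega>. emeasure (\<Phi> \<omega>) (tile 1 j \<times> UNIV) \<partial>P)"
    by (rule nn_integral_sum) (rule measurable_compose[OF Phi_measurable meas[OF tile_borel]])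
  also have "\<dots> = of_nat (L ^ CARD('n)) * intensity P \<Phi>"
    by (simp add: unit card_tile_index)
  finally show ?thesis .
qed

lemma AE_card_pts:
  assumes Q: "bounded Q" "Q \<in> sets borel"
  shows "AE \<omega> in P. finite (pts Q \<omega>) \<and> of_nat (card (pts Q \<omega>)) = emeasure (\<Phi> \<omega>) (Q \<times> UNIV)"
  using AE_simple_on[OF Q]
proof eventually_elim
  case (elim \<omega>)
  then show ?case using simple_onD(2,4)[OF elim slab_borel[OF Q(2)]] by simp
qed

lemma moments_pts:
  assumes Q: "bounded Q" "Q \<in> sets borel" and k: "1 \<le> k"
  shows "(\<integral>\<^sup>+\<omega>. of_nat (card (pts Q \<omega>)) ^ k \<partial>P) < \<infinity>"
proof -
  have "(\<integral>\<^sup>+\<omega>. of_nat (card (pts Q \<omega>)) ^ k \<partial>P) = (\<integral>\<^sup>+\<omega>. emeasure (ground (\<Phi> \<omega>)) Q ^ k \<partial>P)"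
  proof (rule nn_integral_cong_AE)
    show "AE \<omega> in P. of_nat (card (pts Q \<omega>)) ^ k = emeasure (ground (\<Phi> \<omega>)) Q ^ k"
      using AE_card_pts[OF Q] AE_space[of P]
    proof eventually_elim
      case (elim \<omega>)
      then show ?case
        using emeasure_ground[OF integer_measures_sets[OF Phi_integer[OF elim(2)]] Q(2)] by simp
    qed
  qed
  also have "\<dots> < \<infinity>" using moments Q k by (auto simp: all_finite_moments_def)
  finally show ?thesis .
qed

lemma mean_card_cube:
  "(\<integral>\<^sup>+\<omega>. of_nat (card (pts (cube 0 (real L)) \<omega>)) \<partial>P) = of_nat (L ^ CARD('n)) * intensity P \<Phi>"
  unfolding mean_count_cube[symmetric]
  by (rule nn_integral_cong_AE) (use AE_card_pts[OF bounded_cube cube_borel] in auto)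

text \<open>The first moment of the unit cube; it lets the comparison with the limit be carried out
  in the reals.\<close>

lemma intensity_finite: "intensity P \<Phi> < \<infinity>"
  using moments_pts[of "cube 0 1" 1] mean_card_cube[of 1] by (simp add: cube_borel)

end

section \<open>Expected verbose diagrams\<close>

lemma cone_count_0 [simp]: "cone_count q 0 = 0"
  by (simp add: cone_count_def)

text \<open>With \<open>m = k - 1\<close> and \<open>d = q + 1 \<ge> 2\<close> one has
  \<open>m choose d \<ge> (m / d) ^ d \<ge> (m / d)\<^sup>2\<close> as soon as
  \<open>m \<ge> d\<close>, and \<open>(m / d)\<^sup>2 + (M * d)\<^sup>2 \<ge> 2 * M * m\<close>.
  The remaining terms of the constant cover small \<open>k\<close> and the step from
  \<open>m\<close> to \<open>k\<close>.\<close>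

lemma cone_count_superlinear:
  assumes "1 \<le> q"
  shows "M * k \<le> cone_count q k + ((M * (q + 1))\<^sup>2 + M * (q + 1) + M)"
proof (cases "k - 1 < q + 1")
  case True
  then have "k \<le> (q + 1) + 1" by simp
  then have "M * k \<le> M * ((q + 1) + 1)" by (rule mult_le_mono2)
  then show ?thesis by (simp add: algebra_simps)
next
  case False
  define m d where "m = k - 1" and "d = q + 1"
  have md: "d \<le> m" "2 \<le> d" "k = Suc m" using False assms by (auto simp: m_def d_def)
  have "(real m / real d)\<^sup>2 \<le> (real m / real d) ^ d"
    using md by (intro power_increasing) auto
  also have "\<dots> \<le> real (m choose d)"
    using md binomial_ge_n_over_k_pow_k[of d m, where 'a = real] by simp
  finally have "(real m / real d)\<^sup>2 \<le> real (m choose d)" .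
  moreover have "0 \<le> (real m / real d - real M * real d)\<^sup>2" by simp
  then have "2 * (real m / real d) * (real M * real d) \<le> (real m / real d)\<^sup>2 + (real M * real d)\<^sup>2"
    by (simp add: power2_diff)
  moreover have "2 * (real m / real d) * (real M * real d) = 2 * real M * real m" using md by simp
  moreover have "real M * real m \<ge> 0" by simp
  ultimately have "real M * real m \<le> real (m choose d) + (real M * real d)\<^sup>2" by linarith
  then have "real (M * k) \<le> real ((m choose d) + ((M * d)\<^sup>2 + M * d + M))"
  proof -
    have "real (M * k) = real M * real m + real M" using md(3) by (simp add: algebra_simps)
    moreover have "real ((m choose d) + ((M * d)\<^sup>2 + M * d + M))
        = real (m choose d) + (real M * real d)\<^sup>2 + real (M * d) + real M" by simp
    moreover have "0 \<le> real (M * d)" by (rule of_nat_0_le_iff)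
    ultimately show ?thesis using \<open>real M * real m \<le> _\<close> by linarith
  qed
  then have "M * k \<le> (m choose d) + ((M * d)\<^sup>2 + M * d + M)" by (simp only: of_nat_le_iff)
  then show ?thesis using assms by (simp add: cone_count_def m_def d_def)
qed

text \<open>A ramp from 1 at birth \<open>R\<close> down to 0 at birth \<open>R + 1\<close>. The
  birth is capped before \<open>enn2real\<close> is applied, because
  \<open>enn2real \<infinity> = 0\<close> would send the function back up to 1 there.\<close>

definition birth_cutoff :: "real \<Rightarrow> ennreal \<times> ennreal \<Rightarrow> real" where
  "birth_cutoff R p = min 1 (R + 1 - enn2real (min (fst p) (ennreal (R + 1))))"

definition birth_le :: "real \<Rightarrow> (ennreal \<times> ennreal) set" where
  "birth_le R = {p \<in> Delta'. fst p \<le> ennreal R}"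

text \<open>A bounded birth excludes the removed corner, so this is a closed subset of the compact
  square; deaths at \<infinity> are included.\<close>

lemma compact_birth_le: "compact (birth_le R)"
proof -
  have "birth_le R = {p :: ennreal \<times> ennreal. fst p \<le> snd p} \<inter> {p. fst p \<le> ennreal R}"
    by (auto simp: birth_le_def Delta'_def top_unique)
  moreover have "closed \<dots>"
    by (intro closed_Int closed_Collect_le continuous_intros)
  moreover have "compact (UNIV :: (ennreal \<times> ennreal) set)"
    using compact_Times[OF compact_UNIV compact_UNIV] by (simp add: UNIV_Times_UNIV)
  ultimately show ?thesis using compact_Int_closed by (metis inf_top_left)
qed

lemma birth_le_measurable: "birth_le R \<in> sets (restrict_space borel Delta')"
proof -
  have "birth_le R = Delta' \<inter> birth_le R" by (auto simp: birth_le_def)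
  then show ?thesis
    unfolding sets_restrict_space using borel_compact[OF compact_birth_le] by (rule image_eqI)
qed

lemma birth_cutoff_bounds:
  assumes "0 \<le> R"
  shows "0 \<le> birth_cutoff R p" "birth_cutoff R p \<le> 1"
    "fst p \<le> ennreal R \<Longrightarrow> birth_cutoff R p = 1"
    "birth_cutoff R p \<noteq> 0 \<Longrightarrow> fst p \<le> ennreal (R + 1)"
proof -
  have le: "enn2real (min (fst p) (ennreal (R + 1))) \<le> R + 1"
    using assms by (intro enn2real_leI) auto
  then show "0 \<le> birth_cutoff R p" by (simp add: birth_cutoff_def)
  show "birth_cutoff R p \<le> 1" by (simp add: birth_cutoff_def)
  show "birth_cutoff R p = 1" if "fst p \<le> ennreal R"
  proof -
    have "enn2real (min (fst p) (ennreal (R + 1))) \<le> R"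
      using assms that by (intro enn2real_leI) (auto intro: min.coboundedI1)
    then show ?thesis by (simp add: birth_cutoff_def)
  qed
  show "fst p \<le> ennreal (R + 1)" if "birth_cutoff R p \<noteq> 0"
  proof (rule ccontr)
    assume "\<not> fst p \<le> ennreal (R + 1)"
    then have "min (fst p) (ennreal (R + 1)) = ennreal (R + 1)" by (simp add: min_def)
    then show False using that assms by (simp add: birth_cutoff_def del: ennreal_plus)
  qed
qed

lemma continuous_birth_cutoff:
  assumes "0 \<le> R"
  shows "continuous_on UNIV (birth_cutoff R)"
proof -
  have "continuous_on UNIV (\<lambda>p :: ennreal \<times> ennreal. enn2real (min (fst p) (ennreal (R + 1))))"
  proof (rule continuous_on_compose2[of "{..ennreal (R + 1)}" enn2real])
    show "continuous_on {..ennreal (R + 1)} enn2real"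
      by (intro continuous_at_imp_continuous_on ballI)
        (auto simp: isCont_def intro!: tendsto_enn2real dest: le_less_trans[OF _ ennreal_less_top])
    show "continuous_on UNIV (\<lambda>p :: ennreal \<times> ennreal. min (fst p) (ennreal (R + 1)))"
      by (intro continuous_intros)
  qed auto
  then show ?thesis
    unfolding birth_cutoff_def[abs_def] by (intro continuous_intros)
qed

lemma birth_cutoff_cont_comp_supp:
  assumes "0 \<le> R"
  shows "birth_cutoff R \<in> cont_comp_supp Delta'"
proof -
  have sub: "closure {p \<in> Delta'. birth_cutoff R p \<noteq> 0} \<subseteq> birth_le (R + 1)"
    using birth_cutoff_bounds(4)[OF assms] compact_imp_closed[OF compact_birth_le]
    by (intro closure_minimal) (auto simp: birth_le_def)
  then have "Delta' \<inter> closure {p \<in> Delta'. birth_cutoff R p \<noteq> 0}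
     = birth_le (R + 1) \<inter> closure {p \<in> Delta'. birth_cutoff R p \<noteq> 0}"
    by (auto simp: birth_le_def)
  also have "compact \<dots>" by (rule compact_Int_closed[OF compact_birth_le closed_closure])
  finally show ?thesis
    using continuous_on_subset[OF continuous_birth_cutoff[OF assms]] by (simp add: cont_comp_supp_def)
qed

lemma birth_cutoff_measurable:
  assumes "0 \<le> R"
  shows "birth_cutoff R \<in> borel_measurable (restrict_space borel Delta')"
  by (rule measurable_restrict_space1[OF borel_measurable_continuous_onI[OF continuous_birth_cutoff[OF assms]]])

context stationary_process
begin

context
  fixes q :: nat
begin

definition dgm :: "'f::field itself \<Rightarrow> (real^'n) set \<Rightarrow> 'w \<Rightarrow> (ennreal \<times> ennreal) multiset" where
  "dgm F Q \<omega> = verbose_diagram F q (kappa_filtration \<kappa> (pts Q \<omega>))"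

text \<open>A Borel set of \<open>Delta'\<close> is the trace of a Borel set of the square, and
  almost surely the diagram has no points outside \<open>Delta'\<close>.\<close>

lemma dgm_count_measurable:
  assumes Q: "bounded Q" "Q \<in> sets borel" and A: "A \<in> sets (restrict_space borel Delta')"
  obtains G where "G \<in> borel_measurable P" "AE \<omega> in P. (\<Sum>p\<in>#dgm TYPE('f::field) Q \<omega>. indicator A p :: ennreal) = G \<omega>"
proof -
  interpret finite_weight \<kappa> by (rule kappa_weight)
  obtain B where B: "B \<in> sets borel" "A = Delta' \<inter> B"
    using A by (auto simp: sets_restrict_space)
  obtain G where G: "G \<in> borel_measurable P"
    "AE \<omega> in P. (\<Sum>p\<in>#verbose_diagram TYPE('f) q (kappa_filtration \<kappa> (pts Q \<omega>)). indicator B p :: ennreal) = G \<omega>"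
    using AE_measurable[OF Q measurable_verbose_count[OF lc slab_borel[OF Q(2)] kappa_weight kappa_measurable B(1)]]
    by blast
  have "AE \<omega> in P. (\<Sum>p\<in>#dgm TYPE('f) Q \<omega>. indicator A p :: ennreal) = G \<omega>"
    using G(2) AE_card_pts[OF Q]
  proof eventually_elim
    case (elim \<omega>)
    have "set_mset (dgm TYPE('f) Q \<omega>) \<subseteq> Delta'"
      unfolding dgm_def using verbose_diagram_subset_Delta' elim(2) by blast
    then have "(\<Sum>p\<in>#dgm TYPE('f) Q \<omega>. indicator A p :: ennreal) = (\<Sum>p\<in>#dgm TYPE('f) Q \<omega>. indicator B p)"
      by (intro arg_cong[where f = sum_mset] image_mset_cong) (auto simp: B(2) indicator_def)
    then show ?case using elim(1) by (simp add: dgm_def)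
  qed
  with G(1) show ?thesis by (rule that)
qed

text \<open>\<open>expected_measure\<close> is built with \<open>measure_of\<close>, so countable
  additivity has to be shown. The counts are only almost surely equal to measurable functions
  \<open>G i\<close>, for which sum and integral are exchanged.\<close>

lemma
  assumes Q: "bounded Q" "Q \<in> sets borel"
  shows sets_expected_measure: "sets (expected_measure P Delta' (verbose_process TYPE('f::field) \<kappa> q \<Phi> Q)) = sets (restrict_space borel Delta')"
    and emeasure_expected_measure: "A \<in> sets (restrict_space borel Delta') \<Longrightarrow>
      emeasure (expected_measure P Delta' (verbose_process TYPE('f) \<kappa> q \<Phi> Q)) A = (\<integral>\<^sup>+\<omega>. (\<Sum>p\<in>#dgm TYPE('f) Q \<omega>. indicator A p) \<partial>P)"
proof -
  let ?R = "restrict_space borel Delta'"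
  let ?E = "expected_measure P Delta' (verbose_process TYPE('f) \<kappa> q \<Phi> Q)"
  let ?cnt = "\<lambda>A \<omega>. \<Sum>p\<in>#dgm TYPE('f) Q \<omega>. indicator A p :: ennreal"
  have sp: "space ?R = Delta'" by (simp add: space_restrict_space)
  have sub: "sets ?R \<subseteq> Pow Delta'" using sets.space_closed[of ?R] by (simp add: sp)
  show sets: "sets ?E = sets ?R"
    unfolding expected_measure_def using sets_measure_of[OF sub] sets.sigma_sets_eq[of ?R] by (simp add: sp)
  have eq: "emeasure (verbose_process TYPE('f) \<kappa> q \<Phi> Q \<omega>) A = ?cnt A \<omega>" if "A \<in> sets ?R" for A \<omega>
    using emeasure_dirac_sum[OF that]
    by (simp add: verbose_process_def dgm_def points_in_def atoms_in_def)
  show "emeasure ?E A = (\<integral>\<^sup>+\<omega>. ?cnt A \<omega> \<partial>P)" if A: "A \<in> sets ?R" for A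
    unfolding eq[OF A, symmetric]
  proof (rule emeasure_measure_of[OF expected_measure_def sub])
    show "A \<in> sets ?E" using A sets by simp
    show "positive (sets ?E) (\<lambda>A. \<integral>\<^sup>+\<omega>. emeasure (verbose_process TYPE('f) \<kappa> q \<Phi> Q \<omega>) A \<partial>P)"
      by (simp add: positive_def)
    show "countably_additive (sets ?E) (\<lambda>A. \<integral>\<^sup>+\<omega>. emeasure (verbose_process TYPE('f) \<kappa> q \<Phi> Q \<omega>) A \<partial>P)"
      unfolding countably_additive_def sets
    proof (intro allI impI)
      fix B :: "nat \<Rightarrow> (ennreal \<times> ennreal) set"
      assume B: "range B \<subseteq> sets ?R" "disjoint_family B" "\<Union> (range B) \<in> sets ?R"
      have Bi: "B i \<in> sets ?R" for i using B(1) by auto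
      have "\<forall>i. \<exists>G. G \<in> borel_measurable P \<and> (AE \<omega> in P. ?cnt (B i) \<omega> = G \<omega>)"
        using dgm_count_measurable[OF Q Bi] by blast
      from choice[OF this] obtain G where G: "\<And>i. G i \<in> borel_measurable P"
        "\<And>i. AE \<omega> in P. ?cnt (B i) \<omega> = G i \<omega>" by blast
      have "suminf (\<lambda>i. \<integral>\<^sup>+\<omega>. ?cnt (B i) \<omega> \<partial>P) = suminf (\<lambda>i. \<integral>\<^sup>+\<omega>. G i \<omega> \<partial>P)"
        by (intro arg_cong[where f = suminf] ext nn_integral_cong_AE G)
      also have "\<dots> = (\<integral>\<^sup>+\<omega>. suminf (\<lambda>i. G i \<omega>) \<partial>P)"
        by (rule nn_integral_suminf[symmetric]) (rule G)
      also have "\<dots> = (\<integral>\<^sup>+\<omega>. ?cnt (\<Union> (range B)) \<omega> \<partial>P)"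
      proof (rule nn_integral_cong_AE)
        have "AE \<omega> in P. \<forall>i. ?cnt (B i) \<omega> = G i \<omega>" using G(2) by (simp add: AE_all_countable)
        then show "AE \<omega> in P. suminf (\<lambda>i. G i \<omega>) = ?cnt (\<Union> (range B)) \<omega>"
          by eventually_elim (simp add: sum_mset_indicator_UN[OF B(2)])
      qed
      finally show "suminf (\<lambda>i. \<integral>\<^sup>+\<omega>. emeasure (verbose_process TYPE('f) \<kappa> q \<Phi> Q \<omega>) (B i) \<partial>P)
          = (\<integral>\<^sup>+\<omega>. emeasure (verbose_process TYPE('f) \<kappa> q \<Phi> Q \<omega>) (\<Union> (range B)) \<partial>P)"
        by (simp add: eq[OF Bi] eq[OF B(3)])
    qed
  qed
qed

text \<open>Turns finite moments into finiteness of the expected diagram. In degree 0 the exponent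
  is 1 and the bound is the expected number of points.\<close>

lemma emeasure_expected_measure_le:
  assumes Q: "bounded Q" "Q \<in> sets borel"
  shows "emeasure (expected_measure P Delta' (verbose_process TYPE('f::field) \<kappa> q \<Phi> Q)) Delta'
    \<le> (\<integral>\<^sup>+\<omega>. of_nat (card (pts Q \<omega>)) ^ (q + 1) \<partial>P)"
proof -
  interpret finite_weight \<kappa> by (rule kappa_weight)
  have D: "Delta' \<in> sets (restrict_space borel Delta')"
    using sets.top[of "restrict_space borel Delta'"] by (simp add: space_restrict_space)
  have "(\<integral>\<^sup>+\<omega>. (\<Sum>p\<in>#dgm TYPE('f) Q \<omega>. indicator Delta' p) \<partial>P) \<le> (\<integral>\<^sup>+\<omega>. of_nat (card (pts Q \<omega>)) ^ (q + 1) \<partial>P)"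
  proof (rule nn_integral_mono_AE)
    show "AE \<omega> in P. (\<Sum>p\<in>#dgm TYPE('f) Q \<omega>. indicator Delta' p) \<le> (of_nat (card (pts Q \<omega>)) ^ (q + 1) :: ennreal)"
      using AE_card_pts[OF Q]
    proof eventually_elim
      case (elim \<omega>)
      have "size (filter_mset (\<lambda>p. p \<in> Delta') (dgm TYPE('f) Q \<omega>)) \<le> size (dgm TYPE('f) Q \<omega>)"
        by (rule size_filter_mset_lesseq)
      also have "\<dots> \<le> card (pts Q \<omega>) choose (q + 1)"
        unfolding dgm_def using elim by (intro size_verbose_diagram_le) auto
      also have "\<dots> \<le> card (pts Q \<omega>) ^ (q + 1)"
      proof (cases "q + 1 \<le> card (pts Q \<omega>)")
        case True
        then show ?thesis by (rule binomial_le_pow)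
      next
        case False
        then have zero: "card (pts Q \<omega>) choose (q + 1) = 0" by (intro binomial_eq_0) simp
        show ?thesis unfolding zero by (rule le0)
      qed
      finally have "of_nat (size (filter_mset (\<lambda>p. p \<in> Delta') (dgm TYPE('f) Q \<omega>))) \<le> (of_nat (card (pts Q \<omega>) ^ (q + 1)) :: ennreal)"
        by (simp only: of_nat_le_iff)
      then show ?case by (simp add: sum_mset_indicator_eq)
    qed
  qed
  then show ?thesis by (simp add: emeasure_expected_measure[OF Q D])
qed

text \<open>The empty set is excluded explicitly because \<open>\<kappa> {}\<close> is
  unconstrained.\<close>

definition cone_weight :: "real \<Rightarrow> ((real^'n) \<times> 'm) set \<Rightarrow> ennreal" where
  "cone_weight R X = (if X \<noteq> {} \<and> \<kappa> X \<le> ennreal R then of_nat (cone_count q (card X)) else 0)"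

lemma cone_weight_measurable:
  "Q \<in> sets borel \<Longrightarrow> (\<lambda>\<mu>. cone_weight R (atoms_in (Q \<times> UNIV) \<mu>)) \<in> borel_measurable (restrict_space IM (simple_on (Q \<times> UNIV)))"
  unfolding cone_weight_def
  by (rule measurable_cone_count[OF lc slab_borel kappa_measurable])

lemma cone_weight_shift:
  assumes "finite X" shows "cone_weight R ((\<lambda>(x, m). (x + v, m)) ` X) = cone_weight R X"
proof -
  have "inj_on (\<lambda>(x, m). (x + v, m)) X" by (auto simp: inj_on_def)
  then show ?thesis using assms by (cases "X = {}") (simp_all add: cone_weight_def kappa_shift card_image)
qed

text \<open>All tiles contribute the same expectation by stationarity, and
  \<open>verbose_births_ge\<close> adds the contributions within one configuration.\<close>

lemma emeasure_expected_measure_ge: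
  assumes l: "0 < l"
  shows "of_nat (n ^ CARD('n)) * (\<integral>\<^sup>+\<omega>. cone_weight R (pts (cube 0 l) \<omega>) \<partial>P)
    \<le> emeasure (expected_measure P Delta' (verbose_process TYPE('f::field) \<kappa> q \<Phi> (cube 0 (l * real n)))) (birth_le R)"
proof -
  interpret finite_weight \<kappa> by (rule kappa_weight)
  let ?Q = "cube 0 (l * real n) :: (real^'n) set"
  let ?J = "tile_index n :: ('n \<Rightarrow> nat) set"
  have "of_nat (n ^ CARD('n)) * (\<integral>\<^sup>+\<omega>. cone_weight R (pts (cube 0 l) \<omega>) \<partial>P)
      = (\<Sum>j\<in>?J. \<integral>\<^sup>+\<omega>. cone_weight R (pts (tile l j) \<omega>) \<partial>P)"
    by (simp add: card_tile_index nn_integral_shift_pts[OF bounded_cube cube_borel cone_weight_measurable[OF cube_borel]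
        cone_weight_shift tile_shift tile_borel])
  also have "\<dots> \<le> (\<integral>\<^sup>+\<omega>. (\<Sum>p\<in>#dgm TYPE('f) ?Q \<omega>. indicator (birth_le R) p) \<partial>P)"
  proof -
    have "\<forall>j. \<exists>G. G \<in> borel_measurable P \<and> (AE \<omega> in P. cone_weight R (pts (tile l j) \<omega>) = G \<omega>)"
    proof
      fix j :: "'n \<Rightarrow> nat"
      have "bounded (tile l j)" by (simp add: tile_def)
      then obtain G where "G \<in> borel_measurable P" "AE \<omega> in P. cone_weight R (pts (tile l j) \<omega>) = G \<omega>"
        by (rule AE_measurable[OF _ tile_borel cone_weight_measurable[OF tile_borel]])
      then show "\<exists>G. G \<in> borel_measurable P \<and> (AE \<omega> in P. cone_weight R (pts (tile l j) \<omega>) = G \<omega>)"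
        by (intro exI conjI)
    qed
    from choice[OF this] obtain G where G: "\<And>j. G j \<in> borel_measurable P"
      "\<And>j. AE \<omega> in P. cone_weight R (pts (tile l j) \<omega>) = G j \<omega>" by blast
    have "(\<Sum>j\<in>?J. \<integral>\<^sup>+\<omega>. cone_weight R (pts (tile l j) \<omega>) \<partial>P) = (\<Sum>j\<in>?J. \<integral>\<^sup>+\<omega>. G j \<omega> \<partial>P)"
      by (intro sum.cong refl nn_integral_cong_AE G)
    also have "\<dots> = (\<integral>\<^sup>+\<omega>. (\<Sum>j\<in>?J. G j \<omega>) \<partial>P)" by (rule nn_integral_sum[symmetric]) (rule G)
    also have "\<dots> \<le> (\<integral>\<^sup>+\<omega>. (\<Sum>p\<in>#dgm TYPE('f) ?Q \<omega>. indicator (birth_le R) p) \<partial>P)"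
    proof (rule nn_integral_mono_AE)
      have "AE \<omega> in P. \<forall>j\<in>?J. cone_weight R (pts (tile l j) \<omega>) = G j \<omega>"
        using G(2) by (simp add: AE_finite_all)
      with AE_card_pts[OF bounded_cube cube_borel, of 0 "l * real n"]
      show "AE \<omega> in P. (\<Sum>j\<in>?J. G j \<omega>) \<le> (\<Sum>p\<in>#dgm TYPE('f) ?Q \<omega>. indicator (birth_le R) p)"
      proof eventually_elim
        case (elim \<omega>)
        have fin: "finite (pts ?Q \<omega>)" using elim by simp
        have sub: "pts (tile l j) \<omega> \<subseteq> pts ?Q \<omega>" if "j \<in> ?J" for j
          using that cube_eq_Union_tiles[OF l, of n, where 'n = 'n] by (auto simp: atoms_in_def)
        have disj: "disjoint_family_on (\<lambda>j. pts (tile l j) \<omega>) ?J"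
          using disjoint_tiles[OF l, of ?J] by (fastforce simp: disjoint_family_on_def atoms_in_def)
        have "(\<Sum>j\<in>?J. G j \<omega>) = (\<Sum>j\<in>?J. cone_weight R (pts (tile l j) \<omega>))"
          using elim(2) by simp
        also have "\<dots> = of_nat (\<Sum>j\<in>?J. if pts (tile l j) \<omega> \<noteq> {} \<and> \<kappa> (pts (tile l j) \<omega>) \<le> ennreal R
            then cone_count q (card (pts (tile l j) \<omega>)) else 0)"
          unfolding of_nat_sum by (intro sum.cong) (auto simp: cone_weight_def)
        also have "\<dots> \<le> of_nat (size (filter_mset (\<lambda>p. fst p \<le> ennreal R) (dgm TYPE('f) ?Q \<omega>)))"
          unfolding of_nat_le_iff dgm_def by (rule verbose_births_ge[OF fin finite_tile_index sub disj])
        \<comment> \<open>The birth alone decides membership, as the diagram lies in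
          \<open>Delta'\<close>.\<close>
        also have "filter_mset (\<lambda>p. fst p \<le> ennreal R) (dgm TYPE('f) ?Q \<omega>) = filter_mset (\<lambda>p. p \<in> birth_le R) (dgm TYPE('f) ?Q \<omega>)"
          using verbose_diagram_subset_Delta'[OF fin, where 'f = 'f and q = q] unfolding dgm_def
          by (intro filter_mset_cong) (auto simp: birth_le_def)
        finally show ?case by (simp add: sum_mset_indicator_eq)
      qed
    qed
    finally show ?thesis .
  qed
  also have "\<dots> = emeasure (expected_measure P Delta' (verbose_process TYPE('f) \<kappa> q \<Phi> ?Q)) (birth_le R)"
    by (rule emeasure_expected_measure[OF bounded_cube cube_borel birth_le_measurable, symmetric])
  finally show ?thesis .
qed

end

end

section \<open>The limiting measure\<close>

context stationary_process
begin

text \<open>The lower bound does not depend on \<open>n\<close>, since the number of tiles is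
  proportional to the volume. The upper bound will be evaluated in degree 0.\<close>

lemma cutoff_scaled_expectation:
  fixes l R :: real and n q :: nat
  assumes l: "0 < l" and R: "0 \<le> R"
  defines "\<Lambda> \<equiv> cube (0 :: real^'n) (l * real (Suc n))"
  defines "\<mu> \<equiv> scale_measure (1 / emeasure lborel \<Lambda>) (expected_measure P Delta' (verbose_process TYPE('f::field) \<kappa> q \<Phi> \<Lambda>))"
  shows "(\<integral>\<^sup>+\<omega>. cone_weight q R (pts (cube 0 l) \<omega>) \<partial>P) / ennreal (l ^ CARD('n)) \<le> ennreal (integral\<^sup>L \<mu> (birth_cutoff R))"
    and "ennreal (integral\<^sup>L \<mu> (birth_cutoff R)) \<le>
      (\<integral>\<^sup>+\<omega>. of_nat (card (pts \<Lambda> \<omega>)) ^ (q + 1) \<partial>P) / ennreal ((l * real (Suc n)) ^ CARD('n))"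
proof -
  let ?E = "expected_measure P Delta' (verbose_process TYPE('f) \<kappa> q \<Phi> \<Lambda>)"
  let ?V = "(l * real (Suc n)) ^ CARD('n)"
  have bb: "bounded \<Lambda>" "\<Lambda> \<in> sets borel" by (simp_all add: \<Lambda>_def cube_borel)
  have Vpos: "0 < ?V" using l by simp
  have vol: "emeasure lborel \<Lambda> = ennreal ?V" unfolding \<Lambda>_def using l by (intro emeasure_cube) simp
  have sets: "sets ?E = sets (restrict_space borel Delta')" by (rule sets_expected_measure[OF bb])
  have space: "space ?E = Delta'"
    using sets_eq_imp_space_eq[OF sets] by (simp add: space_restrict_space)
  have meas: "birth_cutoff R \<in> borel_measurable ?E"
    using birth_cutoff_measurable[OF R] by (simp cong: measurable_cong_sets add: sets)
  have nn: "(\<integral>\<^sup>+p. ennreal (birth_cutoff R p) \<partial>\<mu>) = 1 / ennreal ?V * (\<integral>\<^sup>+p. ennreal (birth_cutoff R p) \<partial>?E)"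
    unfolding \<mu>_def vol by (rule nn_integral_scale_measure) (use meas in measurable)
  have "(\<integral>\<^sup>+p. ennreal (birth_cutoff R p) \<partial>?E) \<le> (\<integral>\<^sup>+p. 1 \<partial>?E)"
    using birth_cutoff_bounds(2)[OF R] by (intro nn_integral_mono) (simp add: ennreal_le_1)
  also have "\<dots> = emeasure ?E Delta'" by (simp add: space)
  also have "\<dots> \<le> (\<integral>\<^sup>+\<omega>. of_nat (card (pts \<Lambda> \<omega>)) ^ (q + 1) \<partial>P)"
    by (rule emeasure_expected_measure_le[OF bb])
  finally have upper: "(\<integral>\<^sup>+p. ennreal (birth_cutoff R p) \<partial>?E) \<le> (\<integral>\<^sup>+\<omega>. of_nat (card (pts \<Lambda> \<omega>)) ^ (q + 1) \<partial>P)" .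
  \<comment> \<open>Finite moments make the cutoff integrable, so the Bochner integral below is the
    true value and not the default 0.\<close>
  also have "\<dots> < \<infinity>" by (rule moments_pts[OF bb]) simp
  finally have finE: "(\<integral>\<^sup>+p. ennreal (birth_cutoff R p) \<partial>?E) < \<infinity>" .
  have "1 / ennreal ?V < \<infinity>" using Vpos by (simp add: divide_ennreal flip: ennreal_1)
  then have fin: "(\<integral>\<^sup>+p. ennreal (birth_cutoff R p) \<partial>\<mu>) < \<infinity>"
    unfolding nn using finE by (simp add: ennreal_mult_less_top)
  have "birth_cutoff R \<in> borel_measurable \<mu>"
    using meas by (simp cong: measurable_cong_sets add: \<mu>_def)
  then have int: "ennreal (integral\<^sup>L \<mu> (birth_cutoff R)) = (\<integral>\<^sup>+p. ennreal (birth_cutoff R p) \<partial>\<mu>)"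
    using fin birth_cutoff_bounds(1)[OF R] by (subst integral_eq_nn_integral) auto
  have "of_nat (Suc n ^ CARD('n)) * (\<integral>\<^sup>+\<omega>. cone_weight q R (pts (cube 0 l) \<omega>) \<partial>P) \<le> emeasure ?E (birth_le R)"
    unfolding \<Lambda>_def by (rule emeasure_expected_measure_ge[OF l])
  also have "\<dots> = (\<integral>\<^sup>+p. indicator (birth_le R) p \<partial>?E)"
    using birth_le_measurable by (simp add: sets)
  also have "\<dots> \<le> (\<integral>\<^sup>+p. ennreal (birth_cutoff R p) \<partial>?E)"
    using birth_cutoff_bounds(3)[OF R] by (intro nn_integral_mono) (auto simp: indicator_def birth_le_def)
  finally have ge: "1 / ennreal ?V * (of_nat (Suc n ^ CARD('n)) * (\<integral>\<^sup>+\<omega>. cone_weight q R (pts (cube 0 l) \<omega>) \<partial>P))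
     \<le> ennreal (integral\<^sup>L \<mu> (birth_cutoff R))"
    unfolding int nn by (rule mult_left_mono) simp
  have vol_eq: "1 / ennreal ?V * of_nat (Suc n ^ CARD('n)) = 1 / ennreal (l ^ CARD('n))"
  proof -
    have "1 / ennreal ?V * of_nat (Suc n ^ CARD('n)) = ennreal (1 / ?V * real (Suc n ^ CARD('n)))"
    proof -
      have "1 / ennreal ?V = ennreal (1 / ?V)" using divide_ennreal[of 1 ?V] Vpos by simp
      then show ?thesis
        using Vpos by (simp only: ennreal_of_nat_eq_real_of_nat) (intro ennreal_mult[symmetric], auto)
    qed
    also have "1 / ?V * real (Suc n ^ CARD('n)) = 1 / l ^ CARD('n)"
      using l by (simp add: power_mult_distrib)
    also have "ennreal (1 / l ^ CARD('n)) = 1 / ennreal (l ^ CARD('n))"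
      using l by (simp add: divide_ennreal flip: ennreal_1)
    finally show ?thesis .
  qed
  show "(\<integral>\<^sup>+\<omega>. cone_weight q R (pts (cube 0 l) \<omega>) \<partial>P) / ennreal (l ^ CARD('n)) \<le> ennreal (integral\<^sup>L \<mu> (birth_cutoff R))"
  proof -
    have "1 / c * x = x / c" for c x :: ennreal by (simp add: divide_ennreal_def mult.commute)
    then show ?thesis using ge vol_eq by (metis mult.assoc)
  qed
  show "ennreal (integral\<^sup>L \<mu> (birth_cutoff R)) \<le> (\<integral>\<^sup>+\<omega>. of_nat (card (pts \<Lambda> \<omega>)) ^ (q + 1) \<partial>P) / ennreal ?V"
    unfolding int nn using upper by (simp add: ennreal_divide_times mult.commute ennreal_times_divide divide_right_mono_ennreal)
qed

lemma cutoff_limit: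
  assumes lim: "limiting_verbose_measure TYPE('f::field) P \<Phi> \<kappa> q \<nu>" and l: "0 < l" and R: "0 \<le> R"
  shows "(\<lambda>n. integral\<^sup>L (scale_measure (1 / emeasure lborel (cube (0 :: real^'n) (l * real (Suc n))))
      (expected_measure P Delta' (verbose_process TYPE('f) \<kappa> q \<Phi> (cube (0 :: real^'n) (l * real (Suc n))))))
      (birth_cutoff R)) \<longlonglongrightarrow> integral\<^sup>L \<nu> (birth_cutoff R)"
  using lim convex_averaging_cubes[OF l, where 'n = 'n] birth_cutoff_cont_comp_supp[OF R]
  unfolding limiting_verbose_measure_def vague_conv_def by blast

text \<open>The cutoff vanishes outside the compact set \<open>birth_le (R + 1)\<close>, which has
  finite mass under a Radon measure; so its integral is a true value between two masses.\<close>

lemma cutoff_integral_nu: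
  assumes \<nu>: "\<nu> \<in> radon_measures Delta'" and R: "0 \<le> R"
  shows "ennreal (integral\<^sup>L \<nu> (birth_cutoff R)) = (\<integral>\<^sup>+p. ennreal (birth_cutoff R p) \<partial>\<nu>)"
    and "emeasure \<nu> (birth_le R) \<le> ennreal (integral\<^sup>L \<nu> (birth_cutoff R))"
    and "ennreal (integral\<^sup>L \<nu> (birth_cutoff R)) \<le> emeasure \<nu> Delta'"
proof -
  have sets: "sets \<nu> = sets (restrict_space borel Delta')" using \<nu> by (simp add: radon_measures_def)
  have space: "space \<nu> = Delta'" using sets_eq_imp_space_eq[OF sets] by (simp add: space_restrict_space)
  have meas: "birth_cutoff R \<in> borel_measurable \<nu>"
    using birth_cutoff_measurable[OF R] by (simp cong: measurable_cong_sets add: sets)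
  have "(\<integral>\<^sup>+p. ennreal (birth_cutoff R p) \<partial>\<nu>) \<le> (\<integral>\<^sup>+p. indicator (birth_le (R + 1)) p \<partial>\<nu>)"
  proof (rule nn_integral_mono)
    fix p assume "p \<in> space \<nu>"
    then show "ennreal (birth_cutoff R p) \<le> indicator (birth_le (R + 1)) p"
      using birth_cutoff_bounds(2,4)[OF R, of p]
      by (cases "birth_cutoff R p = 0") (simp_all add: birth_le_def space ennreal_le_1)
  qed
  also have "\<dots> = emeasure \<nu> (birth_le (R + 1))"
    using birth_le_measurable by (simp add: sets)
  also have "\<dots> < \<infinity>"
    using \<nu> compact_birth_le[of "R + 1"] by (auto simp: radon_measures_def birth_le_def)
  finally have fin: "(\<integral>\<^sup>+p. ennreal (birth_cutoff R p) \<partial>\<nu>) < \<infinity>" .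
  show int: "ennreal (integral\<^sup>L \<nu> (birth_cutoff R)) = (\<integral>\<^sup>+p. ennreal (birth_cutoff R p) \<partial>\<nu>)"
    using fin birth_cutoff_bounds(1)[OF R] meas by (subst integral_eq_nn_integral) auto
  have "emeasure \<nu> (birth_le R) = (\<integral>\<^sup>+p. indicator (birth_le R) p \<partial>\<nu>)"
    using birth_le_measurable by (simp add: sets)
  also have "\<dots> \<le> (\<integral>\<^sup>+p. ennreal (birth_cutoff R p) \<partial>\<nu>)"
    using birth_cutoff_bounds(3)[OF R] by (intro nn_integral_mono) (auto simp: indicator_def birth_le_def)
  finally show "emeasure \<nu> (birth_le R) \<le> ennreal (integral\<^sup>L \<nu> (birth_cutoff R))" unfolding int .
  have "(\<integral>\<^sup>+p. ennreal (birth_cutoff R p) \<partial>\<nu>) \<le> (\<integral>\<^sup>+p. 1 \<partial>\<nu>)"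
    using birth_cutoff_bounds(2)[OF R] by (intro nn_integral_mono) (simp add: ennreal_le_1)
  then show "ennreal (integral\<^sup>L \<nu> (birth_cutoff R)) \<le> emeasure \<nu> Delta'"
    unfolding int by (simp add: space)
qed

section \<open>Removing the cutoff and bounding the total mass of the limit\<close>

lemma SUP_cone_weight:
  assumes "finite X"
  shows "(SUP k. cone_weight q (real k) X) = of_nat (cone_count q (card X))"
proof (cases "X = {}")
  case False
  \<comment> \<open>Finiteness of \<kappa> is needed again: a set of infinite weight would be
    counted at no cutoff.\<close>
  then have "\<kappa> X < \<infinity>" using assms finite_kappa by simp
  then have eq: "\<kappa> X = ennreal (enn2real (\<kappa> X))" by simp
  obtain k where k: "enn2real (\<kappa> X) \<le> real k" using real_arch_simple by blast
  have "\<kappa> X \<le> ennreal (real k)" by (subst eq) (rule ennreal_leI[OF k])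
  then have "cone_weight q (real k) X = of_nat (cone_count q (card X))" using False by (simp add: cone_weight_def)
  then have "of_nat (cone_count q (card X)) \<le> (SUP k. cone_weight q (real k) X)" by (metis SUP_upper UNIV_I)
  moreover have "(SUP k. cone_weight q (real k) X) \<le> of_nat (cone_count q (card X))"
    by (intro SUP_least) (simp add: cone_weight_def)
  ultimately show ?thesis by (rule antisym[rotated])
qed (simp add: cone_weight_def)

text \<open>Monotone convergence, applied to measurable versions \<open>G k\<close> on a common
  almost sure event.\<close>

lemma SUP_mean_cone_weight:
  assumes Q: "bounded Q" "Q \<in> sets borel"
  shows "(SUP k. \<integral>\<^sup>+\<omega>. cone_weight q (real k) (pts Q \<omega>) \<partial>P) = (\<integral>\<^sup>+\<omega>. of_nat (cone_count q (card (pts Q \<omega>))) \<partial>P)"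
proof -
  have "\<forall>k. \<exists>G. G \<in> borel_measurable P \<and> (AE \<omega> in P. cone_weight q (real k) (pts Q \<omega>) = G \<omega>)"
  proof
    fix k
    obtain G where "G \<in> borel_measurable P" "AE \<omega> in P. cone_weight q (real k) (pts Q \<omega>) = G \<omega>"
      by (rule AE_measurable[OF Q cone_weight_measurable[OF Q(2)]])
    then show "\<exists>G. G \<in> borel_measurable P \<and> (AE \<omega> in P. cone_weight q (real k) (pts Q \<omega>) = G \<omega>)"
      by (intro exI conjI)
  qed
  from choice[OF this] obtain G where G: "\<And>k. G k \<in> borel_measurable P"
    "\<And>k. AE \<omega> in P. cone_weight q (real k) (pts Q \<omega>) = G k \<omega>" by blast
  have all: "AE \<omega> in P. \<forall>k. cone_weight q (real k) (pts Q \<omega>) = G k \<omega>" using G(2) by (simp add: AE_all_countable)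
  have mono: "cone_weight q (real k) X \<le> cone_weight q (real (Suc k)) X" for k X
  proof -
    have "ennreal (real k) \<le> ennreal (real (Suc k))" by (intro ennreal_leI) simp
    then have "\<kappa> X \<le> ennreal (real k) \<Longrightarrow> \<kappa> X \<le> ennreal (real (Suc k))" by (rule order_trans[rotated])
    then show ?thesis by (simp add: cone_weight_def del: of_nat_Suc)
  qed
  have "(SUP k. \<integral>\<^sup>+\<omega>. cone_weight q (real k) (pts Q \<omega>) \<partial>P) = (SUP k. \<integral>\<^sup>+\<omega>. G k \<omega> \<partial>P)"
    by (intro SUP_cong refl nn_integral_cong_AE G)
  also have "\<dots> = (\<integral>\<^sup>+\<omega>. (SUP k. G k \<omega>) \<partial>P)"
  proof (rule nn_integral_monotone_convergence_SUP_AE[symmetric])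
    show "AE \<omega> in P. G k \<omega> \<le> G (Suc k) \<omega>" for k
      using all by eventually_elim (metis mono)
  qed (rule G)
  also have "\<dots> = (\<integral>\<^sup>+\<omega>. of_nat (cone_count q (card (pts Q \<omega>))) \<partial>P)"
  proof (rule nn_integral_cong_AE)
    show "AE \<omega> in P. (SUP k. G k \<omega>) = of_nat (cone_count q (card (pts Q \<omega>)))"
      using all AE_card_pts[OF Q]
    proof eventually_elim
      case (elim \<omega>)
      have "(SUP k. G k \<omega>) = (SUP k. cone_weight q (real k) (pts Q \<omega>))" using elim(1) by simp
      then show ?case using SUP_cone_weight elim(2) by simp
    qed
  qed
  finally show ?thesis .
qed

text \<open>For a fixed cutoff the bound of \<open>cutoff_scaled_expectation\<close> is constant in
  \<open>n\<close> and passes to the vague limit; the cutoff is then removed by monotone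
  convergence. The side \<open>l\<close> remains free.\<close>

lemma nu_ge_mean_cone_count:
  assumes lim: "limiting_verbose_measure TYPE('f::field) P \<Phi> \<kappa> q \<nu>" and l: "0 < l"
  shows "(\<integral>\<^sup>+\<omega>. of_nat (cone_count q (card (pts (cube 0 l) \<omega>))) \<partial>P) / ennreal (l ^ CARD('n)) \<le> emeasure \<nu> Delta'"
proof -
  have \<nu>: "\<nu> \<in> radon_measures Delta'" using lim by (simp add: limiting_verbose_measure_def)
  have lower: "(\<integral>\<^sup>+\<omega>. cone_weight q (real k) (pts (cube 0 l) \<omega>) \<partial>P) / ennreal (l ^ CARD('n)) \<le> emeasure \<nu> Delta'" for k
  proof -
    let ?c = "(\<integral>\<^sup>+\<omega>. cone_weight q (real k) (pts (cube 0 l) \<omega>) \<partial>P) / ennreal (l ^ CARD('n))"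
    let ?X = "\<lambda>n. integral\<^sup>L (scale_measure (1 / emeasure lborel (cube (0 :: real^'n) (l * real (Suc n))))
      (expected_measure P Delta' (verbose_process TYPE('f) \<kappa> q \<Phi> (cube (0 :: real^'n) (l * real (Suc n))))))
      (birth_cutoff (real k))"
    have c: "?c \<le> ennreal (?X n)" for n
      by (rule cutoff_scaled_expectation(1)[OF l]) simp
    then have "?c < \<infinity>" by (rule le_less_trans) simp
    have X0: "0 \<le> ?X n" for n
      by (intro integral_nonneg_AE AE_I2 birth_cutoff_bounds(1)) simp
    have "enn2real ?c \<le> ?X n" for n
      using enn2real_leI[OF X0 c] .
    then have "enn2real ?c \<le> integral\<^sup>L \<nu> (birth_cutoff (real k))"
      by (intro LIMSEQ_le_const[OF cutoff_limit[OF lim l]]) auto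
    then have "ennreal (enn2real ?c) \<le> ennreal (integral\<^sup>L \<nu> (birth_cutoff (real k)))"
      by (rule ennreal_leI)
    also have "\<dots> \<le> emeasure \<nu> Delta'" by (rule cutoff_integral_nu(3)[OF \<nu>]) simp
    finally show ?thesis using \<open>?c < \<infinity>\<close> by simp
  qed
  have "(SUP k. \<integral>\<^sup>+\<omega>. cone_weight q (real k) (pts (cube 0 l) \<omega>) \<partial>P) / ennreal (l ^ CARD('n)) \<le> emeasure \<nu> Delta'"
    unfolding SUP_divide_ennreal by (rule SUP_least) (rule lower)
  then show ?thesis by (simp only: SUP_mean_cone_weight[OF bounded_cube cube_borel])
qed

text \<open>For cubes of integer side the normalised expected number of points equals the intensity
  for every \<open>n\<close>, so the bound survives the limit at each cutoff.\<close>

lemma nu_degree_0_le: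
  assumes lim: "limiting_verbose_measure TYPE('f::field) P \<Phi> \<kappa> 0 \<nu>"
  shows "emeasure \<nu> Delta' \<le> intensity P \<Phi>"
proof -
  have \<nu>: "\<nu> \<in> radon_measures Delta'" using lim by (simp add: limiting_verbose_measure_def)
  have sets: "sets \<nu> = sets (restrict_space borel Delta')" using \<nu> by (simp add: radon_measures_def)
  have upper: "emeasure \<nu> (birth_le (real k)) \<le> intensity P \<Phi>" for k
  proof -
    let ?X = "\<lambda>n. integral\<^sup>L (scale_measure (1 / emeasure lborel (cube (0 :: real^'n) (1 * real (Suc n))))
      (expected_measure P Delta' (verbose_process TYPE('f) \<kappa> 0 \<Phi> (cube (0 :: real^'n) (1 * real (Suc n))))))
      (birth_cutoff (real k))"
    have "?X n \<le> enn2real (intensity P \<Phi>)" for n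
    proof -
      let ?V = "real (Suc n) ^ CARD('n)"
      have V: "0 < ?V" by simp
      have "ennreal (?X n) \<le> (\<integral>\<^sup>+\<omega>. of_nat (card (pts (cube 0 (1 * real (Suc n))) \<omega>)) ^ (0 + 1) \<partial>P) / ennreal ((1 * real (Suc n)) ^ CARD('n))"
        by (rule cutoff_scaled_expectation(2)) simp_all
      also have "\<dots> = of_nat (Suc n ^ CARD('n)) * intensity P \<Phi> / ennreal ?V"
        unfolding mean_card_cube[symmetric] by simp
      also have "of_nat (Suc n ^ CARD('n)) = ennreal ?V"
        unfolding of_nat_power[symmetric] by (rule ennreal_of_nat_eq_real_of_nat)
      also have "ennreal ?V * intensity P \<Phi> / ennreal ?V = intensity P \<Phi>"
        using V by (subst mult.commute, intro mult_divide_eq_ennreal) (auto simp del: of_nat_Suc)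
      finally have "ennreal (?X n) \<le> intensity P \<Phi>" .
      then have "enn2real (ennreal (?X n)) \<le> enn2real (intensity P \<Phi>)"
        using intensity_finite by (intro enn2real_mono) auto
      moreover have "0 \<le> ?X n" by (intro integral_nonneg_AE AE_I2 birth_cutoff_bounds(1)) simp
      then have "enn2real (ennreal (?X n)) = ?X n" by (rule enn2real_ennreal)
      ultimately show ?thesis by simp
    qed
    moreover have "?X \<longlonglongrightarrow> integral\<^sup>L \<nu> (birth_cutoff (real k))" by (rule cutoff_limit[OF lim]) simp_all
    ultimately have "integral\<^sup>L \<nu> (birth_cutoff (real k)) \<le> enn2real (intensity P \<Phi>)"
      by (intro LIMSEQ_le_const2) auto
    then have "ennreal (integral\<^sup>L \<nu> (birth_cutoff (real k))) \<le> ennreal (enn2real (intensity P \<Phi>))"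
      by (rule ennreal_leI)
    also have "ennreal (enn2real (intensity P \<Phi>)) = intensity P \<Phi>"
      using intensity_finite by simp
    finally show ?thesis using cutoff_integral_nu(2)[OF \<nu>, of "real k"] by (auto intro: order_trans)
  qed
  \<comment> \<open>An infinite birth would force an infinite death and thus the removed corner, so
    bounded births exhaust \<open>Delta'\<close>.\<close>
  have "Delta' = (\<Union>k::nat. birth_le (real k))"
  proof
    show "Delta' \<subseteq> (\<Union>k::nat. birth_le (real k))"
    proof
      fix p assume p: "p \<in> Delta'"
      then have "fst p < \<infinity>" by (auto simp: Delta'_def less_top[symmetric] top_unique)
      then have eq: "fst p = ennreal (enn2real (fst p))" by simp
      obtain k where k: "enn2real (fst p) \<le> real k" using real_arch_simple by blast
      have "fst p \<le> ennreal (real k)" by (subst eq) (rule ennreal_leI[OF k])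
      then show "p \<in> (\<Union>k::nat. birth_le (real k))" using p by (auto simp: birth_le_def)
    qed
  qed (auto simp: birth_le_def)
  also have "emeasure \<nu> \<dots> = (SUP k. emeasure \<nu> (birth_le (real k)))"
  proof (rule SUP_emeasure_incseq[symmetric])
    show "range (\<lambda>k. birth_le (real k)) \<subseteq> sets \<nu>" using birth_le_measurable by (auto simp: sets)
    show "incseq (\<lambda>k. birth_le (real k))"
    proof (rule incseq_SucI)
      fix k
      have "ennreal (real k) \<le> ennreal (real (Suc k))" by (intro ennreal_leI) simp
      then show "birth_le (real k) \<le> birth_le (real (Suc k))"
        unfolding birth_le_def by (intro Collect_mono) (metis order_trans)
    qed
  qed
  also have "\<dots> \<le> intensity P \<Phi>" using upper by (rule SUP_least)
  finally show ?thesis .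
qed

text \<open>In degree 0 \<open>cone_count\<close> is the number of points, so the lower bound at
  \<open>l = 1\<close> is already the intensity.\<close>

lemma nu_degree_0:
  assumes lim: "limiting_verbose_measure TYPE('f::field) P \<Phi> \<kappa> 0 \<nu>"
  shows "emeasure \<nu> Delta' = intensity P \<Phi>"
proof (rule antisym)
  show "emeasure \<nu> Delta' \<le> intensity P \<Phi>" by (rule nu_degree_0_le[OF lim])
  show "intensity P \<Phi> \<le> emeasure \<nu> Delta'"
    using nu_ge_mean_cone_count[OF lim, of 1] mean_card_cube[of 1]
    by (simp add: cone_count_def divide_ennreal_def)
qed

text \<open>If the mass were a finite \<open>v\<close>, the linear bounds on
  \<open>cone_count\<close> would give \<open>M * lam \<le> v + C / L\<close> for cubes of every
  side \<open>L\<close>. Large cubes remove \<open>C\<close>, and a large slope \<open>M\<close>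
  then contradicts \<open>lam > 0\<close>.\<close>

lemma nu_positive_degree:
  assumes lim: "limiting_verbose_measure TYPE('f::field) P \<Phi> \<kappa> q \<nu>" and q: "1 \<le> q"
    and pos: "0 < intensity P \<Phi>"
  shows "emeasure \<nu> Delta' = \<infinity>"
proof (rule ccontr)
  assume "emeasure \<nu> Delta' \<noteq> \<infinity>"
  then obtain v where v: "emeasure \<nu> Delta' = ennreal v" "0 \<le> v"
    by (cases "emeasure \<nu> Delta'") auto
  obtain lam where lam: "intensity P \<Phi> = ennreal lam" "0 < lam"
    using intensity_finite pos by (cases "intensity P \<Phi>") auto
  have bound: "real M * lam \<le> v" for M
  proof -
    \<comment> \<open>The additive constant of \<open>cone_count_superlinear\<close> for slope
      \<open>M\<close>; it does not grow with the cube.\<close>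
    define C where "C = (M * (q + 1))\<^sup>2 + M * (q + 1) + M"
    have step: "real M * lam \<le> v + real C / real (Suc L)" for L
    proof -
      let ?l = "real (Suc L)" and ?V = "real (Suc L) ^ CARD('n)"
      let ?n = "\<lambda>\<omega>. card (pts (cube 0 ?l) \<omega>)"
      have V: "0 < ?V" by simp
      obtain G where G: "G \<in> borel_measurable P" "AE \<omega> in P. emeasure (\<Phi> \<omega>) (cube 0 ?l \<times> UNIV) = G \<omega>"
        using AE_measurable[OF bounded_cube cube_borel, of "\<lambda>\<mu>. emeasure \<mu> (cube 0 ?l \<times> UNIV)" 0 ?l]
          measurable_restrict_space1[OF measurable_emeasure_integer_measure_space[OF lc slab_borel[OF cube_borel]]]
        by blast
      have G': "AE \<omega> in P. of_nat (?n \<omega>) = G \<omega>"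
        using AE_card_pts[OF bounded_cube cube_borel, of 0 ?l] G(2) by eventually_elim simp
      have "of_nat M * (of_nat (Suc L ^ CARD('n)) * intensity P \<Phi>) = of_nat M * (\<integral>\<^sup>+\<omega>. G \<omega> \<partial>P)"
        unfolding mean_card_cube[symmetric] by (intro arg_cong[where f = "(*) (of_nat M)"] nn_integral_cong_AE G')
      also have "\<dots> = (\<integral>\<^sup>+\<omega>. of_nat M * G \<omega> \<partial>P)" using G(1) by (rule nn_integral_cmult[symmetric])
      also have "\<dots> = (\<integral>\<^sup>+\<omega>. of_nat (M * ?n \<omega>) \<partial>P)"
        by (rule nn_integral_cong_AE) (use G' in \<open>eventually_elim, simp\<close>)
      also have "\<dots> \<le> (\<integral>\<^sup>+\<omega>. of_nat (cone_count q (?n \<omega>)) + of_nat C \<partial>P)"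
        using cone_count_superlinear[OF q, of M] unfolding C_def of_nat_add[symmetric]
        by (intro nn_integral_mono) (simp only: of_nat_le_iff)
      also have "\<dots> = (\<integral>\<^sup>+\<omega>. of_nat (cone_count q (?n \<omega>)) \<partial>P) + of_nat C"
      proof -
        \<comment> \<open>Splitting the integral of a sum needs measurability, which is at hand for
          \<open>G\<close>; \<open>f\<close> recovers the cone count from the number of points given
          as an extended real.\<close>
        define f :: "ennreal \<Rightarrow> ennreal" where "f x = of_nat (cone_count q (nat \<lfloor>enn2real x\<rfloor>))" for x
        have f: "f (of_nat n) = of_nat (cone_count q n)" for n
          by (simp add: f_def ennreal_of_nat_eq_real_of_nat)
        have fm: "f \<in> borel_measurable borel" unfolding f_def by measurable
        have fG: "(\<lambda>\<omega>. f (G \<omega>)) \<in> borel_measurable P" by (rule measurable_compose[OF G(1) fm])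
        have AEf: "AE \<omega> in P. of_nat (cone_count q (?n \<omega>)) = f (G \<omega>)"
          using G' by eventually_elim (metis f)
        have "(\<integral>\<^sup>+\<omega>. of_nat (cone_count q (?n \<omega>)) + of_nat C \<partial>P) = (\<integral>\<^sup>+\<omega>. f (G \<omega>) + of_nat C \<partial>P)"
          by (rule nn_integral_cong_AE) (use AEf in \<open>eventually_elim, simp\<close>)
        also have "\<dots> = (\<integral>\<^sup>+\<omega>. f (G \<omega>) \<partial>P) + (\<integral>\<^sup>+\<omega>. of_nat C \<partial>P)"
          using fG by (intro nn_integral_add) auto
        also have "(\<integral>\<^sup>+\<omega>. f (G \<omega>) \<partial>P) = (\<integral>\<^sup>+\<omega>. of_nat (cone_count q (?n \<omega>)) \<partial>P)"
          by (rule nn_integral_cong_AE) (use AEf in \<open>eventually_elim, simp\<close>)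
        finally show ?thesis by (simp add: emeasure_space_1)
      qed
      also have "\<dots> \<le> ennreal ?V * emeasure \<nu> Delta' + of_nat C"
      proof (rule add_right_mono)
        have "(\<integral>\<^sup>+\<omega>. of_nat (cone_count q (?n \<omega>)) \<partial>P)
          = ennreal ?V * ((\<integral>\<^sup>+\<omega>. of_nat (cone_count q (?n \<omega>)) \<partial>P) / ennreal ?V)"
          using V by (simp add: ennreal_times_divide mult_divide_eq_ennreal mult.commute[of "ennreal ?V"] del: of_nat_Suc)
        also have "\<dots> \<le> ennreal ?V * emeasure \<nu> Delta'"
          by (rule mult_left_mono[OF nu_ge_mean_cone_count[OF lim]]) simp_all
        finally show "(\<integral>\<^sup>+\<omega>. of_nat (cone_count q (?n \<omega>)) \<partial>P) \<le> ennreal ?V * emeasure \<nu> Delta'" .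
      qed
      finally have "ennreal (real M * (?V * lam)) \<le> ennreal (?V * v + real C)"
        using v lam V by (simp add: ennreal_of_nat_eq_real_of_nat ennreal_mult del: of_nat_Suc)
      then have "real M * (?V * lam) \<le> ?V * v + real C"
        using v V by (subst (asm) ennreal_le_iff) auto
      then have "real M * lam \<le> v + real C / ?V" using V by (simp add: field_simps del: of_nat_Suc)
      \<comment> \<open>The side is at least 1 and the dimension positive, so the side may replace
        the volume, which makes the limit elementary.\<close>
      moreover have "real C / ?V \<le> real C / ?l"
      proof (rule divide_left_mono)
        show "?l \<le> ?V" using power_increasing[of 1 "CARD('n)" ?l] by (simp del: of_nat_Suc)
      qed (use V in \<open>auto simp del: of_nat_Suc\<close>)
      ultimately show ?thesis by linarith
    qed
    have "(\<lambda>L. v + real C / real (Suc L)) \<longlonglongrightarrow> v + 0"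
      by (intro tendsto_intros LIMSEQ_Suc[OF lim_const_over_n])
    then show ?thesis using step by (intro LIMSEQ_le_const[where X = "\<lambda>L. v + real C / real (Suc L)"]) auto
  qed
  obtain M where "v < real M * lam" using reals_Archimedean3[OF lam(2)] by blast
  with bound[of M] show False by simp
qed

end

theorem theorem4p2:
  fixes P :: "'w measure"
    and \<Phi> :: "'w \<Rightarrow> ((real^'n) \<times> 'm::{t2_space, second_countable_topology}) measure"
    and \<kappa> :: "((real^'n) \<times> 'm) set \<Rightarrow> ennreal"
    and q :: nat
    and \<nu> :: "(ennreal \<times> ennreal) measure"
  assumes "locally_compact_space (euclidean :: 'm topology)"
    and "prob_space P"
    and "marked_point_process P \<Phi>"
    and "stationary P \<Phi>"
    and "all_finite_moments P (\<lambda>\<omega>. ground (\<Phi> \<omega>))"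
    and "filtration_function \<kappa>"
    and "0 < intensity P \<Phi>"
    and "\<And>\<sigma>. finite \<sigma> \<Longrightarrow> \<sigma> \<noteq> {} \<Longrightarrow> \<kappa> \<sigma> < \<infinity>"
    and "limiting_verbose_measure TYPE('f::field) P \<Phi> \<kappa> q \<nu>"
  shows "emeasure \<nu> Delta' = (if q = 0 then intensity P \<Phi> else \<infinity>)"
proof -
  interpret prob_space P by fact
  interpret stationary_process P \<Phi> \<kappa>
    using assms by unfold_locales auto
  show ?thesis
    using assms(7,9) nu_degree_0 nu_positive_degree[of q] by (cases "q = 0") auto
qed

end
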